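(* Let $\mathbb{F}$ be a field and let $X$ be a compact, geodesic and $\mathbb{F}$-semi-locally simply-connected space with $H_1(X,\mathbb{F})=\mathbb{F}^n$. Let $A=\{a_1,\dots,a_n\}$ be a collection of loops in $X$ with lengths $l_i=\operatorname{length}(a_i)$ satisfying $l_i\le l_j$ for all $i<j$. Then $A$ is a lexicographically minimal base for $H_1(X,\mathbb{F})$ if and only if there are isomorphisms of persistences $$\{H_1(\mathrm{Rips}(X,r),\mathbb{F})\}_{r>0}\cong\{H_1(X,\mathbb{F})/\langle[a_1]_{\mathbb{F}},[a_2]_{\mathbb{F}},\dots,[a_{k_r}]_{\mathbb{F}}\rangle\}_{r>0}\cong\bigoplus_{i=1}^n\mathbb{I}_{(0,\,l_i/3]},$$ where $k_r=\max\{i : l_i/3<r\}$ (and $k_r=0$ if there is no such $i$). In such a case the critical values of the persistence are $\{l_i/3\}_{i\in\{1,\dots,n\}}$.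
   Context: A metric space $(X,d)$ is geodesic if any $x,y\in X$ are joined by a path of length $d(x,y)$. A path-connected $X$ is $\mathbb F$-semi-locally simply-connected if every $x\in X$ has a neighborhood $U$ such that the image of $H_1(U,\mathbb F)\to H_1(X,\mathbb F)$ is trivial. $\mathrm{Rips}(X,r)$ is the simplicial complex with vertex set $X$ in which a finite nonempty $\sigma\subset X$ is a simplex iff $\operatorname{diam}(\sigma)<r$. $[a]_{\mathbb F}$ is the class of the loop $a$ in $H_1(X,\mathbb F)$ and $\langle\cdot\rangle$ denotes linear span. A collection of loops $a_1,\dots,a_n$ with $\operatorname{length}(a_i)\le\operatorname{length}(a_j)$ for $i<j$ is a base for $H_1(X,\mathbb F)=\mathbb F^n$ if the classes generate $H_1(X,\mathbb F)$; it is a lexicographically minimal base if its length vector is lexicographically minimal among the length vectors of all bases. Bonding maps are induced by inclusions of Rips complexes (left) and are natural quotient maps (middle). The interval module $\mathbb I_{(0,b]}$ is $\mathbb F$ at $r\in(0,b]$ and $0$ at $r>b$, with identity bonding maps between parameters in $(0,b]$ and zero maps otherwise. An isomorphism of persistences is a family of isomorphisms, one for each $r>0$, commuting with bonding maps. A value $p>0$ is critical if either for all small enough $\varepsilon>0$ the bonding map from $p-\varepsilon$ to $p$ is not an isomorphism, or for all $\varepsilon>0$ the bonding map from $p$ to $p+\varepsilon$ is not an isomorphism. *)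

theory Defs
  imports "HOL-Analysis.Analysis" "HOL-Homology.Homology" "HOL-Algebra.Module"
    "HOL-Algebra.AbelCoset" "HOL-Combinatorics.Permutations" "HOL-Library.Poly_Mapping"
begin

section \<open>Vector spaces over a field type\<close>

text \<open>
  Vector spaces over a type \<open>'f\<close> of class \<open>field\<close> are represented by module records over
  \<open>field_ring\<close>. The record fields \<open>mult\<close> and \<open>one\<close> play no role for modules.
\<close>

definition field_ring :: "'f::field ring" where
  "field_ring = \<lparr>carrier = UNIV, monoid.mult = (*), one = 1, ring.zero = 0, add = (+)\<rparr>"

definition field_module :: "('f::field, 'f) module" where
  "field_module =
     \<lparr>carrier = UNIV, monoid.mult = undefined, one = undefined, ring.zero = 0, add = (+), smult = (*)\<rparr>"

definition chain_module :: "('f::field, 'k \<Rightarrow>\<^sub>0 'f) module" where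
  "chain_module =
     \<lparr>carrier = UNIV, monoid.mult = undefined, one = undefined, ring.zero = 0, add = (+),
      smult = (\<lambda>k. Poly_Mapping.map ((*) k))\<rparr>"

text \<open>
  The elements of \<open>M / W\<close> are the cosets of \<open>W\<close>. Adding \<open>W\<close> in the scalar multiplication matters
  only for the scalar 0.
\<close>

definition quotient_module :: "('f, 'v) module \<Rightarrow> 'v set \<Rightarrow> ('f, 'v set) module" where
  "quotient_module M W =
     \<lparr>carrier = a_rcosets\<^bsub>M\<^esub> W, monoid.mult = undefined, one = undefined,
      ring.zero = W, add = set_add M, smult = (\<lambda>k C. W <+>\<^bsub>M\<^esub> ((\<lambda>x. k \<odot>\<^bsub>M\<^esub> x) ` C))\<rparr>"

definition module_span :: "('f::field, 'v) module \<Rightarrow> 'v set \<Rightarrow> 'v set" where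
  "module_span M S = \<Inter>{W. submodule W field_ring M \<and> S \<subseteq> W}"

definition direct_sum_module :: "'i set \<Rightarrow> ('i \<Rightarrow> ('f, 'v) module) \<Rightarrow> ('f, 'i \<Rightarrow> 'v) module" where
  "direct_sum_module I M =
     \<lparr>carrier = {x \<in> \<Pi>\<^sub>E i\<in>I. carrier (M i). finite {i \<in> I. x i \<noteq> \<zero>\<^bsub>M i\<^esub>}},
      monoid.mult = undefined, one = undefined,
      ring.zero = (\<lambda>i\<in>I. \<zero>\<^bsub>M i\<^esub>), add = (\<lambda>x y. \<lambda>i\<in>I. x i \<oplus>\<^bsub>M i\<^esub> y i),
      smult = (\<lambda>k x. \<lambda>i\<in>I. k \<odot>\<^bsub>M i\<^esub> x i)\<rparr>"

definition linear_iso :: "('f, 'v) module \<Rightarrow> ('f, 'w) module \<Rightarrow> ('v \<Rightarrow> 'w) \<Rightarrow> bool" where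
  "linear_iso M N h \<longleftrightarrow>
     bij_betw h (carrier M) (carrier N) \<and>
     (\<forall>x\<in>carrier M. \<forall>y\<in>carrier M. h (x \<oplus>\<^bsub>M\<^esub> y) = h x \<oplus>\<^bsub>N\<^esub> h y) \<and>
     (\<forall>k. \<forall>x\<in>carrier M. h (k \<odot>\<^bsub>M\<^esub> x) = k \<odot>\<^bsub>N\<^esub> h x)"

definition isomorphic_modules :: "('f, 'v) module \<Rightarrow> ('f, 'w) module \<Rightarrow> bool" where
  "isomorphic_modules M N \<longleftrightarrow> (\<exists>h. linear_iso M N h)"


section \<open>Homology with coefficients in a field\<close>

definition homology_module ::
  "('k \<Rightarrow>\<^sub>0 'f::field) set \<Rightarrow> ('k \<Rightarrow>\<^sub>0 'f) set \<Rightarrow> ('f, ('k \<Rightarrow>\<^sub>0 'f) set) module" where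
  "homology_module Z B = quotient_module (chain_module\<lparr>carrier := Z\<rparr>) B"

text \<open>
  For \<open>Z \<subseteq> Z'\<close> and \<open>B \<subseteq> B'\<close>, the induced map \<open>Z/B \<rightarrow> Z'/B'\<close> sends \<open>z + B\<close> to
  \<open>z + B' = B' + (z + B)\<close>.
\<close>

definition coset_map :: "('f, 'v) module \<Rightarrow> 'v set \<Rightarrow> 'v set \<Rightarrow> 'v set" where
  "coset_map M B' C = B' <+>\<^bsub>M\<^esub> C"

subsection \<open>Singular homology\<close>

type_synonym ('a, 'f) schain = "((nat \<Rightarrow> real) \<Rightarrow> 'a) \<Rightarrow>\<^sub>0 'f"

definition singular_chains :: "nat \<Rightarrow> 'a topology \<Rightarrow> ('a, 'f::field) schain set" where
  "singular_chains p T = {c. Poly_Mapping.keys c \<subseteq> singular_simplex_set p T}"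

definition singular_bd :: "nat \<Rightarrow> ('a, 'f::field) schain \<Rightarrow> ('a, 'f) schain" where
  "singular_bd p c =
     (if p = 0 then 0 else
        \<Sum>f\<in>Poly_Mapping.keys c. \<Sum>k\<le>p.
          Poly_Mapping.single (singular_face p k f) ((-1) ^ k * Poly_Mapping.lookup c f))"

definition singular_cycles :: "nat \<Rightarrow> 'a topology \<Rightarrow> ('a, 'f::field) schain set" where
  "singular_cycles p T = {c \<in> singular_chains p T. singular_bd p c = 0}"

definition singular_boundaries :: "nat \<Rightarrow> 'a topology \<Rightarrow> ('a, 'f::field) schain set" where
  "singular_boundaries p T = singular_bd (Suc p) ` singular_chains (Suc p) T"

definition singular_homology ::
  "nat \<Rightarrow> 'a topology \<Rightarrow> ('f::field, ('a, 'f) schain set) module" where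
  "singular_homology p T = homology_module (singular_cycles p T) (singular_boundaries p T)"

subsection \<open>Simplicial homology\<close>

text \<open>
  A simplicial complex is given by its set \<open>K\<close> of simplices. An oriented \<open>p\<close>-chain is a finitely
  supported function on the orderings \<open>[x\<^sub>0,\<dots>,x\<^sub>p]\<close> of the \<open>p\<close>-simplices of \<open>K\<close> that changes by the
  sign of the permutation when the vertices are permuted. Distinctness of the vertices has to be
  required separately in characteristic 2. The oriented simplex \<open>[x\<^sub>0,\<dots>,x\<^sub>p]\<close> is the alternating
  function with value 1 at \<open>[x\<^sub>0,\<dots>,x\<^sub>p]\<close> that is supported on the permutations of this list.
\<close>

definition oriented_chains :: "nat \<Rightarrow> 'a set set \<Rightarrow> ('a list \<Rightarrow>\<^sub>0 'f::field) set" where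
  "oriented_chains p K =
     {c. (\<forall>xs\<in>Poly_Mapping.keys c. length xs = Suc p \<and> distinct xs \<and> set xs \<in> K) \<and>
         (\<forall>xs \<pi>. \<pi> permutes {..<length xs} \<longrightarrow>
            Poly_Mapping.lookup c (permute_list \<pi> xs) = of_int (sign \<pi>) * Poly_Mapping.lookup c xs)}"

text \<open>
  The coefficient of \<open>\<partial>c\<close> at \<open>ys\<close> is \<open>\<Sum>x. c (x # ys)\<close>; in terms of oriented simplices this is the
  usual \<open>\<partial>[x\<^sub>0,\<dots>,x\<^sub>p] = \<Sum>i. (-1)^i [x\<^sub>0,\<dots>,x\<^sub>i\<^sub>-\<^sub>1,x\<^sub>i\<^sub>+\<^sub>1,\<dots>,x\<^sub>p]\<close>, since moving \<open>x\<^sub>i\<close> to the front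
  costs the sign \<open>(-1)^i\<close>.
\<close>

definition oriented_bd :: "nat \<Rightarrow> ('a list \<Rightarrow>\<^sub>0 'f::field) \<Rightarrow> ('a list \<Rightarrow>\<^sub>0 'f)" where
  "oriented_bd p c =
     (if p = 0 then 0 else
        \<Sum>xs\<in>Poly_Mapping.keys c. Poly_Mapping.single (tl xs) (Poly_Mapping.lookup c xs))"

definition oriented_cycles :: "nat \<Rightarrow> 'a set set \<Rightarrow> ('a list \<Rightarrow>\<^sub>0 'f::field) set" where
  "oriented_cycles p K = {c \<in> oriented_chains p K. oriented_bd p c = 0}"

definition oriented_boundaries :: "nat \<Rightarrow> 'a set set \<Rightarrow> ('a list \<Rightarrow>\<^sub>0 'f::field) set" where
  "oriented_boundaries p K = oriented_bd (Suc p) ` oriented_chains (Suc p) K"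

definition complex_homology ::
  "nat \<Rightarrow> 'a set set \<Rightarrow> ('f::field, ('a list \<Rightarrow>\<^sub>0 'f) set) module" where
  "complex_homology p K = homology_module (oriented_cycles p K) (oriented_boundaries p K)"


section \<open>Metric notions\<close>

definition path_length :: "(real \<Rightarrow> 'a::metric_space) \<Rightarrow> ennreal" where
  "path_length g =
     (SUP (m, t) \<in> {(m::nat, t::nat \<Rightarrow> real). mono_on {..m} t \<and> t ` {..m} \<subseteq> {0..1}}.
        \<Sum>i<m. ennreal (dist (g (t i)) (g (t (Suc i)))))"

definition geodesic_space :: "'a::metric_space set \<Rightarrow> bool" where
  "geodesic_space X \<longleftrightarrow>
     (\<forall>x\<in>X. \<forall>y\<in>X. \<exists>g. path g \<and> path_image g \<subseteq> X \<and> pathstart g = x \<and> pathfinish g = y \<and>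
        path_length g = ennreal (dist x y))"

definition Rips :: "'a::metric_space set \<Rightarrow> real \<Rightarrow> 'a set set" where
  "Rips X r = {\<sigma>. finite \<sigma> \<and> \<sigma> \<noteq> {} \<and> \<sigma> \<subseteq> X \<and> diameter \<sigma> < r}"

text \<open>The neighbourhood \<open>U\<close> need not be open.\<close>

definition semi_locally_simply_connected :: "'f::field itself \<Rightarrow> 'a::metric_space set \<Rightarrow> bool" where
  "semi_locally_simply_connected (F :: 'f itself) X \<longleftrightarrow>
     path_connected X \<and>
     (\<forall>x\<in>X. \<exists>U V. openin (top_of_set X) V \<and> x \<in> V \<and> V \<subseteq> U \<and> U \<subseteq> X \<and>
        coset_map chain_module (singular_boundaries 1 (top_of_set X)) `
          carrier (singular_homology 1 (top_of_set U) :: ('f, _) module) =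
        {\<zero>\<^bsub>(singular_homology 1 (top_of_set X) :: ('f, _) module)\<^esub>})"


section \<open>Loops and bases\<close>

definition loop_in :: "'a::topological_space set \<Rightarrow> (real \<Rightarrow> 'a) \<Rightarrow> bool" where
  "loop_in X g \<longleftrightarrow> path g \<and> path_image g \<subseteq> X \<and> pathfinish g = pathstart g"

text \<open>
  The path \<open>g\<close> as a singular 1-simplex: the point with barycentric coordinates \<open>(1 - s, s)\<close> is sent
  to \<open>g s\<close>.
\<close>

definition path_simplex :: "(real \<Rightarrow> 'a) \<Rightarrow> (nat \<Rightarrow> real) \<Rightarrow> 'a" where
  "path_simplex g = restrict (\<lambda>t. g (t 1)) (standard_simplex 1)"

definition loop_class ::
  "'a::metric_space set \<Rightarrow> (real \<Rightarrow> 'a) \<Rightarrow> ('a, 'f::field) schain set" where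
  "loop_class X g =
     singular_boundaries 1 (top_of_set X) +>\<^bsub>chain_module\<^esub> Poly_Mapping.single (path_simplex g) 1"

definition homology_base ::
  "'f::field itself \<Rightarrow> 'a::metric_space set \<Rightarrow> nat \<Rightarrow> (nat \<Rightarrow> real \<Rightarrow> 'a) \<Rightarrow> bool" where
  "homology_base (F :: 'f itself) X n a \<longleftrightarrow>
     (\<forall>i\<in>{1..n}. loop_in X (a i)) \<and>
     (\<forall>i\<in>{1..n}. \<forall>j\<in>{1..n}. i < j \<longrightarrow> path_length (a i) \<le> path_length (a j)) \<and>
     module_span (singular_homology 1 (top_of_set X) :: ('f, _) module)
       ((\<lambda>i. loop_class X (a i)) ` {1..n}) =
     carrier (singular_homology 1 (top_of_set X) :: ('f, _) module)"

definition length_vector :: "nat \<Rightarrow> (nat \<Rightarrow> real \<Rightarrow> 'a::metric_space) \<Rightarrow> ennreal list" where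
  "length_vector n a = map (\<lambda>i. path_length (a i)) [1..<Suc n]"

definition lex_minimal_base ::
  "'f::field itself \<Rightarrow> 'a::metric_space set \<Rightarrow> nat \<Rightarrow> (nat \<Rightarrow> real \<Rightarrow> 'a) \<Rightarrow> bool" where
  "lex_minimal_base F X n a \<longleftrightarrow>
     homology_base F X n a \<and>
     (\<forall>b. homology_base F X n b \<longrightarrow> \<not> ord_class.lexordp (length_vector n b) (length_vector n a))"


section \<open>Persistences\<close>

text \<open>
  Only the levels at \<open>r > 0\<close> and the bonding maps \<open>bond P r s\<close> for \<open>0 < r \<le> s\<close>, restricted to
  \<open>carrier (level P r)\<close>, are meaningful.
\<close>

record ('f, 'v) persistence =
  level :: "real \<Rightarrow> ('f, 'v) module"
  bond :: "real \<Rightarrow> real \<Rightarrow> 'v \<Rightarrow> 'v"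

definition isomorphic_persistences ::
  "('f, 'v) persistence \<Rightarrow> ('f, 'w) persistence \<Rightarrow> bool" where
  "isomorphic_persistences P Q \<longleftrightarrow>
     (\<exists>h. (\<forall>r>0. linear_iso (level P r) (level Q r) (h r)) \<and>
          (\<forall>r>0. \<forall>s\<ge>r. \<forall>x\<in>carrier (level P r). h s (bond P r s x) = bond Q r s (h r x)))"

definition bond_iso :: "('f, 'v) persistence \<Rightarrow> real \<Rightarrow> real \<Rightarrow> bool" where
  "bond_iso P r s \<longleftrightarrow> linear_iso (level P r) (level P s) (bond P r s)"

definition critical_value :: "('f, 'v) persistence \<Rightarrow> real \<Rightarrow> bool" where
  "critical_value P p \<longleftrightarrow>
     p > 0 \<and>
     ((\<forall>\<^sub>F \<epsilon> in at_right 0. \<not> bond_iso P (p - \<epsilon>) p) \<or> (\<forall>\<epsilon>>0. \<not> bond_iso P p (p + \<epsilon>)))"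

definition Rips_persistence ::
  "'a::metric_space set \<Rightarrow> ('f::field, ('a list \<Rightarrow>\<^sub>0 'f) set) persistence" where
  "Rips_persistence X =
     \<lparr>level = (\<lambda>r. complex_homology 1 (Rips X r)),
      bond = (\<lambda>r s. coset_map chain_module (oriented_boundaries 1 (Rips X s)))\<rparr>"

definition num_below :: "nat \<Rightarrow> (nat \<Rightarrow> real \<Rightarrow> 'a::metric_space) \<Rightarrow> real \<Rightarrow> nat" where
  "num_below n a r =
     (let I = {i \<in> {1..n}. path_length (a i) / 3 < ennreal r} in if I = {} then 0 else Max I)"

definition loop_span ::
  "'a::metric_space set \<Rightarrow> nat \<Rightarrow> (nat \<Rightarrow> real \<Rightarrow> 'a) \<Rightarrow> real \<Rightarrow> ('a, 'f::field) schain set set" where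
  "loop_span X n a r =
     module_span (singular_homology 1 (top_of_set X)) ((\<lambda>i. loop_class X (a i)) ` {1..num_below n a r})"

definition quotient_persistence ::
  "'a::metric_space set \<Rightarrow> nat \<Rightarrow> (nat \<Rightarrow> real \<Rightarrow> 'a) \<Rightarrow>
     ('f::field, ('a, 'f) schain set set) persistence" where
  "quotient_persistence X n a =
     \<lparr>level = (\<lambda>r. quotient_module (singular_homology 1 (top_of_set X)) (loop_span X n a r)),
      bond = (\<lambda>r s. coset_map (singular_homology 1 (top_of_set X)) (loop_span X n a s))\<rparr>"

text \<open>The interval module over \<open>(0, b]\<close>; for \<open>b = \<infinity>\<close> the interval is \<open>(0, \<infinity>)\<close>.\<close>

definition interval_persistence :: "ennreal \<Rightarrow> ('f::field, 'f) persistence" where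
  "interval_persistence b =
     \<lparr>level = (\<lambda>r. if 0 < r \<and> ennreal r \<le> b then field_module else field_module\<lparr>carrier := {0}\<rparr>),
      bond = (\<lambda>r s x. if 0 < r \<and> ennreal r \<le> b \<and> 0 < s \<and> ennreal s \<le> b then x else 0)\<rparr>"

definition direct_sum_persistence ::
  "'i set \<Rightarrow> ('i \<Rightarrow> ('f, 'v) persistence) \<Rightarrow> ('f, 'i \<Rightarrow> 'v) persistence" where
  "direct_sum_persistence I P =
     \<lparr>level = (\<lambda>r. direct_sum_module I (\<lambda>i. level (P i) r)),
      bond = (\<lambda>r s x. \<lambda>i\<in>I. bond (P i) r s (x i))\<rparr>"

end

theory Submission
  imports Defs
begin

text \<open>
  Replacing the edges of a cycle of \<open>Rips(X, r)\<close> by geodesics turns it into a singular cycle and turns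
  the boundary of a triangle into a loop of length less than \<open>3r\<close>. Conversely, a compact semi-locally
  simply-connected space is so uniformly, hence every singular cycle is homologous to a geodesic
  polygon with short edges. It remains to see that a Rips cycle is a boundary if its realization is
  homologous to a combination of loops of length less than \<open>3r\<close>. Otherwise it is detected by a
  simplicial cocycle, i.e. a function \<open>\<phi>(x, y)\<close> of points at distance less than \<open>r\<close>, which can be
  integrated along paths. The integral vanishes on singular boundaries, because the cocycle has a
  primitive on a simplex, and on loops of length less than \<open>3r\<close>, because a fine polygon inscribed in
  such a loop splits into three arcs of length less than \<open>r\<close>. So \<open>H\<^sub>1(Rips(X, r))\<close> is the quotient of
  \<open>H\<^sub>1(X)\<close> by the span of the loops of length less than \<open>3r\<close>. For a lexicographically minimal base
  this span is \<open>\<langle>a\<^sub>1, \<dots>, a\<^sub>k\<rangle>\<close> with \<open>k = k\<^sub>r\<close> by an exchange argument, and conversely the dimensions of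
  these spans determine the minimal length vector.
\<close>

\<comment> \<open>The three persistences are compared through one vector space, the singular
  1-cycles of \<open>X\<close>: each gets compatible linear surjections from it onto all its levels.
  A persistence so given is determined up to isomorphism by the kernels, so the theorem becomes an
  equality of subspaces, and cosets (in the quotients, cosets of cosets) are handled only once.
  Injectivity is the hard half. A filling of the realization is a singular 2-chain with large
  simplices, and turning it into Rips triangles would require subdividing it compatibly along common
  faces. A dual cocycle needs no subdivision: pulled back to each simplex separately it is exact,
  and the faces cancel because the integral depends on the path alone. The converse implication
  starts without knowing that the given loops generate, or even that they have finite length. Both
  are read off at a scale beyond the diameter of \<open>X\<close>, where every Rips cycle bounds.
  Minimality then follows by counting, since the levels of the Rips persistence do not depend on the
  chosen loops.\<close>
alias keys = Poly_Mapping.keys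
alias lookup = Poly_Mapping.lookup
alias single = Poly_Mapping.single

section \<open>Linear algebra of finitely supported functions\<close>

abbreviation chain_scale :: "'f::field \<Rightarrow> ('k \<Rightarrow>\<^sub>0 'f) \<Rightarrow> ('k \<Rightarrow>\<^sub>0 'f)" where
  "chain_scale k \<equiv> Poly_Mapping.map ((*) k)"

lemma lookup_chain_scale [simp]:
  "lookup (chain_scale k c) x = k * lookup c x"
  by (simp add: Poly_Mapping.map.rep_eq when_def)

text \<open>The scalar multiplication \<open>s\<close> is a parameter because the values are
  sometimes chains, with \<open>chain_scale\<close>, and sometimes scalars, with the multiplication
  of the field.\<close>

definition lin_ext ::
  "('f \<Rightarrow> 'v \<Rightarrow> 'v) \<Rightarrow> ('k \<Rightarrow> 'v::comm_monoid_add) \<Rightarrow> ('k \<Rightarrow>\<^sub>0 'f::zero) \<Rightarrow> 'v" where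
  "lin_ext s f c = (\<Sum>k\<in>keys c. s (lookup c k) (f k))"

context vector_space
begin

lemma lin_ext_superset:
  assumes "finite S" "keys c \<subseteq> S"
  shows "lin_ext scale f c = (\<Sum>k\<in>S. scale (lookup c k) (f k))"
  unfolding lin_ext_def
  by (rule sum.mono_neutral_left) (use assms in \<open>auto simp: in_keys_iff\<close>)

lemma lin_ext_zero [simp]: "lin_ext scale f 0 = 0"
  by (simp add: lin_ext_def)

lemma lin_ext_single [simp]: "lin_ext scale f (single k a) = scale a (f k)"
  by (simp add: lin_ext_superset[where S = "{k}"] lookup_single)

lemma lin_ext_add: "lin_ext scale f (c + d) = lin_ext scale f c + lin_ext scale f d"
proof -
  let ?S = "keys c \<union> keys d"
  have "lin_ext scale f (c + d) = (\<Sum>k\<in>?S. scale (lookup (c + d) k) (f k))"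
    by (rule lin_ext_superset) (use keys_add[of c d] in auto)
  also have "\<dots> = (\<Sum>k\<in>?S. scale (lookup c k) (f k)) +
      (\<Sum>k\<in>?S. scale (lookup d k) (f k))"
    by (simp add: lookup_add scale_left_distrib sum.distrib)
  also have "\<dots> = lin_ext scale f c + lin_ext scale f d"
    by (simp add: lin_ext_superset[where S = ?S])
  finally show ?thesis .
qed

lemma lin_ext_scale: "lin_ext scale f (chain_scale a c) = scale a (lin_ext scale f c)"
  by (subst lin_ext_superset[where S = "keys c"])
    (auto simp: lin_ext_def scale_sum_right in_keys_iff)

lemma lin_ext_minus: "lin_ext scale f (- c) = - lin_ext scale f c"
  using lin_ext_add[of f c "- c"] by (simp add: eq_neg_iff_add_eq_0 add.commute)

lemma lin_ext_diff: "lin_ext scale f (c - d) = lin_ext scale f c - lin_ext scale f d"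
  using lin_ext_add[of f c "- d"] by (simp add: lin_ext_minus)

lemma lin_ext_sum: "lin_ext scale f (\<Sum>i\<in>I. g i) = (\<Sum>i\<in>I. lin_ext scale f (g i))"
  by (induction I rule: infinite_finite_induct) (auto simp: lin_ext_add)

end

interpretation chains: vector_space "chain_scale :: 'f::field \<Rightarrow> ('k \<Rightarrow>\<^sub>0 'f) \<Rightarrow> _"
  by unfold_locales (auto intro!: poly_mapping_eqI simp: lookup_add algebra_simps)

lemma chain_eq_sum_single:
  "c = (\<Sum>k\<in>keys c. single k (lookup c k))"
  by (rule poly_mapping_eqI) (auto simp: lookup_sum lookup_single when_def in_keys_iff)

lemma chain_scale_single [simp]:
  "chain_scale k (single x a) = single x (k * a)"
  by (rule poly_mapping_eqI) (simp add: lookup_single when_def)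

lemmas chain_subspaceD = chains.subspace_0 chains.subspace_add chains.subspace_diff
  chains.subspace_scale chains.subspace_neg

text \<open>A basis of \<open>B\<close> stays independent when \<open>c\<close> is added, so a
  functional can be prescribed as 0 on the basis and 1 at \<open>c\<close>. It is handed over by its
  values on the generators, in which form \<open>lin_ext\<close> makes it linear by
  construction.\<close>

lemma chain_functional_exists:
  fixes c :: "'k \<Rightarrow>\<^sub>0 'f::field"
  assumes "chains.subspace B" "c \<notin> B"
  obtains f :: "'k \<Rightarrow> 'f" where "\<And>b. b \<in> B \<Longrightarrow> lin_ext (*) f b = 0" "lin_ext (*) f c = 1"
proof -
  interpret vp: vector_space_pair "chain_scale :: 'f \<Rightarrow> ('k \<Rightarrow>\<^sub>0 'f) \<Rightarrow> _" "(*) :: 'f \<Rightarrow> 'f \<Rightarrow> 'f"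
    by unfold_locales
  obtain D where D: "D \<subseteq> B" "chains.independent D" and "B \<subseteq> chains.span D"
    by (rule chains.maximal_independent_subset)
  then have D_span: "chains.span D = B"
    using assms(1) by (intro chains.span_subspace)
  have ind: "chains.independent (insert c D)"
    using D D_span assms(2) by (intro chains.independent_insertI) auto
  define g where "g = vp.construct (insert c D) (\<lambda>x. if x = c then 1 else 0 :: 'f)"
  have lin: "Vector_Spaces.linear chain_scale (*) g"
    unfolding g_def using ind by (rule vp.linear_construct)
  then interpret g: Vector_Spaces.linear "chain_scale :: 'f \<Rightarrow> ('k \<Rightarrow>\<^sub>0 'f) \<Rightarrow> _" "(*)" g .
  have gc: "g c = 1"
    unfolding g_def by (subst vp.construct_basis) (use ind in auto)
  have "g x = 0" if "x \<in> D" for x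
    unfolding g_def by (subst vp.construct_basis) (use ind that D assms in auto)
  then have gB: "g b = 0" if "b \<in> B" for b
    using that D_span g.eq_0_on_span by blast
  have g: "lin_ext (*) (\<lambda>k. g (single k 1)) x = g x" for x
  proof -
    have "g x = (\<Sum>k\<in>keys x. g (chain_scale (lookup x k) (single k 1)))"
      by (subst chain_eq_sum_single[of x]) (simp add: g.sum)
    also have "\<dots> = (\<Sum>k\<in>keys x. lookup x k * g (single k 1))"
      by (simp only: g.scale)
    finally show ?thesis by (simp only: lin_ext_def)
  qed
  show thesis by (rule that[of "\<lambda>k. g (single k 1)"]) (simp_all only: g gB gc)
qed


section \<open>Presentations of modules by vector spaces of chains\<close>

text \<open>A linear surjection \<open>q\<close> of \<open>Z\<close> onto \<open>M\<close> with
  kernel \<open>K\<close>, so that \<open>M\<close> is a copy of \<open>Z/K\<close>. No module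
  axioms are asked of the record \<open>M\<close>; all of its algebra is pulled back to
  chains.\<close>

definition presents ::
  "('k \<Rightarrow>\<^sub>0 'f::field) set \<Rightarrow> ('k \<Rightarrow>\<^sub>0 'f) set \<Rightarrow> ('f, 'v) module \<Rightarrow> (('k \<Rightarrow>\<^sub>0 'f) \<Rightarrow> 'v) \<Rightarrow> bool" where
  "presents Z K M q \<longleftrightarrow>
     chains.subspace Z \<and> chains.subspace K \<and> q ` Z = carrier M \<and> q 0 = \<zero>\<^bsub>M\<^esub> \<and>
     (\<forall>x\<in>Z. \<forall>y\<in>Z. q (x + y) = q x \<oplus>\<^bsub>M\<^esub> q y) \<and>
     (\<forall>k. \<forall>x\<in>Z. q (chain_scale k x) = k \<odot>\<^bsub>M\<^esub> q x) \<and>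
     (\<forall>x\<in>Z. \<forall>y\<in>Z. q x = q y \<longleftrightarrow> x - y \<in> K)"

lemma presentsD:
  assumes "presents Z K M q"
  shows "chains.subspace Z" "chains.subspace K" "q ` Z = carrier M" "q 0 = \<zero>\<^bsub>M\<^esub>"
    "x \<in> Z \<Longrightarrow> y \<in> Z \<Longrightarrow> q (x + y) = q x \<oplus>\<^bsub>M\<^esub> q y"
    "x \<in> Z \<Longrightarrow> q (chain_scale k x) = k \<odot>\<^bsub>M\<^esub> q x"
    "x \<in> Z \<Longrightarrow> y \<in> Z \<Longrightarrow> q x = q y \<longleftrightarrow> x - y \<in> K"
    "x \<in> Z \<Longrightarrow> q x \<in> carrier M"
  using assms unfolding presents_def by blast+

lemma coset_of_presented:
  assumes P: "presents Z K M q" and L: "L \<subseteq> Z" and z: "z \<in> Z"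
  shows "q ` L +>\<^bsub>M\<^esub> q z = (\<lambda>l. q (l + z)) ` L"
  using presentsD(5)[OF P] L z
  by (auto simp: a_r_coset_def' image_iff subset_iff)

text \<open>The coset of \<open>q z\<close> is the image of \<open>z + L\<close>, so the kernel
  grows from \<open>K\<close> to \<open>L\<close>. This is the third isomorphism theorem in terms of
  representatives: homology is the case \<open>K = {0}\<close>, and the quotient persistence applies
  it once more to homology.\<close>

lemma presents_quotient:
  assumes P: "presents Z K M q" and L: "chains.subspace L" "K \<subseteq> L" "L \<subseteq> Z"
  shows "presents Z L (quotient_module M (q ` L)) (\<lambda>z. q ` L +>\<^bsub>M\<^esub> q z)"
proof -
  note D = presentsD[OF P]
  note Z = chain_subspaceD[OF D(1)]
  note LL = chain_subspaceD[OF L(1)]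
  let ?c = "\<lambda>z. q ` L +>\<^bsub>M\<^esub> q z"
  have c: "?c z = (\<lambda>l. q (l + z)) ` L" if "z \<in> Z" for z
    using coset_of_presented[OF P L(3) that] .
  have LZ: "l \<in> Z" if "l \<in> L" for l using that L(3) by auto
  have eq: "?c x = ?c y \<longleftrightarrow> x - y \<in> L" if x: "x \<in> Z" and y: "y \<in> Z" for x y
  proof
    assume "?c x = ?c y"
    moreover have "q (0 + x) \<in> (\<lambda>l. q (l + x)) ` L" using LL(1) by (rule imageI)
    ultimately obtain l where l: "l \<in> L" "q x = q (l + y)" by (auto simp: c[OF x] c[OF y])
    then have "x - (l + y) \<in> K" using D(7) x y Z LZ by simp
    then have "(x - (l + y)) + l \<in> L" using L l LL by blast
    then show "x - y \<in> L" by (simp add: algebra_simps)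
  next
    assume xy: "x - y \<in> L"
    have "q (l + x) \<in> (\<lambda>l. q (l + y)) ` L" if "l \<in> L" for l
      using LL(2)[OF that xy] by (intro image_eqI[of _ _ "l + (x - y)"]) auto
    moreover have "q (l + y) \<in> (\<lambda>l. q (l + x)) ` L" if "l \<in> L" for l
      using LL(3)[OF that xy] by (intro image_eqI[of _ _ "l - (x - y)"]) auto
    ultimately show "?c x = ?c y" by (auto simp: c[OF x] c[OF y])
  qed
  have add: "?c (x + y) = ?c x <+>\<^bsub>M\<^esub> ?c y" if x: "x \<in> Z" and y: "y \<in> Z" for x y
  proof -
    have "?c x <+>\<^bsub>M\<^esub> ?c y = (\<Union>l\<in>L. \<Union>l'\<in>L. {q (l + x) \<oplus>\<^bsub>M\<^esub> q (l' + y)})"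
      by (simp add: c x y set_add_def')
    also have "\<dots> = (\<Union>l\<in>L. \<Union>l'\<in>L. {q ((l + l') + (x + y))})"
      using x y LZ Z D(5) by (intro SUP_cong refl) (simp add: algebra_simps flip: D(5))
    also have "\<dots> = (\<lambda>l. q (l + (x + y))) ` L"
    proof (safe, goal_cases)
      case (1 _ l l') then show ?case using LL(2) by blast
    next
      case (2 _ l) then show ?case using LL(1) by (intro UN_I[of l] UN_I[of 0]) auto
    qed
    finally show ?thesis by (simp add: c x y Z)
  qed
  have smult: "?c (chain_scale k x) = q ` L <+>\<^bsub>M\<^esub> ((\<lambda>m. k \<odot>\<^bsub>M\<^esub> m) ` ?c x)" if x: "x \<in> Z" for k x
  proof -
    have "q ` L <+>\<^bsub>M\<^esub> ((\<lambda>m. k \<odot>\<^bsub>M\<^esub> m) ` ?c x) = (\<Union>l\<in>L. \<Union>l'\<in>L. {q l \<oplus>\<^bsub>M\<^esub> (k \<odot>\<^bsub>M\<^esub> q (l' + x))})"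
      by (simp add: c x set_add_def')
    also have "\<dots> = (\<Union>l\<in>L. \<Union>l'\<in>L. {q ((l + chain_scale k l') + chain_scale k x)})"
      using x LZ Z
      by (intro SUP_cong refl) (simp add: chains.scale_right_distrib add.assoc flip: D(5) D(6))
    also have "\<dots> = (\<lambda>l. q (l + chain_scale k x)) ` L"
    proof (safe, goal_cases)
      case (1 _ l l') then show ?case using LL(2,4) by blast
    next
      case (2 _ l) then show ?case using LL(1) by (intro UN_I[of l] UN_I[of 0]) auto
    qed
    finally show ?thesis by (simp add: c x Z)
  qed
  have "?c ` Z = carrier (quotient_module M (q ` L))"
    by (auto simp: quotient_module_def A_RCOSETS_def' simp flip: D(3))
  moreover have "?c 0 = q ` L"
    using c[OF Z(1)] by simp
  ultimately show ?thesis
    unfolding presents_def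
    using D(1) L(1) eq add smult by (auto simp: quotient_module_def)
qed

text \<open>Adding the larger \<open>L'\<close> absorbs the coset of \<open>L\<close>, so the
  bonding maps between quotients act as the identity on representatives.\<close>

lemma coset_map_presented:
  assumes P: "presents Z K M q" and L: "L \<subseteq> L'" "L' \<subseteq> Z" "0 \<in> L" "chains.subspace L'" and z: "z \<in> Z"
  shows "coset_map M (q ` L') (q ` L +>\<^bsub>M\<^esub> q z) = q ` L' +>\<^bsub>M\<^esub> q z"
proof -
  note D = presentsD[OF P]
  note Z = chain_subspaceD[OF D(1)]
  note LL = chain_subspaceD[OF L(4)]
  have "coset_map M (q ` L') (q ` L +>\<^bsub>M\<^esub> q z) = (\<Union>l'\<in>L'. \<Union>l\<in>L. {q l' \<oplus>\<^bsub>M\<^esub> q (l + z)})"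
    using L by (subst coset_of_presented[OF P _ z]) (auto simp: coset_map_def set_add_def')
  also have "\<dots> = (\<Union>l'\<in>L'. \<Union>l\<in>L. {q ((l' + l) + z)})"
    using L Z z by (intro SUP_cong refl) (auto simp: add.assoc subset_iff simp flip: D(5))
  also have "\<dots> = (\<lambda>l. q (l + z)) ` L'"
  proof (safe, goal_cases)
    case (1 _ l l') then show ?case using LL(2) L by blast
  next
    case (2 _ l) then show ?case using L by (intro UN_I[of l] UN_I[of 0]) auto
  qed
  finally show ?thesis using coset_of_presented[OF P L(2) z] by simp
qed

lemma presents_chains:
  "chains.subspace Z \<Longrightarrow> presents Z {0} (chain_module\<lparr>carrier := Z\<rparr>) (\<lambda>z. z)"
  by (simp add: presents_def chain_module_def chains.subspace_single_0)

lemma presents_homology: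
  assumes "chains.subspace Z" "chains.subspace B" "B \<subseteq> Z"
  shows "presents Z B (homology_module Z B) (\<lambda>z. B +>\<^bsub>chain_module\<^esub> z)"
proof -
  have "B +>\<^bsub>chain_module\<lparr>carrier := Z\<rparr>\<^esub> z = B +>\<^bsub>chain_module\<^esub> z" for z
    by (simp add: a_r_coset_def' chain_module_def)
  moreover have "{0} \<subseteq> B" using chain_subspaceD(1)[OF assms(2)] by simp
  ultimately show ?thesis
    using presents_quotient[OF presents_chains[OF assms(1)] assms(2) _ assms(3)]
    by (simp add: homology_module_def)
qed

lemma coset_map_chains:
  fixes B :: "('k \<Rightarrow>\<^sub>0 'f::field) set"
  assumes "chains.subspace B" "chains.subspace B'" "B \<subseteq> B'"
  shows "coset_map chain_module B' (B +>\<^bsub>chain_module\<^esub> z) = B' +>\<^bsub>chain_module\<^esub> z"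
proof -
  have *: "chain_module\<lparr>carrier := UNIV\<rparr> = (chain_module :: ('f, 'k \<Rightarrow>\<^sub>0 'f) module)"
    by (simp add: chain_module_def)
  show ?thesis
    using coset_map_presented[OF presents_chains[OF chains.subspace_UNIV], of B B' z] assms
      chain_subspaceD(1)[OF assms(1)]
    by (simp add: *)
qed

text \<open>The inverse is a definite description over the carrier, and \<open>M\<close> is not
  known to be a group, so its uniqueness is derived from representatives. It is needed to recognize
  submodules.\<close>

lemma presented_minus:
  assumes P: "presents Z K M q" and x: "x \<in> Z"
  shows "inv\<^bsub>add_monoid M\<^esub> (q x) = q (- x)"
proof -
  note D = presentsD[OF P]
  note Z = chain_subspaceD[OF D(1)]
  show ?thesis
    unfolding m_inv_def
  proof (rule the_equality, goal_cases)
    case 1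
    show ?case using D(4,8) x Z by (simp flip: D(5))
  next
    case (2 y)
    then obtain v where v: "v \<in> Z" "y = q v" using D(3) by auto
    with 2 have "q (x + v) = q 0" using D(4) x by (simp add: D(5))
    then have "x + v \<in> K" using D(7) Z x v by simp
    then show ?case using v x Z D(7)[of v "- x"] by (simp add: add.commute)
  qed
qed

text \<open>Images of subspaces are submodules, which bounds the intersection from above; the
  preimage in \<open>Z\<close> of any competing submodule is a subspace containing \<open>S\<close>,
  which bounds it from below.\<close>

lemma module_span_presented:
  assumes P: "presents Z K M q" and S: "S \<subseteq> Z"
  shows "module_span M (q ` S) = q ` chains.span S"
proof
  note D = presentsD[OF P]
  note Z = chain_subspaceD[OF D(1)]
  have SZ: "chains.span S \<subseteq> Z" using S D(1) by (rule chains.span_minimal)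
  have "submodule (q ` chains.span S) field_ring M"
  proof (unfold_locales, goal_cases)
    case 1 then show ?case using SZ D(8) by auto
  next
    case (2 x y)
    then obtain u v where "u \<in> chains.span S" "v \<in> chains.span S" "x = q u" "y = q v" by auto
    then show ?case
      using D(5)[of u v] subsetD[OF SZ] chains.span_add by (auto intro!: image_eqI[of _ q "u + v"])
  next
    case 3 then show ?case using D(4) chains.span_zero by force
  next
    case (4 x)
    then obtain u where "u \<in> chains.span S" "x = q u" by auto
    then show ?case using presented_minus[OF P, of u] subsetD[OF SZ] chains.span_neg by auto
  next
    case (5 k x)
    then obtain u where "u \<in> chains.span S" "x = q u" by auto
    then show ?case
      using D(6)[of u k] subsetD[OF SZ] chains.span_scale by (auto intro!: image_eqI[of _ q "chain_scale k u"])
  qed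
  then show "module_span M (q ` S) \<subseteq> q ` chains.span S"
    unfolding module_span_def using chains.span_superset by (intro Inter_lower) auto
  show "q ` chains.span S \<subseteq> module_span M (q ` S)"
    unfolding module_span_def
  proof (rule Inter_greatest)
    fix W assume "W \<in> {W. submodule W field_ring M \<and> q ` S \<subseteq> W}"
    then have W: "submodule W field_ring M" "q ` S \<subseteq> W" by auto
    interpret W: submodule W field_ring M by (rule W)
    have "chains.subspace {x \<in> Z. q x \<in> W}"
      using Z D(4,5,6) W.one_closed W.m_closed W.smult_closed
      by (intro chains.subspaceI) (auto simp: field_ring_def)
    then have "chains.span S \<subseteq> {x \<in> Z. q x \<in> W}"
      using W S by (intro chains.span_minimal) auto
    then show "q ` chains.span S \<subseteq> W" by auto
  qed
qed

text \<open>With equal kernels \<open>q'\<close> factors through \<open>q\<close>. The equation on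
  representatives is kept, since it is what makes the levelwise isomorphisms commute with the
  bonding maps.\<close>

lemma linear_iso_presented:
  assumes P: "presents Z K M q" and P': "presents Z K N q'"
  shows "\<exists>h. linear_iso M N h \<and> (\<forall>z\<in>Z. h (q z) = q' z)"
proof -
  note D = presentsD[OF P] and D' = presentsD[OF P']
  note Z = chain_subspaceD[OF D(1)]
  have eq: "q' x = q' y \<longleftrightarrow> q x = q y" if "x \<in> Z" "y \<in> Z" for x y
    using that D(7) D'(7) by simp
  define h where "h m = q' (SOME z. z \<in> Z \<and> q z = m)" for m
  have h: "h (q z) = q' z" if "z \<in> Z" for z
  proof -
    have "(SOME z'. z' \<in> Z \<and> q z' = q z) \<in> Z \<and> q (SOME z'. z' \<in> Z \<and> q z' = q z) = q z"
      by (rule someI[of _ z]) (use that in auto)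
    then show ?thesis unfolding h_def using eq that by blast
  qed
  have "linear_iso M N h"
    unfolding linear_iso_def
  proof (intro conjI ballI allI)
    show "bij_betw h (carrier M) (carrier N)"
      unfolding bij_betw_def
    proof
      show "inj_on h (carrier M)"
        by (rule inj_onI) (use h eq in \<open>auto simp flip: D(3)\<close>)
      have "h ` q ` Z = q' ` Z" using h by (simp add: image_image)
      then show "h ` carrier M = carrier N" by (simp only: D(3) D'(3))
    qed
    fix m m' assume "m \<in> carrier M" "m' \<in> carrier M"
    then obtain u v where "u \<in> Z" "v \<in> Z" "m = q u" "m' = q v" using D(3) by blast
    then show "h (m \<oplus>\<^bsub>M\<^esub> m') = h m \<oplus>\<^bsub>N\<^esub> h m'"
      using h Z D'(5) by (simp flip: D(5))
  next
    fix m k assume "m \<in> carrier M"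
    then obtain u where "u \<in> Z" "m = q u" using D(3) by blast
    then show "h (k \<odot>\<^bsub>M\<^esub> m) = k \<odot>\<^bsub>N\<^esub> h m"
      using h Z D'(6) by (simp flip: D(6))
  qed
  with h show ?thesis by blast
qed

text \<open>A map acting as the identity on representatives has kernel \<open>K'/K\<close>. This
  reduces critical values to the question where the kernels change.\<close>

lemma linear_iso_between_presented:
  assumes P: "presents Z K M q" and P': "presents Z K' N q'" and b: "\<And>z. z \<in> Z \<Longrightarrow> b (q z) = q' z"
    and K: "K \<subseteq> K'" "K' \<subseteq> Z"
  shows "linear_iso M N b \<longleftrightarrow> K = K'"
proof
  note D = presentsD[OF P] and D' = presentsD[OF P']
  note Z = chain_subspaceD[OF D(1)]
  assume "linear_iso M N b"
  then have inj: "inj_on b (carrier M)" by (simp add: linear_iso_def bij_betw_def)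
  have "z \<in> K" if z: "z \<in> K'" for z
  proof -
    have zZ: "z \<in> Z" using z K by blast
    have "b (q z) = b (q 0)" using D'(7)[OF zZ Z(1)] b zZ Z(1) z by simp
    then have "q z = q 0" using inj D(8) zZ Z(1) by (auto dest: inj_onD)
    then show ?thesis using D(7)[OF zZ Z(1)] by simp
  qed
  then show "K = K'" using K by blast
next
  assume "K = K'"
  with P' have "presents Z K N q'" by simp
  then obtain h where h: "linear_iso M N h" "\<And>z. z \<in> Z \<Longrightarrow> h (q z) = q' z"
    using linear_iso_presented[OF P] by blast
  then have "b m = h m" if "m \<in> carrier M" for m
    using that b presentsD(3)[OF P] by (metis imageE)
  moreover have "x \<oplus>\<^bsub>M\<^esub> y \<in> carrier M" if xy: "x \<in> carrier M" "y \<in> carrier M" for x y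
  proof -
    obtain u v where "u \<in> Z" "v \<in> Z" "x = q u" "y = q v" using xy presentsD(3)[OF P] by blast
    then show ?thesis
      using presentsD(5,8)[OF P] chain_subspaceD(2)[OF presentsD(1)[OF P]] by metis
  qed
  moreover have "k \<odot>\<^bsub>M\<^esub> x \<in> carrier M" if x: "x \<in> carrier M" for k x
  proof -
    obtain u where "u \<in> Z" "x = q u" using x presentsD(3)[OF P] by blast
    then show ?thesis
      using presentsD(6,8)[OF P] chain_subspaceD(4)[OF presentsD(1)[OF P]] by metis
  qed
  moreover have "bij_betw b (carrier M) (carrier N) \<longleftrightarrow> bij_betw h (carrier M) (carrier N)"
    by (rule bij_betw_cong) (rule calculation(1))
  ultimately show "linear_iso M N b" using h(1) by (simp add: linear_iso_def)
qed

text \<open>\<open>q' z\<close> is \<open>q x\<close> for any \<open>x\<close> whose image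
  \<open>T x\<close> equals \<open>z\<close> modulo \<open>K\<close>; this is well defined because
  the preimage of \<open>K\<close> under \<open>T\<close> is \<open>K0\<close>. The freedom in the
  choice of \<open>x\<close> is part of the conclusion: later one \<open>x\<close> has to serve at
  two scales.\<close>

lemma presents_transfer:
  assumes P: "presents Z0 K0 M q" and Z: "chains.subspace Z" and K: "chains.subspace K"
    and T: "\<And>x y. x \<in> Z0 \<Longrightarrow> y \<in> Z0 \<Longrightarrow> T (x + y) = T x + T y"
      "\<And>k x. x \<in> Z0 \<Longrightarrow> T (chain_scale k x) = chain_scale k (T x)"
      "\<And>x. x \<in> Z0 \<Longrightarrow> T x \<in> Z"
      "\<And>x. x \<in> Z0 \<Longrightarrow> T x \<in> K \<longleftrightarrow> x \<in> K0"
      "\<And>z. z \<in> Z \<Longrightarrow> \<exists>x\<in>Z0. z - T x \<in> K"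
  shows "\<exists>q'. presents Z K M q' \<and> (\<forall>z\<in>Z. \<forall>x\<in>Z0. z - T x \<in> K \<longrightarrow> q' z = q x)"
proof -
  note D = presentsD[OF P]
  note Z0 = chain_subspaceD[OF D(1)] and ZZ = chain_subspaceD[OF Z] and KK = chain_subspaceD[OF K]
  have Td: "T (x - y) = T x - T y" if "x \<in> Z0" "y \<in> Z0" for x y
    using T(1)[of "x - y" y] Z0 that by simp
  obtain p where p: "\<And>z. z \<in> Z \<Longrightarrow> p z \<in> Z0" "\<And>z. z \<in> Z \<Longrightarrow> z - T (p z) \<in> K"
    using T(5) by metis
  have q_eq: "q x = q y \<longleftrightarrow> T x - T y \<in> K" if "x \<in> Z0" "y \<in> Z0" for x y
    using D(7)[OF that] T(4)[of "x - y"] Td[OF that] Z0 that by simp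
  have pick: "q (p z) = q x" if "z \<in> Z" "x \<in> Z0" "z - T x \<in> K" for z x
  proof -
    have "(z - T x) - (z - T (p z)) \<in> K" by (rule KK(3)[OF that(3) p(2)[OF that(1)]])
    then show ?thesis using q_eq[of "p z" x] p that by simp
  qed
  have "presents Z K M (\<lambda>z. q (p z))"
    unfolding presents_def
  proof (intro conjI ballI allI Z K)
    have "q x \<in> (\<lambda>z. q (p z)) ` Z" if "x \<in> Z0" for x
      using pick[of "T x" x] that T(3) KK(1) by (intro image_eqI[of _ _ "T x"]) auto
    then show "(\<lambda>z. q (p z)) ` Z = carrier M" using p(1) D(8) by (auto simp flip: D(3))
    have "T 0 = 0" using Td[of 0 0] Z0 by simp
    then show "q (p 0) = \<zero>\<^bsub>M\<^esub>" using pick[of 0 0] ZZ KK Z0 D(4) by simp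
    fix x y assume xy: "x \<in> Z" "y \<in> Z"
    have "(x - T (p x)) + (y - T (p y)) \<in> K" using p xy by (intro KK(2))
    then have "(x + y) - T (p x + p y) \<in> K" using p xy by (simp add: T(1) algebra_simps)
    then show "q (p (x + y)) = q (p x) \<oplus>\<^bsub>M\<^esub> q (p y)"
      using pick[of "x + y" "p x + p y"] p xy ZZ Z0 by (simp add: D(5))
    have *: "x - y = (T (p x) - T (p y)) + ((x - T (p x)) - (y - T (p y)))" by simp
    have **: "(x - T (p x)) - (y - T (p y)) \<in> K" by (rule KK(3)[OF p(2)[OF xy(1)] p(2)[OF xy(2)]])
    have "T (p x) - T (p y) \<in> K \<longleftrightarrow> x - y \<in> K"
    proof
      assume "T (p x) - T (p y) \<in> K"
      then show "x - y \<in> K" by (subst *) (intro KK(2) **)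
    next
      assume "x - y \<in> K"
      from KK(3)[OF this **] show "T (p x) - T (p y) \<in> K" by simp
    qed
    then show "q (p x) = q (p y) \<longleftrightarrow> x - y \<in> K" using q_eq p xy by simp
  next
    fix k x assume x: "x \<in> Z"
    have "chain_scale k (x - T (p x)) \<in> K" using p x by (intro KK(4))
    then have "chain_scale k x - T (chain_scale k (p x)) \<in> K"
      using p x by (simp add: T(2) chains.scale_right_diff_distrib)
    then show "q (p (chain_scale k x)) = k \<odot>\<^bsub>M\<^esub> q (p x)"
      using pick[of "chain_scale k x" "chain_scale k (p x)"] p x ZZ Z0 by (simp add: D(6))
  qed
  then show ?thesis using pick by blast
qed


section \<open>Singular chains in dimension one\<close>

abbreviation vertex :: "nat \<Rightarrow> nat \<Rightarrow> real" where
  "vertex i \<equiv> (\<lambda>j. if j = i then 1 else 0)"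

definition point_simplex :: "'a \<Rightarrow> (nat \<Rightarrow> real) \<Rightarrow> 'a" where
  "point_simplex x = restrict (\<lambda>_. x) (standard_simplex 0)"

lemma singular_bd_lin_ext:
  "p > 0 \<Longrightarrow> singular_bd p c =
     lin_ext chain_scale (\<lambda>f. \<Sum>k\<le>p. single (singular_face p k f) ((-1) ^ k)) c"
  by (simp add: singular_bd_def lin_ext_def chains.scale_sum_right mult.commute)

lemma singular_bd_add: "singular_bd p (c + d) = singular_bd p c + singular_bd p d"
  by (cases "p = 0") (simp_all add: singular_bd_lin_ext chains.lin_ext_add, simp add: singular_bd_def)

lemma singular_bd_scale: "singular_bd p (chain_scale k c) = chain_scale k (singular_bd p c)"
  by (cases "p = 0") (simp_all add: singular_bd_lin_ext chains.lin_ext_scale, simp add: singular_bd_def)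

lemma singular_bd_zero [simp]: "singular_bd p 0 = 0"
  by (simp add: singular_bd_def)

lemma singular_bd_diff: "singular_bd p (c - d) = singular_bd p c - singular_bd p d"
  using singular_bd_add[of p "c - d" d] by simp

lemma singular_bd_sum: "singular_bd p (\<Sum>i\<in>I. g i) = (\<Sum>i\<in>I. singular_bd p (g i))"
  by (induction I rule: infinite_finite_induct) (auto simp: singular_bd_add)

lemma singular_face_1:
  "singular_face 1 0 f = point_simplex (f (vertex 1))"
  "singular_face 1 (Suc 0) f = point_simplex (f (vertex 0))"
proof -
  have "simplical_face 0 (vertex 0 :: nat \<Rightarrow> real) = vertex 1"
    "simplical_face (Suc 0) (vertex 0 :: nat \<Rightarrow> real) = vertex 0"
    by (auto simp: simplical_face_def fun_eq_iff)
  then show "singular_face 1 0 f = point_simplex (f (vertex 1))"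
    "singular_face 1 (Suc 0) f = point_simplex (f (vertex 0))"
    unfolding singular_face_def point_simplex_def One_nat_def diff_self_eq_0 standard_simplex_0
    by (auto intro!: restrict_ext)
qed

lemma singular_bd_1_single:
  "singular_bd 1 (single f a) =
     single (point_simplex (f (vertex 1))) a - single (point_simplex (f (vertex 0))) a"
  by (simp add: singular_bd_lin_ext singular_face_1[simplified] chains.scale_right_distrib chains.scale_right_diff_distrib single_uminus)

lemma singular_bd_2_single:
  "singular_bd 2 (single f a) =
     single (singular_face 2 0 f) a - single (singular_face 2 1 f) a +
     single (singular_face 2 2 f) a"
  by (simp add: singular_bd_lin_ext numeral_2_eq_2 chains.scale_right_distrib chains.scale_right_diff_distrib
      single_uminus)

lemma singular_face_2_vertex:
  "singular_face 2 0 f (vertex 0) = f (vertex 1)" "singular_face 2 0 f (vertex 1) = f (vertex 2)"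
  "singular_face 2 1 f (vertex 0) = f (vertex 0)" "singular_face 2 1 f (vertex 1) = f (vertex 2)"
  "singular_face 2 2 f (vertex 0) = f (vertex 0)" "singular_face 2 2 f (vertex 1) = f (vertex 1)"
proof -
  have v: "vertex 0 \<in> standard_simplex (Suc 0)" "vertex 1 \<in> standard_simplex (Suc 0)"
    by simp_all
  have "simplical_face 0 (vertex 0 :: nat \<Rightarrow> real) = vertex 1" "simplical_face 0 (vertex 1 :: nat \<Rightarrow> real) = vertex 2"
    "simplical_face 1 (vertex 0 :: nat \<Rightarrow> real) = vertex 0" "simplical_face 1 (vertex 1 :: nat \<Rightarrow> real) = vertex 2"
    "simplical_face 2 (vertex 0 :: nat \<Rightarrow> real) = vertex 0" "simplical_face 2 (vertex 1 :: nat \<Rightarrow> real) = vertex 1"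
    by (auto simp: simplical_face_def fun_eq_iff)
  with v show
    "singular_face 2 0 f (vertex 0) = f (vertex 1)" "singular_face 2 0 f (vertex 1) = f (vertex 2)"
    "singular_face 2 1 f (vertex 0) = f (vertex 0)" "singular_face 2 1 f (vertex 1) = f (vertex 2)"
    "singular_face 2 2 f (vertex 0) = f (vertex 0)" "singular_face 2 2 f (vertex 1) = f (vertex 1)"
    by (simp_all add: singular_face_def)
qed

lemma singular_bd_1_bd_2: "singular_bd 1 (singular_bd 2 c) = 0"
proof -
  have *: "singular_bd 1 (singular_bd 2 (single f a)) = 0" for f a
    unfolding singular_bd_2_single singular_bd_add singular_bd_diff singular_bd_1_single
      singular_face_2_vertex by simp
  show ?thesis
    by (subst chain_eq_sum_single[of c]) (simp only: singular_bd_sum * sum.neutral_const)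
qed

lemma subspace_singular_chains:
  "chains.subspace (singular_chains p T :: ('a, 'f::field) schain set)"
proof (rule chains.subspaceI)
  fix x y :: "('a, 'f) schain" assume "x \<in> singular_chains p T" "y \<in> singular_chains p T"
  then show "x + y \<in> singular_chains p T"
    using keys_add[of x y] unfolding singular_chains_def by blast
next
  fix c x assume "x \<in> singular_chains p T"
  then show "chain_scale c x \<in> singular_chains p T"
    unfolding singular_chains_def by (auto simp: in_keys_iff)
qed (simp add: singular_chains_def)

lemma subspace_singular_cycles: "chains.subspace (singular_cycles p T)"
  using chain_subspaceD[OF subspace_singular_chains[of p T]] unfolding singular_cycles_def
  by (intro chains.subspaceI) (auto simp: singular_bd_add singular_bd_scale)

lemma subspace_singular_boundaries: "chains.subspace (singular_boundaries p T)"
proof (rule chains.subspaceI)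
  note Z = chain_subspaceD[OF subspace_singular_chains[of "Suc p" T]]
  show "0 \<in> singular_boundaries p T"
    unfolding singular_boundaries_def using Z(1) by (auto intro!: image_eqI[of _ _ 0])
  show "x + y \<in> singular_boundaries p T"
    if "x \<in> singular_boundaries p T" "y \<in> singular_boundaries p T" for x y
    using that Z(2) unfolding singular_boundaries_def by (auto simp flip: singular_bd_add intro!: imageI)
  show "chain_scale k x \<in> singular_boundaries p T" if "x \<in> singular_boundaries p T" for k x
    using that Z(4) unfolding singular_boundaries_def by (auto simp flip: singular_bd_scale intro!: imageI)
qed

lemma singular_chains_single [simp]:
  "single f a \<in> singular_chains p T \<longleftrightarrow> a = 0 \<or> singular_simplex p T f"
  by (auto simp: singular_chains_def)

lemma singular_chains_sum_single:
  "c \<in> singular_chains p T \<Longrightarrow> f \<in> keys c \<Longrightarrow> singular_simplex p T f"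
  by (auto simp: singular_chains_def)

lemma singular_bd_2_chains:
  assumes "c \<in> singular_chains 2 T"
  shows "singular_bd 2 c \<in> singular_chains 1 T"
proof -
  note Z = chain_subspaceD[OF subspace_singular_chains[of 1 T]]
  have *: "singular_bd 2 (single f a) \<in> singular_chains 1 T" if "singular_simplex 2 T f" for f a
  proof -
    have "singular_simplex 1 T (singular_face 2 k f)" if "k \<le> 2" for k
      using singular_simplex_singular_face[OF \<open>singular_simplex 2 T f\<close> _ that] by simp
    then show ?thesis
      unfolding singular_bd_2_single by (intro Z(2,3)) auto
  qed
  show ?thesis
    by (subst chain_eq_sum_single[of c], subst singular_bd_sum)
      (intro chains.subspace_sum subspace_singular_chains * singular_chains_sum_single[OF assms])
qed

lemma singular_boundaries_1_subset_cycles: "singular_boundaries 1 T \<subseteq> singular_cycles 1 T"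
  using singular_bd_2_chains[of _ T] singular_bd_1_bd_2
  by (auto simp: singular_boundaries_def singular_cycles_def numeral_2_eq_2)

lemma presents_singular_homology:
  "presents (singular_cycles 1 T) (singular_boundaries 1 T) (singular_homology 1 T)
     (\<lambda>z. singular_boundaries 1 T +>\<^bsub>chain_module\<^esub> z)"
  unfolding singular_homology_def
  by (intro presents_homology subspace_singular_cycles subspace_singular_boundaries
      singular_boundaries_1_subset_cycles)

lemma singular_simplex_mono_set:
  "singular_simplex p (top_of_set U) f \<Longrightarrow> U \<subseteq> X \<Longrightarrow> singular_simplex p (top_of_set X) f"
  by (metis singular_simplex_mono)

lemma singular_chains_mono:
  "U \<subseteq> X \<Longrightarrow> singular_chains p (top_of_set U) \<subseteq> singular_chains p (top_of_set X)"
  unfolding singular_chains_def using singular_simplex_mono_set by blast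

lemma singular_cycles_mono:
  "U \<subseteq> X \<Longrightarrow> singular_cycles p (top_of_set U) \<subseteq> singular_cycles p (top_of_set X)"
  unfolding singular_cycles_def using singular_chains_mono by blast

lemma singular_boundaries_mono:
  "U \<subseteq> X \<Longrightarrow> singular_boundaries p (top_of_set U) \<subseteq> singular_boundaries p (top_of_set X)"
  unfolding singular_boundaries_def using singular_chains_mono by blast

text \<open>Triviality of the induced map says that each cycle of the neighbourhood has the zero
  coset in \<open>X\<close>, hence bounds there. Passing to the relatively open \<open>V\<close>
  inside the neighbourhood prepares an open cover.\<close>

lemma semi_locally_simply_connectedD:
  fixes X :: "'a::metric_space set"
  assumes "semi_locally_simply_connected TYPE('f::field) X" "x \<in> X"
  obtains V where "openin (top_of_set X) V" "x \<in> V"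
    "(singular_cycles 1 (top_of_set V) :: ('a, 'f) schain set) \<subseteq> singular_boundaries 1 (top_of_set X)"
proof -
  let ?BX = "singular_boundaries 1 (top_of_set X) :: ('a, 'f) schain set"
  obtain U V where UV: "openin (top_of_set X) V" "x \<in> V" "V \<subseteq> U" "U \<subseteq> X"
    and im: "coset_map chain_module ?BX `
          carrier (singular_homology 1 (top_of_set U) :: ('f, _) module) =
        {\<zero>\<^bsub>(singular_homology 1 (top_of_set X) :: ('f, _) module)\<^esub>}"
    using assms unfolding semi_locally_simply_connected_def by blast
  have "z \<in> ?BX" if z: "z \<in> singular_cycles 1 (top_of_set V)" for z
  proof -
    note PX = presentsD[OF presents_singular_homology[of "top_of_set X"]]
    have zU: "z \<in> singular_cycles 1 (top_of_set U)" using z singular_cycles_mono[OF UV(3)] by blast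
    then have zX: "z \<in> singular_cycles 1 (top_of_set X)" using singular_cycles_mono[OF UV(4)] by blast
    have "coset_map chain_module ?BX (singular_boundaries 1 (top_of_set U) +>\<^bsub>chain_module\<^esub> z) =
        \<zero>\<^bsub>(singular_homology 1 (top_of_set X) :: ('f, _) module)\<^esub>"
      using im presentsD(8)[OF presents_singular_homology zU] by blast
    also have "\<dots> = ?BX +>\<^bsub>chain_module\<^esub> 0"
      by (rule PX(4)[symmetric])
    finally have "?BX +>\<^bsub>chain_module\<^esub> z = ?BX +>\<^bsub>chain_module\<^esub> 0"
      using coset_map_chains[OF subspace_singular_boundaries subspace_singular_boundaries
          singular_boundaries_mono[OF UV(4)]] by metis
    then show ?thesis
      using PX(7)[OF zX chain_subspaceD(1)[OF PX(1)]] by simp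
  qed
  then show thesis using that UV by blast
qed


section \<open>Paths as singular simplices\<close>

abbreviation path_chain :: "(real \<Rightarrow> 'a) \<Rightarrow> ('a, 'f::field) schain" where
  "path_chain g \<equiv> single (path_simplex g) 1"

lemma standard_simplex_1D:
  assumes "t \<in> standard_simplex (Suc 0)"
  shows "t 0 = 1 - t (Suc 0)" "0 \<le> t (Suc 0)" "t (Suc 0) \<le> 1" "i \<ge> 2 \<Longrightarrow> t i = 0"
  using assms by (auto simp: standard_simplex_def)

lemma continuous_map_coordinate:
  "continuous_map (subtopology (powertop_real UNIV) S) euclideanreal (\<lambda>t. t i)"
  by (intro continuous_map_from_subtopology continuous_map_product_projection) auto

lemma singular_simplex_real_compose:
  assumes "continuous_on K g" "g ` K \<subseteq> X"
    and "continuous_map (subtopology (powertop_real UNIV) (standard_simplex p)) euclidean \<phi>"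
    and "\<phi> ` standard_simplex p \<subseteq> K"
  shows "singular_simplex p (top_of_set X) (restrict (\<lambda>t. g (\<phi> t)) (standard_simplex p))"
proof -
  have "continuous_map (subtopology (powertop_real UNIV) (standard_simplex p)) (top_of_set K) \<phi>"
    using assms(3,4) by (auto simp: continuous_map_in_subtopology)
  moreover have "continuous_map (top_of_set K) (top_of_set X) g"
    using assms(1,2) by (auto simp: continuous_map_in_subtopology)
  ultimately have "continuous_map (subtopology (powertop_real UNIV) (standard_simplex p)) (top_of_set X) (g \<circ> \<phi>)"
    by (rule continuous_map_compose)
  then have "continuous_map (subtopology (powertop_real UNIV) (standard_simplex p)) (top_of_set X)
      (restrict (\<lambda>t. g (\<phi> t)) (standard_simplex p))"
    by (rule continuous_map_eq) auto
  then show ?thesis by (simp add: singular_simplex_def)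
qed

lemma singular_simplex_path_simplex:
  assumes "path g" "path_image g \<subseteq> X"
  shows "singular_simplex 1 (top_of_set X) (path_simplex g)"
  unfolding path_simplex_def
  by (rule singular_simplex_real_compose[where K = "{0..1}"])
    (use assms in \<open>auto simp: path_def path_image_def continuous_map_coordinate standard_simplex_1D\<close>)

lemma path_simplex_vertex [simp]:
  "path_simplex g (vertex 0) = pathstart g" "path_simplex g (vertex 1) = pathfinish g"
  "path_simplex g (vertex (Suc 0)) = pathfinish g"
proof -
  have "vertex 0 \<in> standard_simplex 1" "vertex 1 \<in> standard_simplex 1"
    by simp_all
  then show "path_simplex g (vertex 0) = pathstart g" "path_simplex g (vertex 1) = pathfinish g"
    "path_simplex g (vertex (Suc 0)) = pathfinish g"
    by (auto simp: path_simplex_def pathstart_def pathfinish_def)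
qed

lemma singular_bd_path_chain:
  "singular_bd 1 (path_chain g) =
     single (point_simplex (pathfinish g)) 1 - single (point_simplex (pathstart g)) 1"
  unfolding singular_bd_1_single path_simplex_vertex ..

lemma path_simplex_cong: "(\<And>s. s \<in> {0..1} \<Longrightarrow> g s = h s) \<Longrightarrow> path_simplex g = path_simplex h"
  unfolding path_simplex_def by (rule restrict_ext) (use standard_simplex_1D in auto)

text \<open>The affine parametrization \<open>e\<close> of the standard 1-simplex is inverse to the
  coordinate \<open>t 1\<close>.\<close>

lemma singular_1_simplex_is_path:
  assumes "singular_simplex 1 (top_of_set X) f"
  obtains g where "path g" "path_image g \<subseteq> X" "f = path_simplex g"
proof -
  define e where "e s = (\<lambda>i::nat. if i = 0 then 1 - s else if i = 1 then s else 0)" for s :: real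
  have e: "e s \<in> standard_simplex 1" if "s \<in> {0..1}" for s
    using that by (auto simp: e_def standard_simplex_def)
  have "continuous_map euclideanreal (powertop_real UNIV) e"
    unfolding continuous_map_componentwise_UNIV
  proof
    fix i :: nat
    consider "i = 0" | "i = 1" | "i > 1" by linarith
    then show "continuous_map euclideanreal euclideanreal (\<lambda>x. e x i)"
      by cases (auto simp: e_def intro!: continuous_intros)
  qed
  then have "continuous_map (top_of_set {0..1}) (subtopology (powertop_real UNIV) (standard_simplex 1)) e"
    using e by (auto simp: continuous_map_in_subtopology intro: continuous_map_from_subtopology)
  then have "continuous_map (top_of_set {0..1}) (top_of_set X) (f \<circ> e)"
    using assms unfolding singular_simplex_def by (metis continuous_map_compose)
  then have 1: "path (f \<circ> e)" "path_image (f \<circ> e) \<subseteq> X"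
    by (auto simp: continuous_map_in_subtopology path_def path_image_def)
  have "e (t 1) = t" if "t \<in> standard_simplex 1" for t
  proof
    fix i show "e (t 1) i = t i"
      using standard_simplex_1D[OF that[simplified]] by (cases "i = 0"; cases "i = Suc 0") (auto simp: e_def)
  qed
  then have "f = path_simplex (f \<circ> e)"
    using assms unfolding singular_simplex_def path_simplex_def
    by (intro extensionalityI[where A = "standard_simplex 1"]) auto
  with 1 show thesis by (rule that)
qed

lemma simplical_face_in_simplex_2:
  "t \<in> standard_simplex 1 \<Longrightarrow> k \<le> 2 \<Longrightarrow> simplical_face k t \<in> standard_simplex 2"
  using simplical_face_in_standard_simplex[of 2 k t] by simp

definition path_segment :: "real \<Rightarrow> real \<Rightarrow> (real \<Rightarrow> 'a) \<Rightarrow> real \<Rightarrow> 'a" where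
  "path_segment u v g = (\<lambda>s. g ((v - u) * s + u))"

lemma path_segment_0_1 [simp]: "path_segment 0 1 g = g"
  by (simp add: path_segment_def)

text \<open>The bounding singular simplex is \<open>g\<close> composed with the affine map that
  sends the vertices of the standard 2-simplex to \<open>u\<close>, \<open>v\<close>,
  \<open>w\<close>. No order among them is assumed: \<open>0, 0, 0\<close> shows that constant loops
  bound, \<open>0, 1, 0\<close> handles reversed paths and \<open>0, 1/2, 1\<close>
  concatenation.\<close>

lemma path_segment_triangle:
  assumes g: "path g" "path_image g \<subseteq> X" and uvw: "u \<in> {0..1}" "v \<in> {0..1}" "w \<in> {0..1}"
  shows "path_chain (path_segment u v g) + path_chain (path_segment v w g) - path_chain (path_segment u w g)
    \<in> singular_boundaries 1 (top_of_set X)"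
proof -
  let ?\<phi> = "\<lambda>t::nat\<Rightarrow>real. u * t 0 + v * t 1 + w * t 2"
  define \<sigma> where "\<sigma> = restrict (\<lambda>t. g (?\<phi> t)) (standard_simplex 2)"
  have "?\<phi> t \<in> {0..1}" if "t \<in> standard_simplex 2" for t
  proof -
    have t: "t 0 \<ge> 0" "t 1 \<ge> 0" "t 2 \<ge> 0" "t 0 + t 1 + t 2 = 1"
      using that by (auto simp: standard_simplex_def numeral_2_eq_2)
    then have "?\<phi> t \<le> 1 * t 0 + 1 * t 1 + 1 * t 2"
      using uvw by (intro add_mono mult_right_mono) auto
    then show ?thesis using t uvw by auto
  qed
  then have "singular_simplex 2 (top_of_set X) \<sigma>"
    unfolding \<sigma>_def using g
    by (intro singular_simplex_real_compose[where K = "{0..1}"])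
      (auto simp: path_def path_image_def intro!: continuous_intros continuous_map_coordinate)
  then have "singular_bd 2 (single \<sigma> 1) \<in> singular_boundaries 1 (top_of_set X)"
    by (auto simp: singular_boundaries_def numeral_2_eq_2)
  moreover have "singular_face 2 k \<sigma> = restrict (\<lambda>t. g (?\<phi> (simplical_face k t))) (standard_simplex 1)"
    if "k \<le> 2" for k
    using that simplical_face_in_simplex_2 by (auto simp: singular_face_def \<sigma>_def fun_eq_iff restrict_def)
  then have "singular_face 2 0 \<sigma> = path_simplex (path_segment v w g)"
    "singular_face 2 1 \<sigma> = path_simplex (path_segment u w g)"
    "singular_face 2 2 \<sigma> = path_simplex (path_segment u v g)"
    unfolding path_simplex_def
    by (auto simp: path_segment_def simplical_face_def numeral_2_eq_2 standard_simplex_1D algebra_simps intro!: restrict_ext)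
  ultimately show ?thesis
    unfolding singular_bd_2_single by (simp add: algebra_simps)
qed

lemma const_path_chain_boundary:
  assumes "x \<in> X"
  shows "path_chain (\<lambda>_. x) \<in> singular_boundaries 1 (top_of_set X)"
  using path_segment_triangle[of "\<lambda>_. x" X 0 0 0] assms by (auto simp: path_def path_image_def path_segment_def)

lemma reversepath_chain_boundary:
  assumes "path g" "path_image g \<subseteq> X"
  shows "path_chain g + path_chain (reversepath g) \<in> singular_boundaries 1 (top_of_set X)"
proof -
  have "path_chain (path_segment 0 1 g) + path_chain (path_segment 1 0 g) - path_chain (path_segment 0 0 g)
      \<in> singular_boundaries 1 (top_of_set X)"
    by (rule path_segment_triangle) (use assms in auto)
  moreover have "path_chain (path_segment 0 0 g) \<in> singular_boundaries 1 (top_of_set X)"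
  proof -
    have "g 0 \<in> X" using assms(2) by (auto simp: path_image_def)
    then show ?thesis using const_path_chain_boundary by (simp add: path_segment_def)
  qed
  ultimately have "path_chain (path_segment 0 1 g) + path_chain (path_segment 1 0 g) \<in> singular_boundaries 1 (top_of_set X)"
    using chain_subspaceD(2)[OF subspace_singular_boundaries] by fastforce
  moreover have "path_segment 0 1 g = g" "path_segment 1 0 g = reversepath g"
    by (auto simp: path_segment_def reversepath_def algebra_simps)
  ultimately show ?thesis by simp
qed

lemma joinpaths_chain_boundary:
  assumes "path g" "path_image g \<subseteq> X" "path h" "path_image h \<subseteq> X" "pathfinish g = pathstart h"
  shows "path_chain g + path_chain h - path_chain (g +++ h) \<in> singular_boundaries 1 (top_of_set X)"
proof -
  have "path_chain (path_segment 0 (1/2) (g +++ h)) + path_chain (path_segment (1/2) 1 (g +++ h))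
      - path_chain (path_segment 0 1 (g +++ h)) \<in> singular_boundaries 1 (top_of_set X)"
    by (rule path_segment_triangle) (use assms path_image_join_subset[of g h] in auto)
  moreover have "path_simplex (path_segment 0 (1/2) (g +++ h)) = path_simplex g"
    by (rule path_simplex_cong) (auto simp: path_segment_def joinpaths_def)
  moreover have "path_simplex (path_segment (1/2) 1 (g +++ h)) = path_simplex h"
  proof (rule path_simplex_cong)
    fix s :: real assume "s \<in> {0..1}"
    then show "path_segment (1/2) 1 (g +++ h) s = h s"
      using assms(5) by (cases "s = 0") (auto simp: path_segment_def joinpaths_def pathfinish_def pathstart_def field_simps)
  qed
  ultimately show ?thesis by simp
qed

lemma loop_in_cycle:
  assumes "loop_in X g"
  shows "path_chain g \<in> singular_cycles 1 (top_of_set X)"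
  using assms singular_simplex_path_simplex[of g X] singular_bd_path_chain[of g]
  by (auto simp: singular_cycles_def loop_in_def)


section \<open>Lengths of paths\<close>

lemma path_length_partition:
  assumes "mono_on {..m} t" "t ` {..m} \<subseteq> {0..1}"
  shows "(\<Sum>i<m. ennreal (dist (g (t i)) (g (t (Suc i))))) \<le> path_length g"
  unfolding path_length_def by (rule SUP_upper2[of "(m, t)"]) (use assms in auto)

lemma dist_le_path_length:
  assumes "s \<in> {0..1}" "t \<in> {0..1}"
  shows "ennreal (dist (g s) (g t)) \<le> path_length g"
proof -
  have *: "ennreal (dist (g s) (g t)) \<le> path_length g" if "s \<in> {0..1}" "t \<in> {0..1}" "s \<le> t" for s t
  proof -
    have 1: "mono_on {..1} (\<lambda>i::nat. if i = 0 then s else t)" using that by (auto simp: mono_on_def)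
    have 2: "(\<lambda>i::nat. if i = 0 then s else t) ` {..1} \<subseteq> {0..1}" using that by auto
    show ?thesis using path_length_partition[OF 1 2, of g] by simp
  qed
  show ?thesis using *[OF assms] *[OF assms(2,1)] by (cases "s \<le> t") (auto simp: dist_commute)
qed

lemma path_length_reversepath: "path_length (reversepath g) \<le> path_length g"
  unfolding path_length_def[of "reversepath g"]
proof (rule SUP_least, clarify)
  fix m :: nat and t :: "nat \<Rightarrow> real"
  assume t: "mono_on {..m} t" "t ` {..m} \<subseteq> {0..1}"
  let ?t = "\<lambda>i. 1 - t (m - i)"
  have "(\<Sum>i<m. ennreal (dist (reversepath g (t i)) (reversepath g (t (Suc i))))) =
      (\<Sum>i<m. ennreal (dist (g (1 - t (m - Suc i))) (g (1 - t (Suc (m - Suc i))))))"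
    unfolding reversepath_def by (rule sum.nat_diff_reindex[symmetric])
  also have "\<dots> = (\<Sum>i<m. ennreal (dist (g (?t i)) (g (?t (Suc i)))))"
    by (rule sum.cong) (auto simp: dist_commute Suc_diff_Suc)
  also have "\<dots> \<le> path_length g"
    by (rule path_length_partition) (use t in \<open>auto simp: mono_on_def image_subset_iff\<close>)
  finally show "(\<Sum>i<m. ennreal (dist (reversepath g (t i)) (reversepath g (t (Suc i))))) \<le> path_length g" .
qed

text \<open>
  Clamping a partition at \<open>1/2\<close> from above and from below gives partitions of both halves; this
  avoids splitting the partition at an index.
\<close>

lemma path_length_joinpaths:
  assumes "pathfinish g = pathstart h"
  shows "path_length (g +++ h) \<le> path_length g + path_length h"
  unfolding path_length_def[of "g +++ h"]
proof (rule SUP_least, clarify)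
  fix m :: nat and t :: "nat \<Rightarrow> real"
  assume t: "mono_on {..m} t" "t ` {..m} \<subseteq> {0..1}"
  let ?l = "\<lambda>i. 2 * min (t i) (1/2)" and ?r = "\<lambda>i. 2 * max (t i) (1/2) - 1"
  have gh: "(g +++ h) s = g (2 * min s (1/2))" if "s \<le> 1/2" for s
    using that by (auto simp: joinpaths_def)
  have hg: "(g +++ h) s = h (2 * max s (1/2) - 1)" if "s \<ge> 1/2" for s
  proof (cases "s = 1/2")
    case True
    show ?thesis unfolding True using assms by (simp add: joinpaths_def pathfinish_def pathstart_def)
  next
    case False
    then show ?thesis using that by (auto simp: joinpaths_def)
  qed
  have join: "g 1 = h 0" using assms by (simp add: pathfinish_def pathstart_def)
  have "ennreal (dist ((g +++ h) (t i)) ((g +++ h) (t (Suc i)))) \<le>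
      ennreal (dist (g (?l i)) (g (?l (Suc i)))) + ennreal (dist (h (?r i)) (h (?r (Suc i))))" if "i < m" for i
  proof -
    have le: "t i \<le> t (Suc i)" using t(1) that by (auto simp: mono_on_def)
    consider "t (Suc i) \<le> 1/2" | "1/2 \<le> t i" | "t i < 1/2" "1/2 < t (Suc i)" using le by linarith
    then have "dist ((g +++ h) (t i)) ((g +++ h) (t (Suc i))) \<le>
        dist (g (?l i)) (g (?l (Suc i))) + dist (h (?r i)) (h (?r (Suc i)))"
    proof cases
      case 1 then show ?thesis using gh le by simp
    next
      case 2 then show ?thesis using hg le by simp
    next
      case 3
      then have "?l (Suc i) = 1" "?r i = 0" by auto
      then show ?thesis
        using 3 gh[of "t i"] hg[of "t (Suc i)"] join
          dist_triangle[of "g (?l i)" "h (?r (Suc i))" "g 1"] by simp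
    qed
    then show ?thesis by (simp flip: ennreal_plus add: ennreal_leI)
  qed
  then have "(\<Sum>i<m. ennreal (dist ((g +++ h) (t i)) ((g +++ h) (t (Suc i))))) \<le>
      (\<Sum>i<m. ennreal (dist (g (?l i)) (g (?l (Suc i))))) + (\<Sum>i<m. ennreal (dist (h (?r i)) (h (?r (Suc i)))))"
    unfolding sum.distrib[symmetric] by (intro sum_mono) auto
  also have "\<dots> \<le> path_length g + path_length h"
  proof (intro add_mono path_length_partition)
    have "t i \<le> t j" if "j \<le> m" "i \<le> j" for i j
      using t(1) that by (auto simp: mono_on_def)
    then show "mono_on {..m} ?l" "mono_on {..m} ?r"
      by (intro mono_onI mult_left_mono diff_right_mono min.mono max.mono; simp)+
    show "?l ` {..m} \<subseteq> {0..1}" "?r ` {..m} \<subseteq> {0..1}"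
      using t(2) by (auto simp: image_subset_iff min_def max_def)
  qed
  finally show "(\<Sum>i<m. ennreal (dist ((g +++ h) (t i)) ((g +++ h) (t (Suc i))))) \<le>
      path_length g + path_length h" .
qed


section \<open>Oriented simplicial chains\<close>

lemma oriented_bd_lin_ext:
  "p > 0 \<Longrightarrow> oriented_bd p c = lin_ext chain_scale (\<lambda>xs. single (tl xs) 1) c"
  by (simp add: oriented_bd_def lin_ext_def)

lemma oriented_bd_add: "oriented_bd p (c + d) = oriented_bd p c + oriented_bd p d"
  by (cases "p = 0") (simp_all add: oriented_bd_lin_ext chains.lin_ext_add, simp add: oriented_bd_def)

lemma oriented_bd_scale: "oriented_bd p (chain_scale k c) = chain_scale k (oriented_bd p c)"
  by (cases "p = 0") (simp_all add: oriented_bd_lin_ext chains.lin_ext_scale, simp add: oriented_bd_def)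

lemma oriented_bd_zero [simp]: "oriented_bd p 0 = 0"
  by (simp add: oriented_bd_def)

lemma oriented_bd_diff: "oriented_bd p (c - d) = oriented_bd p c - oriented_bd p d"
  using oriented_bd_add[of p "c - d" d] by simp

lemma subspace_oriented_chains:
  "chains.subspace (oriented_chains p K :: ('a list \<Rightarrow>\<^sub>0 'f::field) set)"
proof (rule chains.subspaceI)
  fix x y :: "'a list \<Rightarrow>\<^sub>0 'f" assume "x \<in> oriented_chains p K" "y \<in> oriented_chains p K"
  then show "x + y \<in> oriented_chains p K"
    using keys_add[of x y] unfolding oriented_chains_def
    by (auto simp: lookup_add distrib_left)
next
  fix c and x :: "'a list \<Rightarrow>\<^sub>0 'f" assume "x \<in> oriented_chains p K"
  then show "chain_scale c x \<in> oriented_chains p K"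
    unfolding oriented_chains_def by (auto simp: in_keys_iff)
qed (simp add: oriented_chains_def)

lemma subspace_oriented_cycles: "chains.subspace (oriented_cycles p K)"
  using chain_subspaceD[OF subspace_oriented_chains[of p K]] unfolding oriented_cycles_def
  by (intro chains.subspaceI) (auto simp: oriented_bd_add oriented_bd_scale)

lemma subspace_oriented_boundaries: "chains.subspace (oriented_boundaries p K)"
proof (rule chains.subspaceI)
  note Z = chain_subspaceD[OF subspace_oriented_chains[of "Suc p" K]]
  show "0 \<in> oriented_boundaries p K"
    unfolding oriented_boundaries_def using Z(1) by (auto intro!: image_eqI[of _ _ 0])
  show "x + y \<in> oriented_boundaries p K"
    if "x \<in> oriented_boundaries p K" "y \<in> oriented_boundaries p K" for x y
    using that Z(2) unfolding oriented_boundaries_def by (auto simp flip: oriented_bd_add intro!: imageI)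
  show "chain_scale k x \<in> oriented_boundaries p K" if "x \<in> oriented_boundaries p K" for k x
    using that Z(4) unfolding oriented_boundaries_def by (auto simp flip: oriented_bd_scale intro!: imageI)
qed

definition simplex_chain :: "'a list \<Rightarrow> ('a list \<Rightarrow>\<^sub>0 'f::field)" where
  "simplex_chain xs =
     (\<Sum>\<pi> | \<pi> permutes {..<length xs}. single (permute_list \<pi> xs) (of_int (sign \<pi>)))"

lemma lookup_simplex_chain:
  "lookup (simplex_chain xs :: 'a list \<Rightarrow>\<^sub>0 'f::field) ys =
     (\<Sum>\<pi> | \<pi> permutes {..<length xs}. if permute_list \<pi> xs = ys then of_int (sign \<pi>) else 0)"
  by (simp add: simplex_chain_def lookup_sum lookup_single when_def)

lemma keys_simplex_chain:
  assumes "ys \<in> keys (simplex_chain xs :: 'a list \<Rightarrow>\<^sub>0 'f::field)"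
  obtains \<pi> where "\<pi> permutes {..<length xs}" "ys = permute_list \<pi> xs"
proof -
  have "\<exists>\<pi>. \<pi> permutes {..<length xs} \<and> ys = permute_list \<pi> xs"
  proof (rule ccontr)
    assume *: "\<not> ?thesis"
    have "lookup (simplex_chain xs :: 'a list \<Rightarrow>\<^sub>0 'f) ys = 0"
      unfolding lookup_simplex_chain by (rule sum.neutral) (use * in auto)
    then show False using assms by (simp add: in_keys_iff)
  qed
  then show thesis using that by blast
qed

lemma permute_list_inj:
  assumes "\<rho> permutes {..<n}" "length xs = n" "length ys = n" "permute_list \<rho> xs = permute_list \<rho> ys"
  shows "xs = ys"
proof -
  have "permute_list (inv_into UNIV \<rho>) (permute_list \<rho> zs) = zs" if "length zs = n" for zs :: "'a list"
    using permute_list_compose[of "inv_into UNIV \<rho>" zs \<rho>] that permutes_inv[OF assms(1)] permutes_inv_o(1)[OF assms(1)]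
    by simp
  then show ?thesis using assms by metis
qed

text \<open>Replacing \<pi> by \<open>\<pi> \<circ> \<rho>\<close> permutes the summands and
  multiplies each sign by \<open>sign \<rho>\<close>.\<close>

lemma lookup_simplex_chain_permute:
  assumes \<rho>: "\<rho> permutes {..<length ys}"
  shows "lookup (simplex_chain xs :: 'a list \<Rightarrow>\<^sub>0 'f::field) (permute_list \<rho> ys) =
     of_int (sign \<rho>) * lookup (simplex_chain xs) ys"
proof (cases "length ys = length xs")
  case True
  let ?n = "length xs"
  have \<rho>': "\<rho> permutes {..<?n}" using \<rho> True by simp
  have "(if permute_list (\<pi> \<circ> \<rho>) xs = permute_list \<rho> ys then of_int (sign (\<pi> \<circ> \<rho>)) else 0 :: 'f) =
      of_int (sign \<rho>) * (if permute_list \<pi> xs = ys then of_int (sign \<pi>) else 0)"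
    if \<pi>: "\<pi> permutes {..<?n}" for \<pi>
  proof -
    have "sign (\<pi> \<circ> \<rho>) = sign \<pi> * sign \<rho>"
      by (intro sign_compose permutes_imp_permutation[OF _ \<pi>] permutes_imp_permutation[OF _ \<rho>']) auto
    moreover have "permute_list (\<pi> \<circ> \<rho>) xs = permute_list \<rho> (permute_list \<pi> xs)"
      by (rule permute_list_compose) (rule \<rho>')
    moreover have "permute_list \<rho> (permute_list \<pi> xs) = permute_list \<rho> ys \<longleftrightarrow> permute_list \<pi> xs = ys"
      using permute_list_inj[OF \<rho>', of "permute_list \<pi> xs" ys] True by auto
    ultimately show ?thesis by simp
  qed
  then show ?thesis
    unfolding lookup_simplex_chain
    by (subst sum_permutations_compose_right[OF \<rho>']) (auto simp: sum_distrib_left intro!: sum.cong)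
next
  case False
  then have "zs \<notin> keys (simplex_chain xs :: 'a list \<Rightarrow>\<^sub>0 'f)" if "length zs = length ys" for zs
    using that keys_simplex_chain[of zs xs] by (metis length_permute_list)
  then show ?thesis by (simp add: in_keys_iff)
qed

lemma lookup_simplex_chain_self:
  assumes "distinct xs"
  shows "lookup (simplex_chain xs :: 'a list \<Rightarrow>\<^sub>0 'f::field) xs = 1"
proof -
  have id: "\<pi> = id" if \<pi>: "\<pi> permutes {..<length xs}" "permute_list \<pi> xs = xs" for \<pi>
  proof
    fix i show "\<pi> i = id i"
    proof (cases "i < length xs")
      case True
      then have "xs ! \<pi> i = xs ! i" using permute_list_nth[OF \<pi>(1) True] \<pi>(2) by simp
      moreover have "\<pi> i < length xs" using permutes_in_image[OF \<pi>(1), of i] True by simp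
      ultimately show ?thesis using assms True by (simp add: nth_eq_iff_index_eq)
    next
      case False
      then show ?thesis using permutes_not_in[OF \<pi>(1), of i] by simp
    qed
  qed
  have "lookup (simplex_chain xs :: 'a list \<Rightarrow>\<^sub>0 'f) xs =
      (\<Sum>\<pi>\<in>{id}. if permute_list \<pi> xs = xs then of_int (sign \<pi>) else 0)"
    unfolding lookup_simplex_chain
    by (rule sum.mono_neutral_right) (use id in \<open>auto simp: finite_permutations permutes_id\<close>)
  then show ?thesis by simp
qed

lemma simplex_chain_in_chains:
  assumes "length xs = Suc p" "distinct xs" "set xs \<in> K"
  shows "(simplex_chain xs :: 'a list \<Rightarrow>\<^sub>0 'f::field) \<in> oriented_chains p K"
  unfolding oriented_chains_def
proof (intro CollectI conjI ballI allI impI)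
  fix ys :: "'a list" and \<pi> assume "\<pi> permutes {..<length ys}"
  then show "lookup (simplex_chain xs) (permute_list \<pi> ys) =
      of_int (sign \<pi>) * (lookup (simplex_chain xs) ys :: 'f)"
    by (rule lookup_simplex_chain_permute)
next
  fix ys :: "'a list" assume "ys \<in> keys (simplex_chain xs :: 'a list \<Rightarrow>\<^sub>0 'f)"
  then obtain \<pi> where "\<pi> permutes {..<length xs}" "ys = permute_list \<pi> xs" by (rule keys_simplex_chain)
  with assms show "length ys = Suc p" "distinct ys" "set ys \<in> K" by auto
qed

text \<open>Induction on the size of the support: subtracting the multiple of an oriented simplex
  that clears one key creates no new keys, because an alternating chain is nonzero at every
  reordering of a key.\<close>

lemma oriented_chains_eq_span:
  "oriented_chains p K =
     chains.span (simplex_chain ` {xs. length xs = Suc p \<and> distinct xs \<and> set xs \<in> K} :: ('a list \<Rightarrow>\<^sub>0 'f::field) set)"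
  (is "_ = chains.span ?E")
proof
  show "chains.span ?E \<subseteq> oriented_chains p K"
    by (rule chains.span_minimal) (auto simp: simplex_chain_in_chains subspace_oriented_chains)
  have "c \<in> chains.span ?E" if "c \<in> oriented_chains p K" for c :: "'a list \<Rightarrow>\<^sub>0 'f"
    using that
  proof (induction "card (keys c)" arbitrary: c rule: less_induct)
    case less
    show ?case
    proof (cases "c = 0")
      case True then show ?thesis by (simp add: chains.span_zero)
    next
      case False
      then obtain xs where xs: "xs \<in> keys c" using poly_mapping_eqI[of c 0] by (auto simp: in_keys_iff)
      then have xs': "length xs = Suc p" "distinct xs" "set xs \<in> K"
        using less.prems by (auto simp: oriented_chains_def)
      define a where "a = lookup c xs"
      define d where "d = c - chain_scale a (simplex_chain xs)"
      have "d \<in> oriented_chains p K"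
        unfolding d_def using less.prems simplex_chain_in_chains[OF xs']
          chain_subspaceD[OF subspace_oriented_chains[of p K]] by blast
      moreover have "keys d \<subset> keys c"
      proof
        show "keys d \<subseteq> keys c"
        proof
          fix ys assume ys: "ys \<in> keys d"
          show "ys \<in> keys c"
          proof (rule ccontr)
            assume n: "ys \<notin> keys c"
            then have "ys \<in> keys (simplex_chain xs :: 'a list \<Rightarrow>\<^sub>0 'f)"
              using ys by (auto simp: d_def in_keys_iff lookup_minus)
            then obtain \<pi> where \<pi>: "\<pi> permutes {..<length xs}" "ys = permute_list \<pi> xs"
              by (rule keys_simplex_chain)
            then have "lookup c ys = of_int (sign \<pi>) * lookup c xs"
              using less.prems by (auto simp: oriented_chains_def)
            then show False using n xs by (auto simp: in_keys_iff sign_def split: if_splits)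
          qed
        qed
        have "xs \<notin> keys d"
          using lookup_simplex_chain_self[OF xs'(2), where 'f = 'f]
          by (simp add: d_def a_def in_keys_iff lookup_minus)
        then show "keys d \<noteq> keys c" using xs by blast
      qed
      then have "card (keys d) < card (keys c)"
        by (intro psubset_card_mono) auto
      ultimately have "d \<in> chains.span ?E" using less.hyps by blast
      moreover have "chain_scale a (simplex_chain xs) \<in> chains.span ?E"
        using xs' by (intro chains.span_scale chains.span_base) auto
      ultimately have "d + chain_scale a (simplex_chain xs) \<in> chains.span ?E"
        by (rule chains.span_add)
      then show ?thesis by (simp add: d_def)
    qed
  qed
  then show "oriented_chains p K \<subseteq> chains.span ?E" by blast
qed

text \<open>Antisymmetrized without requiring \<open>x \<noteq> y\<close>, so that a degenerate edge
  is 0 and polygons may repeat consecutive points.\<close>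

definition edge :: "'a \<Rightarrow> 'a \<Rightarrow> ('a list \<Rightarrow>\<^sub>0 'f::field)" where
  "edge x y = single [x, y] 1 - single [y, x] 1"

lemma edge_refl [simp]: "edge x x = 0"
  by (simp add: edge_def)

lemma edge_swap: "edge y x = - edge x y"
  by (simp add: edge_def)

lemma simplex_chain_2: "simplex_chain [x, y] = edge x y"
proof -
  have *: "{..<length [x, y]} = insert 1 (insert 0 {})" by auto
  show ?thesis
    unfolding simplex_chain_def *
    by (subst sum_over_permutations_insert; simp)+
      (simp add: edge_def permute_list_def sign_swap_id upt_rec transpose_def single_uminus)
qed

lemma simplex_chain_3:
  "simplex_chain [x, y, z] =
     single [x, y, z] 1 + single [y, z, x] 1 + single [z, x, y] 1
     - single [y, x, z] 1 - single [x, z, y] 1 - single [z, y, x] 1"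
proof -
  have *: "{..<length [x, y, z]} = insert (Suc (Suc 0)) (insert (Suc 0) (insert 0 {}))" by auto
  show ?thesis
    unfolding simplex_chain_def *
    by (simp add: sum_over_permutations_insert permute_list_def sign_swap_id sign_compose
        permutation_swap_id permutation_compose upt_rec transpose_def single_uminus algebra_simps)
qed

lemma oriented_bd_edge:
  "oriented_bd 1 (edge x y) = single [y] 1 - single [x] 1"
  by (simp add: edge_def oriented_bd_diff) (simp add: oriented_bd_lin_ext)

lemma oriented_bd_triangle:
  "oriented_bd 2 (simplex_chain [x, y, z]) = edge x y + edge y z + edge z x"
  by (simp add: simplex_chain_3 edge_def oriented_bd_diff oriented_bd_add) (simp add: oriented_bd_lin_ext)

lemma oriented_chains_1_eq_span:
  "oriented_chains 1 K = chains.span ({edge x y |x y. x \<noteq> y \<and> {x, y} \<in> K} :: ('a list \<Rightarrow>\<^sub>0 'f::field) set)"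
proof -
  have "{xs. length xs = Suc 1 \<and> distinct xs \<and> set xs \<in> K} = {[x, y] |x y. x \<noteq> y \<and> {x, y} \<in> K}"
    by (auto simp: length_Suc_conv)
  then have "simplex_chain ` {xs. length xs = Suc 1 \<and> distinct xs \<and> set xs \<in> K} =
      ({edge x y |x y. x \<noteq> y \<and> {x, y} \<in> K} :: ('a list \<Rightarrow>\<^sub>0 'f) set)"
    by (auto simp: simplex_chain_2[symmetric])
  then show ?thesis unfolding oriented_chains_eq_span by simp
qed

lemma edge_in_oriented_chains: "{x, y} \<in> K \<Longrightarrow> edge x y \<in> oriented_chains 1 K"
  unfolding oriented_chains_1_eq_span
  by (cases "x = y") (auto intro: chains.span_zero chains.span_base)

text \<open>With a repeated vertex the three edges cancel, so the relation holds for all triples;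
  the cocycle obtained later then needs no distinctness.\<close>

lemma triangle_in_oriented_boundaries:
  assumes "{x, y, z} \<in> K"
  shows "edge x y + edge y z + edge z x \<in> oriented_boundaries 1 K"
proof (cases "distinct [x, y, z]")
  case True
  then have "simplex_chain [x, y, z] \<in> oriented_chains 2 K"
    using assms by (intro simplex_chain_in_chains) auto
  then show ?thesis
    unfolding oriented_boundaries_def
    by (metis One_nat_def Suc_1 imageI oriented_bd_triangle)
next
  case False
  then have "edge x y + edge y z + edge z x = (0 :: 'a list \<Rightarrow>\<^sub>0 'b)"
    by (auto simp: edge_def)
  then show ?thesis using chain_subspaceD(1)[OF subspace_oriented_boundaries] by metis
qed

lemma oriented_boundaries_1_subset_span:
  "oriented_boundaries 1 K \<subseteq> chains.span {edge x y + edge y z + edge z x |x y z. {x, y, z} \<in> K}"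
  (is "_ \<subseteq> chains.span ?T")
proof -
  have "oriented_chains 2 K \<subseteq> {c. oriented_bd 2 c \<in> chains.span ?T}"
    unfolding oriented_chains_eq_span
  proof (rule chains.span_minimal)
    show "simplex_chain ` {xs. length xs = Suc 2 \<and> distinct xs \<and> set xs \<in> K} \<subseteq> {c. oriented_bd 2 c \<in> chains.span ?T}"
    proof clarsimp
      fix xs :: "'a list" assume "length xs = 3" "distinct xs" "set xs \<in> K"
      moreover from this obtain x y z where "xs = [x, y, z]"
        by (auto simp: numeral_3_eq_3 length_Suc_conv)
      ultimately show "oriented_bd 2 (simplex_chain xs) \<in> chains.span ?T"
        by (auto simp: oriented_bd_triangle intro!: chains.span_base)
    qed
    show "chains.subspace {c. oriented_bd 2 c \<in> chains.span ?T}"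
      by (intro chains.subspaceI)
        (auto simp: oriented_bd_add oriented_bd_scale intro: chains.span_add chains.span_scale chains.span_zero)
  qed
  then show ?thesis by (auto simp: oriented_boundaries_def numeral_2_eq_2)
qed

lemma oriented_boundaries_1_subset_cycles:
  assumes "\<And>\<sigma> \<tau>. \<sigma> \<in> K \<Longrightarrow> \<tau> \<subseteq> \<sigma> \<Longrightarrow> \<tau> \<noteq> {} \<Longrightarrow> \<tau> \<in> K"
  shows "oriented_boundaries 1 K \<subseteq> oriented_cycles 1 K"
proof (rule order.trans[OF oriented_boundaries_1_subset_span], rule chains.span_minimal)
  note C = chain_subspaceD(2)[OF subspace_oriented_chains[of 1 K]]
  show "{edge x y + edge y z + edge z x |x y z. {x, y, z} \<in> K} \<subseteq> oriented_cycles 1 K"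
  proof clarify
    fix x y z assume *: "{x, y, z} \<in> K"
    have "{x, y} \<in> K" "{y, z} \<in> K" "{z, x} \<in> K" by (rule assms[OF *]; simp)+
    then have "edge x y + edge y z + edge z x \<in> oriented_chains 1 K"
      by (intro C edge_in_oriented_chains)
    then show "edge x y + edge y z + edge z x \<in> oriented_cycles 1 K"
      unfolding oriented_cycles_def by (simp add: oriented_bd_add oriented_bd_edge[simplified])
  qed
qed (rule subspace_oriented_cycles)

lemma oriented_chains_mono: "K \<subseteq> K' \<Longrightarrow> oriented_chains p K \<subseteq> oriented_chains p K'"
  by (auto simp: oriented_chains_def)

lemma oriented_cycles_mono: "K \<subseteq> K' \<Longrightarrow> oriented_cycles p K \<subseteq> oriented_cycles p K'"
  unfolding oriented_cycles_def using oriented_chains_mono by blast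

lemma oriented_boundaries_mono: "K \<subseteq> K' \<Longrightarrow> oriented_boundaries p K \<subseteq> oriented_boundaries p K'"
  unfolding oriented_boundaries_def by (intro image_mono oriented_chains_mono)


section \<open>Rips complexes\<close>

text \<open>A supremum over finitely many pairs is attained, so the strict bound on the diameter is
  a strict bound on every distance; taking a point with itself, it forces
  \<open>0 < r\<close>.\<close>

lemma in_Rips_iff:
  "\<sigma> \<in> Rips X r \<longleftrightarrow> finite \<sigma> \<and> \<sigma> \<noteq> {} \<and> \<sigma> \<subseteq> X \<and> (\<forall>x\<in>\<sigma>. \<forall>y\<in>\<sigma>. dist x y < r)"
proof (cases "finite \<sigma> \<and> \<sigma> \<noteq> {}")
  case True
  then have "diameter \<sigma> < r \<longleftrightarrow> (\<forall>d\<in>(\<lambda>(x, y). dist x y) ` (\<sigma> \<times> \<sigma>). d < r)"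
    unfolding diameter_def by (simp add: finite_Sup_less_iff)
  then show ?thesis using True by (auto simp: Rips_def)
qed (auto simp: Rips_def)

lemma edge_in_Rips: "{x, y} \<in> Rips X r \<longleftrightarrow> x \<in> X \<and> y \<in> X \<and> 0 < r \<and> dist x y < r"
  by (auto simp: in_Rips_iff dist_commute)

lemma triangle_in_Rips:
  "{x, y, z} \<in> Rips X r \<longleftrightarrow>
     x \<in> X \<and> y \<in> X \<and> z \<in> X \<and> 0 < r \<and> dist x y < r \<and> dist y z < r \<and> dist x z < r"
  by (auto simp: in_Rips_iff dist_commute)

lemma Rips_face: "\<sigma> \<in> Rips X r \<Longrightarrow> \<tau> \<subseteq> \<sigma> \<Longrightarrow> \<tau> \<noteq> {} \<Longrightarrow> \<tau> \<in> Rips X r"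
  unfolding in_Rips_iff by (blast intro: finite_subset)

lemma Rips_mono: "r \<le> s \<Longrightarrow> Rips X r \<subseteq> Rips X s"
  by (auto simp: Rips_def)

lemma presents_Rips_homology:
  "presents (oriented_cycles 1 (Rips X r)) (oriented_boundaries 1 (Rips X r))
     (complex_homology 1 (Rips X r)) (\<lambda>z. oriented_boundaries 1 (Rips X r) +>\<^bsub>chain_module\<^esub> z)"
  unfolding complex_homology_def
  by (rule presents_homology[OF subspace_oriented_cycles subspace_oriented_boundaries
      oriented_boundaries_1_subset_cycles[OF Rips_face]])


section \<open>Integration of local cocycles along paths\<close>

text \<open>A simplicial 1-cocycle of \<open>Rips X r\<close> as a function of ordered pairs.
  Triples may have repeated points, which for \<open>0 < r\<close> yields
  \<open>\<phi> x x = 0\<close>; values at pairs at distance at least \<open>r\<close> are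
  unconstrained.\<close>

definition local_cocycle :: "'a::metric_space set \<Rightarrow> real \<Rightarrow> ('a \<Rightarrow> 'a \<Rightarrow> 'f::field) \<Rightarrow> bool" where
  "local_cocycle X r \<phi> \<longleftrightarrow>
     (\<forall>x\<in>X. \<forall>y\<in>X. \<forall>z\<in>X. dist x y < r \<longrightarrow> dist y z < r \<longrightarrow> dist x z < r \<longrightarrow> \<phi> x y + \<phi> y z = \<phi> x z)"

lemma local_cocycleD:
  assumes "local_cocycle X r \<phi>" "x \<in> X" "y \<in> X" "z \<in> X" "dist x y < r" "dist y z < r" "dist x z < r"
  shows "\<phi> x y + \<phi> y z = \<phi> x z"
  using assms unfolding local_cocycle_def by blast

lemma local_cocycle_refl:
  assumes "local_cocycle X r \<phi>" "0 < r" "x \<in> X"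
  shows "\<phi> x x = 0"
proof -
  have "\<phi> x x + \<phi> x x = \<phi> x x + 0"
    using local_cocycleD[OF assms(1), of x x x] assms(2,3) by simp
  then show ?thesis by (simp only: add_left_cancel)
qed

text \<open>The primitive sums the cocycle along the segment from a base point.\<close>

lemma local_primitive:
  fixes K :: "'b::real_normed_vector set" and \<psi> :: "'b \<Rightarrow> 'b \<Rightarrow> 'f::field"
  assumes K: "convex K" "bounded K" and \<delta>: "\<delta> > 0"
    and \<psi>: "\<And>p q s. \<lbrakk>p \<in> K; q \<in> K; s \<in> K; dist p q < \<delta>; dist q s < \<delta>; dist p s < \<delta>\<rbrakk> \<Longrightarrow> \<psi> p q + \<psi> q s = \<psi> p s"
  obtains h where "\<And>p q. p \<in> K \<Longrightarrow> q \<in> K \<Longrightarrow> dist p q < \<delta> / 2 \<Longrightarrow> \<psi> p q = h q - h p"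
proof (cases "K = {}")
  case True then show thesis using that by auto
next
  case False
  then obtain p0 where p0: "p0 \<in> K" by auto
  obtain B where B: "\<And>p. p \<in> K \<Longrightarrow> dist p0 p \<le> B" using K(2) p0 unfolding bounded_any_center[of K p0] by blast
  have B0: "B \<ge> 0" using B[OF p0] by simp
  \<comment> \<open>Dividing the segment from the base point into \<open>N\<close> equal steps makes
    each step at most \<open>B / N\<close>, which is below \<open>\<delta> / 2\<close>.\<close>
  obtain N :: nat where N: "2 * B / \<delta> < real N" using reals_Archimedean2 by blast
  then have N0: "N > 0" using B0 \<delta> by (cases N) (auto simp: field_simps)
  have BN: "B / real N < \<delta> / 2" using N N0 \<delta> by (simp add: field_simps)
  define P where "P i p = (1 - real i / real N) *\<^sub>R p0 + (real i / real N) *\<^sub>R p" for i p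
  have PK: "P i p \<in> K" if "p \<in> K" "i \<le> N" for i p
    unfolding P_def using K(1) p0 that N0 by (intro convexD) auto
  have P0: "P 0 p = p0" and PN: "P N p = p" for p using N0 by (auto simp: P_def)
  have step: "dist (P i p) (P (Suc i) p) < \<delta> / 2" if "p \<in> K" for i p
  proof -
    have "P (Suc i) p - P i p = (1 / real N) *\<^sub>R (p - p0)"
      using N0 by (simp add: P_def algebra_simps add_divide_distrib)
    then have "dist (P (Suc i) p) (P i p) = dist p p0 / real N"
      by (simp add: dist_norm)
    then have "dist (P i p) (P (Suc i) p) = dist p0 p / real N"
      by (simp add: dist_commute)
    also have "\<dots> \<le> B / real N" using B[OF that] by (intro divide_right_mono) auto
    finally show ?thesis using BN by linarith
  qed
  have side: "dist (P i p) (P i q) < \<delta> / 2" if "dist p q < \<delta> / 2" "i \<le> N" for i p q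
  proof -
    have "P i p - P i q = (real i / real N) *\<^sub>R (p - q)" by (simp add: P_def algebra_simps)
    then have "dist (P i p) (P i q) = (real i / real N) * dist p q"
      by (simp add: dist_norm)
    also have "\<dots> \<le> 1 * dist p q" using that N0 by (intro mult_right_mono) auto
    finally show ?thesis using that by simp
  qed
  define h where "h p = (\<Sum>i<N. \<psi> (P i p) (P (Suc i) p))" for p
  \<comment> \<open>Ladder argument: the two rails run from \<open>p0\<close> to \<open>p\<close>
    and to \<open>q\<close>, and both triangles of a square contain the diagonal from
    \<open>P n p\<close> to \<open>P (Suc n) q\<close>. It is shorter than \<delta> because the
    sides are shorter than \<open>\<delta> / 2\<close>, which explains the halved bound on
    \<open>dist p q\<close>.\<close>
  have tel: "(\<Sum>i<n. \<psi> (P i p) (P (Suc i) p)) + \<psi> (P n p) (P n q) = (\<Sum>i<n. \<psi> (P i q) (P (Suc i) q))"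
    if pq: "p \<in> K" "q \<in> K" "dist p q < \<delta> / 2" and "n \<le> N" for n p q
    using \<open>n \<le> N\<close>
  proof (induction n)
    case 0
    have "\<psi> p0 p0 + \<psi> p0 p0 = \<psi> p0 p0 + 0" using \<psi>[of p0 p0 p0] p0 \<delta> by simp
    then have "\<psi> p0 p0 = 0" by (simp only: add_left_cancel)
    then show ?case by (simp add: P0)
  next
    case (Suc n)
    have pts: "P n p \<in> K" "P (Suc n) p \<in> K" "P n q \<in> K" "P (Suc n) q \<in> K"
      using PK pq Suc.prems by auto
    have d: "dist (P n p) (P (Suc n) p) < \<delta> / 2" "dist (P n q) (P (Suc n) q) < \<delta> / 2"
      "dist (P n p) (P n q) < \<delta> / 2" "dist (P (Suc n) p) (P (Suc n) q) < \<delta> / 2"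
      using step side pq Suc.prems by auto
    have d': "dist (P n p) (P (Suc n) q) < \<delta>"
      using dist_triangle[of "P n p" "P (Suc n) q" "P n q"] d by simp
    have 1: "\<psi> (P n p) (P (Suc n) p) + \<psi> (P (Suc n) p) (P (Suc n) q) = \<psi> (P n p) (P (Suc n) q)"
      using pts d d' \<delta> by (intro \<psi>) auto
    have 2: "\<psi> (P n p) (P n q) + \<psi> (P n q) (P (Suc n) q) = \<psi> (P n p) (P (Suc n) q)"
      using pts d d' \<delta> by (intro \<psi>) auto
    have 3: "(\<Sum>i<n. \<psi> (P i p) (P (Suc i) p)) + \<psi> (P n p) (P n q) = (\<Sum>i<n. \<psi> (P i q) (P (Suc i) q))"
      using Suc by simp
    show ?case
      by (simp only: sum.lessThan_Suc add.assoc 1) (simp only: 2[symmetric] 3[symmetric] add.assoc)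
  qed
  have "\<psi> p q = h q - h p" if "p \<in> K" "q \<in> K" "dist p q < \<delta> / 2" for p q
    using tel[OF that order_refl] by (simp add: h_def PN algebra_simps)
  then show thesis by (rule that)
qed

text \<open>Uniform continuity of \<open>F\<close> pulls the cocycle back to one on \<open>K\<close>
  at some scale \<delta>, and a bounded convex set carries a primitive.\<close>

lemma local_primitive_compose:
  fixes K :: "'b::real_normed_vector set" and \<phi> :: "'a::metric_space \<Rightarrow> 'a \<Rightarrow> 'f::field"
  assumes \<phi>: "local_cocycle X r \<phi>" "0 < r" and K: "convex K" "compact K"
    and F: "continuous_on K F" "F ` K \<subseteq> X"
  obtains \<delta> h where "\<delta> > 0" "\<And>p q. p \<in> K \<Longrightarrow> q \<in> K \<Longrightarrow> dist p q < \<delta> \<Longrightarrow> \<phi> (F p) (F q) = h q - h p"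
proof -
  have "uniformly_continuous_on K F" using F(1) K(2) by (rule compact_uniformly_continuous)
  then obtain \<delta> where \<delta>: "\<delta> > 0" "\<And>p q. p \<in> K \<Longrightarrow> q \<in> K \<Longrightarrow> dist p q < \<delta> \<Longrightarrow> dist (F p) (F q) < r"
    using \<open>0 < r\<close> unfolding uniformly_continuous_on_def by (metis dist_commute)
  obtain h where "\<And>p q. p \<in> K \<Longrightarrow> q \<in> K \<Longrightarrow> dist p q < \<delta> / 2 \<Longrightarrow> \<phi> (F p) (F q) = h q - h p"
  proof (rule local_primitive[OF K(1) compact_imp_bounded[OF K(2)] \<delta>(1), of "\<lambda>p q. \<phi> (F p) (F q)"])
    show "\<phi> (F p) (F q) + \<phi> (F q) (F s) = \<phi> (F p) (F s)"
      if "p \<in> K" "q \<in> K" "s \<in> K" "dist p q < \<delta>" "dist q s < \<delta>" "dist p s < \<delta>" for p q s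
      by (rule local_cocycleD[OF \<phi>(1)]) (use that \<delta>(2) F(2) in auto)
  qed blast
  then show thesis using that[of "\<delta> / 2" h] \<delta>(1) by simp
qed

section \<open>Sums of a cocycle over partitions of a path and their limit\<close>

definition path_sum :: "('a \<Rightarrow> 'a \<Rightarrow> 'f::comm_monoid_add) \<Rightarrow> (real \<Rightarrow> 'a) \<Rightarrow> nat \<Rightarrow> 'f" where
  "path_sum \<phi> g N = (\<Sum>i<N. \<phi> (g (real i / real N)) (g (real (Suc i) / real N)))"

text \<open>
  Meaningful for local cocycles only: then the sums over equidistant partitions are eventually
  constant.
\<close>

definition path_integral :: "('a \<Rightarrow> 'a \<Rightarrow> 'f::comm_monoid_add) \<Rightarrow> (real \<Rightarrow> 'a) \<Rightarrow> 'f" where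
  "path_integral \<phi> g = (THE v. \<forall>\<^sub>F N in sequentially. path_sum \<phi> g N = v)"

lemma path_integral_eqI:
  assumes "\<forall>\<^sub>F N in sequentially. path_sum \<phi> g N = v"
  shows "path_integral \<phi> g = v"
  unfolding path_integral_def
proof (rule the_equality)
  show "\<forall>\<^sub>F N in sequentially. path_sum \<phi> g N = v" by (rule assms)
  fix w assume "\<forall>\<^sub>F N in sequentially. path_sum \<phi> g N = w"
  with assms have "\<forall>\<^sub>F N in sequentially. w = v" by eventually_elim simp
  then show "w = v" by simp
qed

lemma path_sum_cong:
  assumes "\<And>s. s \<in> {0..1} \<Longrightarrow> g s = h s"
  shows "path_sum \<phi> g N = path_sum \<phi> h N"
  unfolding path_sum_def by (rule sum.cong) (auto simp: assms)

lemma path_integral_cong: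
  assumes "\<And>s. s \<in> {0..1} \<Longrightarrow> g s = h s"
  shows "path_integral \<phi> g = path_integral \<phi> h"
  unfolding path_integral_def using path_sum_cong[of g h \<phi>] assms by simp

lemma eventually_mesh_less:
  assumes "\<delta> > 0"
  shows "\<forall>\<^sub>F N in sequentially. N > 0 \<and> 1 / real N < \<delta>"
  using order_tendstoD(2)[OF lim_1_over_n assms] by (intro eventually_conj eventually_gt_at_top)

lemma path_sum_primitive:
  fixes \<phi> :: "'a \<Rightarrow> 'a \<Rightarrow> 'f::field"
  assumes "\<delta> > 0" and h: "\<And>s t. s \<in> {0..1} \<Longrightarrow> t \<in> {0..1} \<Longrightarrow> dist s t < \<delta> \<Longrightarrow> \<phi> (g s) (g t) = h t - h s"
  shows "\<forall>\<^sub>F N in sequentially. path_sum \<phi> g N = h 1 - h 0"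
  using eventually_mesh_less[OF assms(1)]
proof eventually_elim
  case (elim N)
  have "path_sum \<phi> g N = (\<Sum>i<N. h (real (Suc i) / real N) - h (real i / real N))"
    unfolding path_sum_def
  proof (rule sum.cong[OF refl], rule h)
    fix i assume "i \<in> {..<N}"
    then show "real i / real N \<in> {0..1}" "real (Suc i) / real N \<in> {0..1}" by auto
    have "real (Suc i) / real N = real i / real N + 1 / real N" by (simp add: add_divide_distrib)
    then show "dist (real i / real N) (real (Suc i) / real N) < \<delta>"
      using elim by (simp only: dist_real_def) simp
  qed
  also have "\<dots> = h 1 - h 0"
    using elim sum_lessThan_telescope[of "\<lambda>i. h (real i / real N)" N] by simp
  finally show ?case .
qed

lemmas path_integral_primitive = path_integral_eqI[OF path_sum_primitive]

text \<open>The path of a singular 1-simplex; on \<open>[0, 1]\<close> it undoes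
  \<open>path_simplex\<close>.\<close>

definition simplex_path :: "((nat \<Rightarrow> real) \<Rightarrow> 'a) \<Rightarrow> real \<Rightarrow> 'a" where
  "simplex_path f s = f (\<lambda>i. if i = 0 then 1 - s else if i = 1 then s else 0)"

definition chain_integral :: "('a \<Rightarrow> 'a \<Rightarrow> 'f::field) \<Rightarrow> ('a, 'f) schain \<Rightarrow> 'f" where
  "chain_integral \<phi> c = lin_ext (*) (\<lambda>f. path_integral \<phi> (simplex_path f)) c"

lemma barycentric_in_simplex:
  "s \<in> {0..1} \<Longrightarrow> (\<lambda>i. if i = 0 then 1 - s else if i = 1 then s else 0) \<in> standard_simplex (Suc 0)"
  by (auto simp: standard_simplex_def)

lemma chain_integral_path_chain: "chain_integral \<phi> (path_chain g) = path_integral \<phi> g"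
proof -
  have "path_integral \<phi> (simplex_path (path_simplex g)) = path_integral \<phi> g"
    by (rule path_integral_cong) (use barycentric_in_simplex in \<open>auto simp: simplex_path_def path_simplex_def\<close>)
  then show ?thesis by (simp add: chain_integral_def)
qed

text \<open>The primitive on the simplex turns each face integral into a difference of end values,
  and the alternating sum cancels. The simplex is reparametrized by a plane triangle because the
  primitive is built from straight segments in a normed space.\<close>

lemma chain_integral_triangle:
  fixes \<phi> :: "'a::metric_space \<Rightarrow> 'a \<Rightarrow> 'f::field"
  assumes \<phi>: "local_cocycle X r \<phi>" "0 < r" and \<sigma>: "singular_simplex 2 (top_of_set X) \<sigma>"
  shows "chain_integral \<phi> (singular_bd 2 (single \<sigma> a)) = 0"
proof -
  define K :: "(real \<times> real) set" where "K = {p. 0 \<le> fst p \<and> 0 \<le> snd p \<and> fst p + snd p \<le> 1}"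
  define T :: "real \<times> real \<Rightarrow> nat \<Rightarrow> real"
    where "T p = (\<lambda>i. if i = 0 then 1 - fst p - snd p else if i = 1 then fst p else if i = 2 then snd p else 0)" for p
  have K: "convex K" "compact K"
  proof -
    have eq: "K = {p. (-1, 0) \<bullet> p \<le> 0} \<inter> {p. (0, -1) \<bullet> p \<le> 0} \<inter> {p. (1, 1) \<bullet> p \<le> 1}"
      by (auto simp: K_def)
    show "convex K" unfolding eq by (intro convex_Int convex_halfspace_le)
    have "closed K" unfolding eq by (intro closed_Int closed_halfspace_le)
    moreover have "K \<subseteq> {0..1} \<times> {0..1}" by (auto simp: K_def)
    then have "bounded K" by (rule bounded_subset[rotated]) (auto intro: bounded_Times)
    ultimately show "compact K" by (simp add: compact_eq_bounded_closed)
  qed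
  have TK: "T p \<in> standard_simplex 2" if "p \<in> K" for p
    using that by (auto simp: K_def T_def standard_simplex_def numeral_2_eq_2)
  have "continuous_map euclidean (powertop_real UNIV) T"
    unfolding continuous_map_componentwise_UNIV
  proof
    fix i :: nat
    consider "i = 0" | "i = 1" | "i = 2" | "i > 2" by linarith
    then show "continuous_map euclidean euclideanreal (\<lambda>x. T x i)"
      by cases (auto simp: T_def intro!: continuous_intros)
  qed
  then have "continuous_map (top_of_set K) (subtopology (powertop_real UNIV) (standard_simplex 2)) T"
    using TK by (auto simp: continuous_map_in_subtopology intro: continuous_map_from_subtopology)
  then have "continuous_map (top_of_set K) (top_of_set X) (\<sigma> \<circ> T)"
    using \<sigma> unfolding singular_simplex_def by (metis continuous_map_compose)
  then have "continuous_on K (\<sigma> \<circ> T)" "(\<sigma> \<circ> T) ` K \<subseteq> X"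
    by (auto simp: continuous_map_in_subtopology)
  from local_primitive_compose[OF \<phi> K this] obtain \<delta> h where \<delta>: "\<delta> > 0"
    and h: "\<And>p q. p \<in> K \<Longrightarrow> q \<in> K \<Longrightarrow> dist p q < \<delta> \<Longrightarrow> \<phi> (\<sigma> (T p)) (\<sigma> (T q)) = h q - h p"
    by auto
  \<comment> \<open>\<open>c\<close> runs along one edge of \<open>K\<close>. On the edge
    \<open>(1 - s, s)\<close> both coordinates move, hence the Lipschitz constant 2 and the scale
    \<open>\<delta> / 2\<close>.\<close>
  have face: "path_integral \<phi> (simplex_path (singular_face 2 k \<sigma>)) = h (c 1) - h (c 0)"
    if k: "k \<le> 2" and c: "\<And>s. s \<in> {0..1} \<Longrightarrow> c s \<in> K"
      "\<And>s. simplical_face k (\<lambda>i. if i = 0 then 1 - s else if i = 1 then s else 0) = T (c s)"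
      "\<And>s t. dist (c s) (c t) \<le> 2 * dist s t" for k c
  proof -
    have "path_integral \<phi> (simplex_path (singular_face 2 k \<sigma>)) = path_integral \<phi> (\<lambda>s. \<sigma> (T (c s)))"
      by (rule path_integral_cong)
        (use barycentric_in_simplex c(2) in \<open>auto simp: simplex_path_def singular_face_def\<close>)
    also have "\<dots> = h (c 1) - h (c 0)"
    proof (rule path_integral_primitive[of "\<delta> / 2" \<phi> _ "\<lambda>s. h (c s)"])
      fix s t :: real assume st: "s \<in> {0..1}" "t \<in> {0..1}" "dist s t < \<delta> / 2"
      then have "dist (c s) (c t) < \<delta>" using c(3)[of s t] by simp
      then show "\<phi> (\<sigma> (T (c s))) (\<sigma> (T (c t))) = h (c t) - h (c s)" using h c(1) st by blast
    qed (use \<delta> in simp)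
    finally show ?thesis .
  qed
  have dist2: "dist (a, b) (a', b') \<le> dist a a' + dist b b'" for a b a' b' :: real
    unfolding dist_Pair_Pair by (rule sqrt_sum_squares_le_sum) auto
  have d: "dist (1 - s, s) (1 - t, t) \<le> 2 * dist s t" "dist (0 :: real, s) (0, t) \<le> 2 * dist s t"
    "dist (s, 0 :: real) (t, 0) \<le> 2 * dist s t" for s t :: real
  proof -
    have "dist (1 - s) (1 - t) = dist s t" by (simp add: dist_real_def abs_minus_commute)
    then show "dist (1 - s, s) (1 - t, t) \<le> 2 * dist s t" using dist2[of "1 - s" s "1 - t" t] by simp
    show "dist (0 :: real, s) (0, t) \<le> 2 * dist s t" by (simp add: dist_Pair_Pair)
    show "dist (s, 0 :: real) (t, 0) \<le> 2 * dist s t" by (simp add: dist_Pair_Pair)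
  qed
  have "path_integral \<phi> (simplex_path (singular_face 2 0 \<sigma>)) = h (0, 1) - h (1, 0)"
    using face[of 0 "\<lambda>s. (1 - s, s)"] d
    by (force simp: K_def T_def simplical_face_def)
  moreover have "path_integral \<phi> (simplex_path (singular_face 2 1 \<sigma>)) = h (0, 1) - h (0, 0)"
    using face[of 1 "\<lambda>s. (0, s)"] d
    by (force simp: K_def T_def simplical_face_def)
  moreover have "path_integral \<phi> (simplex_path (singular_face 2 2 \<sigma>)) = h (1, 0) - h (0, 0)"
    using face[of 2 "\<lambda>s. (s, 0)"] d
    by (force simp: K_def T_def simplical_face_def)
  ultimately show ?thesis
    unfolding chain_integral_def singular_bd_2_single
    by (simp only: vector_space_over_itself.lin_ext_add vector_space_over_itself.lin_ext_diff vector_space_over_itself.lin_ext_single) (simp add: algebra_simps)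
qed

lemma chain_integral_boundary:
  assumes "local_cocycle X r \<phi>" "0 < r" "b \<in> singular_boundaries 1 (top_of_set X)"
  shows "chain_integral \<phi> b = 0"
proof -
  obtain c where c: "c \<in> singular_chains 2 (top_of_set X)" "b = singular_bd 2 c"
    using assms(3) by (auto simp: singular_boundaries_def numeral_2_eq_2)
  have "b = (\<Sum>k\<in>keys c. singular_bd 2 (single k (lookup c k)))"
    by (simp only: c(2) singular_bd_sum[symmetric] chain_eq_sum_single[symmetric])
  then have "chain_integral \<phi> b =
      (\<Sum>k\<in>keys c. chain_integral \<phi> (singular_bd 2 (single k (lookup c k))))"
    by (simp only: chain_integral_def vector_space_over_itself.lin_ext_sum)
  also have "\<dots> = 0"
    by (intro sum.neutral ballI chain_integral_triangle[OF assms(1,2)] singular_chains_sum_single[OF c(1)])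
  finally show ?thesis .
qed

section \<open>Cocycles on polygons and the vanishing of the integral on short loops\<close>

lemma cocycle_sum_clustered:
  assumes \<phi>: "local_cocycle X r \<phi>" "0 < r" and x: "\<And>i. a \<le> i \<Longrightarrow> i \<le> b \<Longrightarrow> x i \<in> X"
    and d: "\<And>i j. a \<le> i \<Longrightarrow> i \<le> b \<Longrightarrow> a \<le> j \<Longrightarrow> j \<le> b \<Longrightarrow> dist (x i) (x j) < r" and "a \<le> b"
  shows "(\<Sum>i=a..<b. \<phi> (x i) (x (Suc i))) = \<phi> (x a) (x b)"
  using \<open>a \<le> b\<close> x d
proof (induction b rule: dec_induct)
  case base
  then show ?case using local_cocycle_refl[OF \<phi>] by simp
next
  case (step n)
  have "(\<Sum>i=a..<n. \<phi> (x i) (x (Suc i))) = \<phi> (x a) (x n)"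
    by (rule step.IH) (use step.prems in auto)
  moreover have "\<phi> (x a) (x n) + \<phi> (x n) (x (Suc n)) = \<phi> (x a) (x (Suc n))"
    using step by (intro local_cocycleD[OF \<phi>(1)]) auto
  ultimately show ?case using step.hyps by simp
qed

lemma dist_le_sum_dist:
  fixes x :: "nat \<Rightarrow> 'a::metric_space"
  assumes "a \<le> b"
  shows "dist (x a) (x b) \<le> (\<Sum>i=a..<b. dist (x i) (x (Suc i)))"
  using assms
proof (induction b rule: dec_induct)
  case (step n)
  then show ?case using dist_triangle[of "x a" "x (Suc n)" "x n"] by simp
qed simp

text \<open>The polygon splits greedily into three arcs of length less than \<open>r\<close>.\<close>

lemma cocycle_sum_short_polygon:
  fixes x :: "nat \<Rightarrow> 'a::metric_space"
  assumes \<phi>: "local_cocycle X r \<phi>" "0 < r" and x: "\<And>i. i \<le> N \<Longrightarrow> x i \<in> X" and closed: "x N = x 0"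
    and L: "(\<Sum>i<N. dist (x i) (x (Suc i))) \<le> L" "L < 3 * r"
    and step: "\<And>i. i < N \<Longrightarrow> dist (x i) (x (Suc i)) < r - L / 3"
  shows "(\<Sum>i<N. \<phi> (x i) (x (Suc i))) = 0"
proof -
  define S where "S n = (\<Sum>i<n. dist (x i) (x (Suc i)))" for n
  have S_diff: "S b - S a = (\<Sum>i=a..<b. dist (x i) (x (Suc i)))" if "a \<le> b" for a b
    unfolding S_def using that sum_diff_nat_ivl[of 0 a b "\<lambda>i. dist (x i) (x (Suc i))"]
    by (simp add: atLeast0LessThan)
  have S_mono: "S a \<le> S b" if "a \<le> b" for a b
    using S_diff[OF that] sum_nonneg[of "{a..<b}" "\<lambda>i. dist (x i) (x (Suc i))"] by simp
  have dS: "dist (x i) (x j) \<le> S b - S a" if "a \<le> i" "i \<le> b" "a \<le> j" "j \<le> b" for a b i j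
  proof -
    have *: "dist (x i) (x j) \<le> S b - S a" if "a \<le> i" "i \<le> j" "j \<le> b" for i j
      using dist_le_sum_dist[OF that(2), of x] S_diff[OF that(2)] S_mono[OF that(1)] S_mono[OF that(3)] by simp
    show ?thesis using *[of i j] *[of j i] that by (cases "i \<le> j") (auto simp: dist_commute)
  qed
  have arc: "(\<Sum>i=a..<b. \<phi> (x i) (x (Suc i))) = \<phi> (x a) (x b)"
    if "a \<le> b" "b \<le> N" "S b - S a < r" for a b
    using that x dS[of a _ b] by (intro cocycle_sum_clustered[OF \<phi>]) (auto intro: le_less_trans)
  \<comment> \<open>The arc is prolonged as long as it stays below \<open>r\<close>. The step that
    would break this bound is shorter than \<open>r - L / 3\<close>, so an arc that stops before
    \<open>N\<close> is already longer than \<open>L / 3\<close>.\<close>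
  have arc_exists: "\<exists>b. a \<le> b \<and> b \<le> N \<and> S b - S a < r \<and> (b = N \<or> S b - S a > L / 3)" if "a \<le> N" for a
  proof -
    define I where "I = {b. a \<le> b \<and> b \<le> N \<and> S b - S a < r}"
    have I: "finite I" "a \<in> I" using \<phi>(2) that by (auto simp: I_def)
    then have "Max I \<in> I" by (intro Max_in) auto
    moreover have "S (Max I) - S a > L / 3" if "Max I \<noteq> N"
    proof -
      have "Suc (Max I) \<notin> I" using Max_ge[OF I(1)] not_less_eq_eq by blast
      with \<open>Max I \<in> I\<close> that have "S (Suc (Max I)) - S a \<ge> r" by (auto simp: I_def)
      moreover have "S (Suc (Max I)) = S (Max I) + dist (x (Max I)) (x (Suc (Max I)))" by (simp add: S_def)
      moreover have "dist (x (Max I)) (x (Suc (Max I))) < r - L / 3"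
        using \<open>Max I \<in> I\<close> that by (intro step) (auto simp: I_def)
      ultimately show ?thesis by linarith
    qed
    ultimately show ?thesis by (auto simp: I_def)
  qed
  obtain i where i: "i \<le> N" "S i < r" "i = N \<or> S i > L / 3"
    using arc_exists[of 0] by (auto simp: S_def)
  obtain j where j: "i \<le> j" "j \<le> N" "S j - S i < r" "j = N \<or> S j - S i > L / 3"
    using arc_exists[OF i(1)] by auto
  have "S N \<le> L" using L(1) by (simp add: S_def)
  \<comment> \<open>Two arcs longer than \<open>L / 3\<close> leave less than \<open>L / 3\<close>,
    which is below \<open>r\<close>; if one of them ended at \<open>N\<close>, nothing is
    left.\<close>
  then have tail: "S N - S j < r"
    using i j \<phi>(2) L(2) by auto
  have "(\<Sum>i<N. \<phi> (x i) (x (Suc i))) =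
      (\<Sum>i=0..<i. \<phi> (x i) (x (Suc i))) + (\<Sum>i=i..<j. \<phi> (x i) (x (Suc i))) + (\<Sum>i=j..<N. \<phi> (x i) (x (Suc i)))"
    using i(1) j(1,2) by (simp add: sum.atLeastLessThan_concat flip: atLeast0LessThan)
  also have "\<dots> = \<phi> (x 0) (x i) + \<phi> (x i) (x j) + \<phi> (x j) (x N)"
    using arc[of 0 i] arc[of i j] arc[of j N] i j tail by (simp add: S_def)
  also have "\<phi> (x 0) (x i) + \<phi> (x i) (x j) = \<phi> (x 0) (x j)"
  proof (rule local_cocycleD[OF \<phi>(1)])
    show "dist (x 0) (x i) < r" using dS[of 0 0 i i] i by (simp add: S_def)
    show "dist (x i) (x j) < r" using dS[of i i j j] j by simp
    \<comment> \<open>The polygon is closed, so this distance is bounded by the third arc. Thus the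
      three dividing points span a Rips triangle.\<close>
    show "dist (x 0) (x j) < r" using dS[of j N N j] j tail closed by simp
  qed (use x i j in auto)
  also have "\<phi> (x 0) (x j) + \<phi> (x j) (x N) = \<phi> (x 0) (x N)"
  proof (rule local_cocycleD[OF \<phi>(1)])
    show "dist (x 0) (x j) < r" using dS[of j N N j] j tail closed by simp
    then show "dist (x j) (x N) < r" using closed by (simp add: dist_commute)
  qed (use x j closed \<phi>(2) in auto)
  also have "\<dots> = 0" using local_cocycle_refl[OF \<phi>] x[of 0] closed by simp
  finally show ?thesis .
qed

lemma sum_dist_le_path_length:
  assumes "N > 0"
  shows "ennreal (\<Sum>i<N. dist (g (real i / real N)) (g (real (Suc i) / real N))) \<le> path_length g"
proof -
  have "(\<Sum>i<N. ennreal (dist (g (real i / real N)) (g (real (Suc i) / real N)))) \<le> path_length g"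
    by (rule path_length_partition) (use assms in \<open>auto intro!: mono_onI divide_right_mono\<close>)
  then show ?thesis by (simp add: sum_ennreal)
qed

lemma path_integral_short_loop:
  fixes \<phi> :: "'a::metric_space \<Rightarrow> 'a \<Rightarrow> 'f::field"
  assumes \<phi>: "local_cocycle X r \<phi>" "0 < r" and g: "loop_in X g" "path_length g < ennreal (3 * r)"
  shows "path_integral \<phi> g = 0"
proof -
  have g': "path g" "path_image g \<subseteq> X" "g 1 = g 0" "\<And>s. s \<in> {0..1} \<Longrightarrow> g s \<in> X"
    using g(1) by (auto simp: loop_in_def path_image_def pathstart_def pathfinish_def)
  obtain L where L: "path_length g = ennreal L" "0 \<le> L" "L < 3 * r"
    using g(2) by (cases "path_length g") (auto simp: ennreal_less_iff)
  have "uniformly_continuous_on {0..1} g"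
    using g'(1) unfolding path_def by (rule compact_uniformly_continuous) simp
  \<comment> \<open>Uniform continuity is applied with exactly the bound on the steps that the
    splitting into three arcs requires.\<close>
  moreover have "r - L / 3 > 0" using L(3) by simp
  ultimately obtain \<delta> where \<delta>: "\<delta> > 0"
    "\<And>s t. s \<in> {0..1} \<Longrightarrow> t \<in> {0..1} \<Longrightarrow> dist s t < \<delta> \<Longrightarrow> dist (g s) (g t) < r - L / 3"
    unfolding uniformly_continuous_on_def by (metis dist_commute)
  have "\<forall>\<^sub>F N in sequentially. path_sum \<phi> g N = 0"
    using eventually_mesh_less[OF \<delta>(1)]
  proof eventually_elim
    case (elim N)
    show ?case
      unfolding path_sum_def
    proof (rule cocycle_sum_short_polygon[OF \<phi>, where x = "\<lambda>i. g (real i / real N)" and L = L])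
      show "(\<Sum>i<N. dist (g (real i / real N)) (g (real (Suc i) / real N))) \<le> L"
        using sum_dist_le_path_length[of N g] elim L by simp
      show "g (real N / real N) = g (real 0 / real N)" using elim g'(3) by simp
      show "g (real i / real N) \<in> X" if "i \<le> N" for i using that elim by (intro g'(4)) auto
      show "dist (g (real i / real N)) (g (real (Suc i) / real N)) < r - L / 3" if "i < N" for i
      proof (rule \<delta>(2))
        have "real (Suc i) / real N = real i / real N + 1 / real N" by (simp add: add_divide_distrib)
        then show "dist (real i / real N) (real (Suc i) / real N) < \<delta>"
          using elim by (simp only: dist_real_def) simp
      qed (use that in auto)
    qed (rule L(3))
  qed
  then show ?thesis by (rule path_integral_eqI)
qed

lemma path_integral_small_path:
  fixes \<phi> :: "'a::metric_space \<Rightarrow> 'a \<Rightarrow> 'f::field"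
  assumes \<phi>: "local_cocycle X r \<phi>" "0 < r" and g: "path_image g \<subseteq> X"
    "\<And>s t. s \<in> {0..1} \<Longrightarrow> t \<in> {0..1} \<Longrightarrow> dist (g s) (g t) < r"
  shows "path_integral \<phi> g = \<phi> (pathstart g) (pathfinish g)"
proof (rule path_integral_eqI)
  show "\<forall>\<^sub>F N in sequentially. path_sum \<phi> g N = \<phi> (pathstart g) (pathfinish g)"
    using eventually_gt_at_top[of 0]
  proof eventually_elim
    case (elim N)
    have "path_sum \<phi> g N = (\<Sum>i=0..<N. \<phi> (g (real i / real N)) (g (real (Suc i) / real N)))"
      unfolding path_sum_def by (simp add: atLeast0LessThan)
    also have "\<dots> = \<phi> (g (real 0 / real N)) (g (real N / real N))"
      by (rule cocycle_sum_clustered[OF \<phi>, where x = "\<lambda>i. g (real i / real N)"])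
        (use g elim in \<open>auto simp: path_image_def\<close>)
    finally show ?case using elim by (simp add: pathstart_def pathfinish_def)
  qed
qed


section \<open>Geodesic realization of Rips cycles\<close>

definition orients :: "('a \<times> 'a) set \<Rightarrow> bool" where
  "orients R \<longleftrightarrow> (\<forall>x y. x \<noteq> y \<longrightarrow> ((x, y) \<in> R \<longleftrightarrow> (y, x) \<notin> R))"

lemma orientation_exists: "\<exists>R :: ('a \<times> 'a) set. orients R"
proof -
  obtain R :: "('a \<times> 'a) set" where R: "Well_order R \<and> Field R = UNIV" using well_ordering ..
  then have "antisym R" "total_on (Field R) R"
    unfolding well_order_on_def linear_order_on_def partial_order_on_def by blast+
  then have "orients R" unfolding orients_def using R by (metis UNIV_I antisymD total_on_def)
  then show ?thesis ..
qed

lemma orientsD: "orients R \<Longrightarrow> x \<noteq> y \<Longrightarrow> (x, y) \<in> R \<longleftrightarrow> (y, x) \<notin> R"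
  unfolding orients_def by blast

text \<open>Geodesics need not be unique, so opposite choices are forced to be each other's reverse.\<close>

definition geodesic_choice :: "'a::metric_space set \<Rightarrow> ('a \<Rightarrow> 'a \<Rightarrow> real \<Rightarrow> 'a) \<Rightarrow> bool" where
  "geodesic_choice X G \<longleftrightarrow>
     (\<forall>x\<in>X. \<forall>y\<in>X. path (G x y) \<and> path_image (G x y) \<subseteq> X \<and> pathstart (G x y) = x \<and>
        pathfinish (G x y) = y \<and> path_length (G x y) \<le> ennreal (dist x y) \<and>
        (x \<noteq> y \<longrightarrow> G y x = reversepath (G x y)))"

lemma geodesic_choiceD:
  assumes "geodesic_choice X G" "x \<in> X" "y \<in> X"
  shows "path (G x y)" "path_image (G x y) \<subseteq> X" "pathstart (G x y) = x" "pathfinish (G x y) = y"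
    "path_length (G x y) \<le> ennreal (dist x y)" "x \<noteq> y \<Longrightarrow> G y x = reversepath (G x y)"
  using assms unfolding geodesic_choice_def by blast+

lemma geodesic_choice_exists:
  assumes "geodesic_space X"
  obtains G where "geodesic_choice X G"
proof -
  obtain R :: "('a \<times> 'a) set" where R: "orients R" using orientation_exists ..
  define P where "P x y g \<longleftrightarrow> path g \<and> path_image g \<subseteq> X \<and> pathstart g = x \<and> pathfinish g = y \<and>
      path_length g \<le> ennreal (dist x y)" for x y g
  define G0 where "G0 x y = (SOME g. P x y g)" for x y
  have G0: "P x y (G0 x y)" if xy: "x \<in> X" "y \<in> X" for x y
  proof -
    have "\<exists>g. P x y g" using assms xy unfolding geodesic_space_def P_def by (metis order_refl)
    then show ?thesis unfolding G0_def by (rule someI_ex)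
  qed
  define G where "G x y = (if (x, y) \<in> R then G0 x y else reversepath (G0 y x))" for x y
  have "P x y (G x y)" if "x \<in> X" "y \<in> X" for x y
  proof (cases "(x, y) \<in> R")
    case True
    then show ?thesis using G0[OF that] by (simp add: G_def)
  next
    case False
    have "P y x (G0 y x)" using G0[OF that(2,1)] .
    then have "P x y (reversepath (G0 y x))"
      using order.trans[OF path_length_reversepath[of "G0 y x"]] by (simp add: P_def dist_commute[of x y])
    then show ?thesis using False by (simp add: G_def)
  qed
  moreover have "G y x = reversepath (G x y)" if "x \<noteq> y" for x y
    using orientsD[OF R that] by (auto simp: G_def)
  ultimately have "geodesic_choice X G" unfolding geodesic_choice_def P_def by blast
  then show thesis by (rule that)
qed

lemma geodesic_choice_small:
  assumes "geodesic_choice X G" "x \<in> X" "y \<in> X" "s \<in> {0..1}" "t \<in> {0..1}"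
  shows "dist (G x y s) (G x y t) \<le> dist x y"
  using dist_le_path_length[OF assms(4,5), of "G x y"] geodesic_choiceD(5)[OF assms(1-3)]
  by (metis ennreal_le_iff order_trans zero_le_dist)

text \<open>An oriented chain stores every edge at both orderings, with opposite signs. Summing over
  both would realize twice the edge up to boundaries, which is lost in characteristic 2, so the
  orientation \<open>R\<close> selects one ordering.\<close>

definition realize ::
  "('a \<times> 'a) set \<Rightarrow> ('a \<Rightarrow> 'a \<Rightarrow> real \<Rightarrow> 'a) \<Rightarrow> ('a list \<Rightarrow>\<^sub>0 'f::field) \<Rightarrow> ('a, 'f) schain" where
  "realize R G c =
     lin_ext chain_scale (\<lambda>xs. if (xs ! 0, xs ! 1) \<in> R then path_chain (G (xs ! 0) (xs ! 1)) else 0) c"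

text \<open>The cycles that die in the Rips complex at scale \<open>r\<close>.\<close>

definition short_cycles :: "'a::metric_space set \<Rightarrow> real \<Rightarrow> ('a, 'f::field) schain set" where
  "short_cycles X r =
     chains.span (singular_boundaries 1 (top_of_set X) \<union>
       path_chain ` {g. loop_in X g \<and> path_length g < ennreal (3 * r)})"

lemma subspace_short_cycles: "chains.subspace (short_cycles X r)"
  by (simp add: short_cycles_def)

lemma boundaries_subset_short_cycles: "singular_boundaries 1 (top_of_set X) \<subseteq> short_cycles X r"
  unfolding short_cycles_def using chains.span_superset by blast

lemma short_cycles_subset_cycles: "short_cycles X r \<subseteq> singular_cycles 1 (top_of_set X)"
  unfolding short_cycles_def using singular_boundaries_1_subset_cycles loop_in_cycle
  by (intro chains.span_minimal subspace_singular_cycles) blast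

lemma short_loop_in_short_cycles:
  "loop_in X g \<Longrightarrow> path_length g < ennreal (3 * r) \<Longrightarrow> path_chain g \<in> short_cycles X r"
  unfolding short_cycles_def by (intro chains.span_base) blast

lemma short_cycles_mono: "r \<le> s \<Longrightarrow> short_cycles X r \<subseteq> short_cycles X s"
  unfolding short_cycles_def using ennreal_leI[of "3 * r" "3 * s"]
  by (intro chains.span_mono Un_mono image_mono order_refl) (auto intro: less_le_trans)

lemma realize_add: "realize R G (c + d) = realize R G c + realize R G d"
  by (simp add: realize_def chains.lin_ext_add)

lemma realize_scale: "realize R G (chain_scale k c) = chain_scale k (realize R G c)"
  by (simp add: realize_def chains.lin_ext_scale)

lemma realize_zero [simp]: "realize R G 0 = 0"
  by (simp add: realize_def)

text \<open>The effect of realization on 0-chains, where a list is a single vertex; with it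
  \<open>realize\<close> commutes with the boundary operators.\<close>

definition chain_points :: "('a list \<Rightarrow>\<^sub>0 'f::field) \<Rightarrow> ('a, 'f) schain" where
  "chain_points c = lin_ext chain_scale (\<lambda>xs. single (point_simplex (hd xs)) 1) c"

lemma oriented_chains_1_induct [consumes 1, case_names edge add scale zero]:
  assumes "c \<in> oriented_chains 1 K"
    and "\<And>x y. x \<noteq> y \<Longrightarrow> {x, y} \<in> K \<Longrightarrow> P (edge x y)"
    and "\<And>c d. P c \<Longrightarrow> P d \<Longrightarrow> P (c + d)" "\<And>k c. P c \<Longrightarrow> P (chain_scale k c)" "P 0"
  shows "P c"
proof -
  have "oriented_chains 1 K \<subseteq> {c. P c}"
    unfolding oriented_chains_1_eq_span
    by (rule chains.span_minimal) (use assms(2-) in \<open>auto intro!: chains.subspaceI\<close>)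
  then show ?thesis using assms(1) by blast
qed

locale geodesic_realization =
  fixes X :: "'a::metric_space set" and R :: "('a \<times> 'a) set" and G :: "'a \<Rightarrow> 'a \<Rightarrow> real \<Rightarrow> 'a"
  assumes R: "orients R"
    and G: "geodesic_choice X G"
begin

text \<open>Up to boundaries the orientation disappears: for the direction not selected the value is
  minus the reversed geodesic, and for \<open>x = y\<close> the geodesic is constant.\<close>

lemma realize_edge:
  assumes "x \<in> X" "y \<in> X"
  shows "realize R G (edge x y) - (path_chain (G x y) :: ('a, 'f::field) schain)
    \<in> singular_boundaries 1 (top_of_set X)"
proof (cases "x = y")
  case True
  have "G x x s = x" if "s \<in> {0..1}" for s
    using geodesic_choice_small[OF G assms(1) assms(1) that, of 0] geodesic_choiceD(3)[OF G assms(1) assms(1)]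
    by (simp add: pathstart_def)
  then have "path_simplex (G x y) = path_simplex (\<lambda>_. x)" using True by (intro path_simplex_cong) auto
  then show ?thesis
    using True chain_subspaceD(5)[OF subspace_singular_boundaries const_path_chain_boundary[OF assms(1)]]
    by simp
next
  case False
  note g = geodesic_choiceD[OF G assms]
  show ?thesis
  proof (cases "(x, y) \<in> R")
    case True
    then have "realize R G (edge x y) = (path_chain (G x y) :: ('a, 'f) schain)"
      using orientsD[OF R False] by (simp add: realize_def edge_def chains.lin_ext_diff)
    then show ?thesis using chain_subspaceD(1)[OF subspace_singular_boundaries] by simp
  next
    case n: False
    then have "realize R G (edge x y) = (- path_chain (reversepath (G x y)) :: ('a, 'f) schain)"
      using orientsD[OF R False] g(6) False by (simp add: realize_def edge_def chains.lin_ext_diff)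
    then have *: "realize R G (edge x y) - path_chain (G x y) =
        (- (path_chain (G x y) + path_chain (reversepath (G x y))) :: ('a, 'f) schain)"
      by simp
    show ?thesis
      unfolding * by (intro chain_subspaceD(5)[OF subspace_singular_boundaries] reversepath_chain_boundary g(1,2))
  qed
qed

lemma singular_bd_realize_edge:
  assumes "x \<in> X" "y \<in> X"
  shows "realize R G (edge x y) \<in> (singular_chains 1 (top_of_set X) :: ('a, 'f::field) schain set)"
    "singular_bd 1 (realize R G (edge x y) :: ('a, 'f::field) schain) =
       single (point_simplex y) 1 - single (point_simplex x) 1"
proof -
  note g = geodesic_choiceD[OF G assms]
  let ?p = "path_chain (G x y) :: ('a, 'f) schain"
  have *: "realize R G (edge x y) - ?p \<in> singular_cycles 1 (top_of_set X)"
    using realize_edge[OF assms] singular_boundaries_1_subset_cycles by blast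
  have "?p \<in> singular_chains 1 (top_of_set X)" using singular_simplex_path_simplex[OF g(1,2)] by simp
  then have "(realize R G (edge x y) - ?p) + ?p \<in> singular_chains 1 (top_of_set X)"
    using * by (intro chain_subspaceD(2)[OF subspace_singular_chains]) (auto simp: singular_cycles_def)
  then show "realize R G (edge x y) \<in> (singular_chains 1 (top_of_set X) :: ('a, 'f) schain set)" by simp
  have "singular_bd 1 (realize R G (edge x y)) = singular_bd 1 ?p"
    using * by (simp add: singular_cycles_def singular_bd_diff)
  then show "singular_bd 1 (realize R G (edge x y) :: ('a, 'f) schain) =
       single (point_simplex y) 1 - single (point_simplex x) 1"
    by (simp only: singular_bd_path_chain g(3,4))
qed

lemma singular_bd_realize:
  assumes "c \<in> oriented_chains 1 (Rips X r)"
  shows "realize R G c \<in> singular_chains 1 (top_of_set X) \<and>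
    singular_bd 1 (realize R G c) = chain_points (oriented_bd 1 c)"
  using assms
proof (induction c rule: oriented_chains_1_induct)
  case (edge x y)
  then have "x \<in> X" "y \<in> X" by (auto simp: edge_in_Rips)
  then show ?case
    unfolding oriented_bd_edge
    by (simp add: singular_bd_realize_edge[simplified] chain_points_def chains.lin_ext_diff)
next
  case (add c d)
  then show ?case
    using chain_subspaceD(2)[OF subspace_singular_chains]
    by (auto simp: realize_add singular_bd_add oriented_bd_add chain_points_def chains.lin_ext_add)
next
  case (scale k c)
  then show ?case
    using chain_subspaceD(4)[OF subspace_singular_chains]
    by (auto simp: realize_scale singular_bd_scale oriented_bd_scale chain_points_def chains.lin_ext_scale)
next
  case zero
  then show ?case
    using chain_subspaceD(1)[OF subspace_singular_chains] by (auto simp: chain_points_def)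
qed

lemma realize_cycle:
  "c \<in> oriented_cycles 1 (Rips X r) \<Longrightarrow> realize R G c \<in> singular_cycles 1 (top_of_set X)"
  using singular_bd_realize[of c r] by (auto simp: oriented_cycles_def singular_cycles_def chain_points_def)

lemma realize_triangle:
  assumes "{x, y, z} \<in> Rips X r"
  shows "realize R G (edge x y + edge y z + edge z x) \<in> short_cycles X r"
proof -
  have xyz: "x \<in> X" "y \<in> X" "z \<in> X" and d: "dist x y < r" "dist y z < r" "dist z x < r"
    using assms by (auto simp: triangle_in_Rips dist_commute)
  note g1 = geodesic_choiceD[OF G xyz(1,2)] and g2 = geodesic_choiceD[OF G xyz(2,3)]
    and g3 = geodesic_choiceD[OF G xyz(3,1)]
  let ?g = "G x y" and ?h = "G y z" and ?k = "G z x"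
  have gh: "path (?g +++ ?h)" "path_image (?g +++ ?h) \<subseteq> X"
    using g1 g2 path_image_join_subset[of ?g ?h] by auto
  have loop: "loop_in X ((?g +++ ?h) +++ ?k)"
    using g1 g3 g2 gh path_image_join_subset[of "?g +++ ?h" ?k] by (auto simp: loop_in_def)
  have "path_length ((?g +++ ?h) +++ ?k) \<le> (path_length ?g + path_length ?h) + path_length ?k"
    using g1 g2 g3
    by (intro order.trans[OF path_length_joinpaths] add_mono path_length_joinpaths) auto
  also have "\<dots> \<le> ennreal (dist x y) + ennreal (dist y z) + ennreal (dist z x)"
    using g1 g2 g3 by (intro add_mono)
  also have "\<dots> = ennreal (dist x y + dist y z + dist z x)" by simp
  also have "\<dots> < ennreal (3 * r)" using d by (subst ennreal_less_iff) auto
  finally have short: "path_chain ((?g +++ ?h) +++ ?k) \<in> short_cycles X r"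
    using loop by (intro short_loop_in_short_cycles)
  note S = chain_subspaceD[OF subspace_short_cycles[of X r]] and B = subsetD[OF boundaries_subset_short_cycles[of X r]]
  \<comment> \<open>The correction terms are boundaries: one for each edge and one for each of the
    two concatenations.\<close>
  have "realize R G (edge x y + edge y z + edge z x) =
      (realize R G (edge x y) - path_chain ?g) + (realize R G (edge y z) - path_chain ?h) +
      (realize R G (edge z x) - path_chain ?k) +
      (path_chain ?g + path_chain ?h - path_chain (?g +++ ?h)) +
      (path_chain (?g +++ ?h) + path_chain ?k - path_chain ((?g +++ ?h) +++ ?k)) +
      path_chain ((?g +++ ?h) +++ ?k)"
    by (simp add: realize_add)
  also have "\<dots> \<in> short_cycles X r"
    by (intro S(2) B realize_edge joinpaths_chain_boundary xyz short gh g1(1,2) g2(1,2) g3(1,2))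
      (simp_all add: g1(3,4) g2(3,4) g3(3,4))
  finally show ?thesis .
qed

lemma realize_boundary:
  assumes "c \<in> oriented_boundaries 1 (Rips X r)"
  shows "realize R G c \<in> short_cycles X r"
proof -
  note S = chain_subspaceD[OF subspace_short_cycles[of X r]]
  have "chains.span {edge x y + edge y z + edge z x |x y z. {x, y, z} \<in> Rips X r} \<subseteq> {c. realize R G c \<in> short_cycles X r}"
  proof (rule chains.span_minimal)
    show "{edge x y + edge y z + edge z x |x y z. {x, y, z} \<in> Rips X r} \<subseteq> {c. realize R G c \<in> short_cycles X r}"
      using realize_triangle by blast
    show "chains.subspace {c. realize R G c \<in> short_cycles X r}"
      using S by (intro chains.subspaceI) (simp_all add: realize_add realize_scale)
  qed
  then show ?thesis using assms oriented_boundaries_1_subset_span by blast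
qed

lemma boundary_if_realize_short:
  fixes c :: "'a list \<Rightarrow>\<^sub>0 'f::field"
  assumes r: "r > 0" and c: "c \<in> oriented_chains 1 (Rips X r)" and short: "realize R G c \<in> short_cycles X r"
  shows "c \<in> oriented_boundaries 1 (Rips X r)"
proof (rule ccontr)
  assume "c \<notin> oriented_boundaries 1 (Rips X r)"
  then obtain f :: "'a list \<Rightarrow> 'f" where f: "\<And>b. b \<in> oriented_boundaries 1 (Rips X r) \<Longrightarrow> lin_ext (*) f b = 0"
    and fc: "lin_ext (*) f c = 1"
    using chain_functional_exists[OF subspace_oriented_boundaries] by metis
  \<comment> \<open>The functional evaluated on edges; its vanishing on the boundaries of triangles
    is the cocycle relation.\<close>
  define \<phi> where "\<phi> x y = lin_ext (*) f (edge x y)" for x y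
  note lin = vector_space_over_itself.lin_ext_add vector_space_over_itself.lin_ext_diff
    vector_space_over_itself.lin_ext_scale
  have \<phi>: "local_cocycle X r \<phi>"
    unfolding local_cocycle_def
  proof (intro ballI impI)
    fix x y z assume "x \<in> X" "y \<in> X" "z \<in> X" "dist x y < r" "dist y z < r" "dist x z < r"
    then have "edge x y + edge y z + edge z x \<in> (oriented_boundaries 1 (Rips X r) :: ('a list \<Rightarrow>\<^sub>0 'f) set)"
      using r by (intro triangle_in_oriented_boundaries) (auto simp: triangle_in_Rips)
    moreover have "edge x y + edge y z + edge z x = edge x y + edge y z - (edge x z :: 'a list \<Rightarrow>\<^sub>0 'f)"
      by (simp add: edge_swap[of z x])
    ultimately have "lin_ext (*) f (edge x y + edge y z - edge x z) = 0" using f by metis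
    then show "\<phi> x y + \<phi> y z = \<phi> x z" by (simp add: \<phi>_def lin)
  qed
  have int_edge: "chain_integral \<phi> (realize R G (edge x y)) = \<phi> x y" if xy: "x \<in> X" "y \<in> X" "dist x y < r" for x y
  proof -
    note g = geodesic_choiceD[OF G xy(1,2)]
    have "chain_integral \<phi> (realize R G (edge x y) - path_chain (G x y)) = 0"
      by (rule chain_integral_boundary[OF \<phi> r realize_edge[OF xy(1,2)]])
    then have "chain_integral \<phi> (realize R G (edge x y)) = chain_integral \<phi> (path_chain (G x y))"
      by (simp add: chain_integral_def lin)
    also have "\<dots> = path_integral \<phi> (G x y)" by (rule chain_integral_path_chain)
    \<comment> \<open>Any two points of the geodesic are at distance at most
      \<open>dist x y\<close>, which is below \<open>r\<close>, so the whole integral is one value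
      of \<phi>.\<close>
    also have "\<dots> = \<phi> (pathstart (G x y)) (pathfinish (G x y))"
      by (rule path_integral_small_path[OF \<phi> r g(2)])
        (rule le_less_trans[OF geodesic_choice_small[OF G xy(1,2)] xy(3)])
    finally show ?thesis by (simp only: g(3,4))
  qed
  have "chain_integral \<phi> (realize R G c) = lin_ext (*) f c"
    using c
  proof (induction c rule: oriented_chains_1_induct)
    case (edge x y)
    then have "x \<in> X" "y \<in> X" "dist x y < r" by (auto simp: edge_in_Rips)
    then show ?case by (rule trans[OF int_edge \<phi>_def])
  qed (simp_all add: chain_integral_def realize_add realize_scale lin)
  \<comment> \<open>Integration along the realization recovers \<open>f c = 1\<close>, yet it
    vanishes on the generators of \<open>short_cycles\<close>.\<close>
  moreover have "short_cycles X r \<subseteq> {c. chain_integral \<phi> c = 0}"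
    unfolding short_cycles_def
  proof (rule chains.span_minimal)
    show "chains.subspace {c. chain_integral \<phi> c = 0}"
      by (intro chains.subspaceI) (simp_all add: chain_integral_def lin)
    show "singular_boundaries 1 (top_of_set X) \<union>
       path_chain ` {g. loop_in X g \<and> path_length g < ennreal (3 * r)} \<subseteq> {c. chain_integral \<phi> c = 0}"
      using chain_integral_boundary[OF \<phi> r] path_integral_short_loop[OF \<phi> r]
      by (auto simp: chain_integral_path_chain)
  qed
  ultimately show False using short fc by auto
qed

end


section \<open>Approximation of singular cycles by geodesic polygons\<close>

text \<open>\<rho> is a Lebesgue number of the cover of \<open>X\<close> by the open sets whose
  traces on \<open>X\<close> carry only cycles that bound in \<open>X\<close>.\<close>

lemma uniformly_semi_locally_simply_connected:
  fixes X :: "'a::metric_space set"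
  assumes "compact X" "semi_locally_simply_connected TYPE('f::field) X"
  obtains \<rho> where "\<rho> > 0"
    "\<And>x. x \<in> X \<Longrightarrow> (singular_cycles 1 (top_of_set (X \<inter> ball x \<rho>)) :: ('a, 'f) schain set)
      \<subseteq> singular_boundaries 1 (top_of_set X)"
proof -
  define \<G> where "\<G> = {W. open W \<and> (singular_cycles 1 (top_of_set (X \<inter> W)) :: ('a, 'f) schain set)
      \<subseteq> singular_boundaries 1 (top_of_set X)}"
  have cover: "X \<subseteq> \<Union>\<G>"
  proof
    fix x assume "x \<in> X"
    then obtain V where V: "openin (top_of_set X) V" "x \<in> V"
      "(singular_cycles 1 (top_of_set V) :: ('a, 'f) schain set) \<subseteq> singular_boundaries 1 (top_of_set X)"
      using semi_locally_simply_connectedD[OF assms(2)] by metis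
    then obtain T where "open T" "V = X \<inter> T" by (auto simp: openin_open)
    with V show "x \<in> \<Union>\<G>" by (auto simp: \<G>_def)
  qed
  have "\<And>W. W \<in> \<G> \<Longrightarrow> open W" by (simp add: \<G>_def)
  then obtain \<rho> where \<rho>: "\<rho> > 0" "\<And>x. x \<in> X \<Longrightarrow> \<exists>W\<in>\<G>. ball x \<rho> \<subseteq> W"
    using Heine_Borel_lemma[OF assms(1) cover] by metis
  show thesis
  proof (rule that[OF \<rho>(1)])
    fix x assume "x \<in> X"
    then obtain T where T: "T \<in> \<G>" "ball x \<rho> \<subseteq> T" using \<rho>(2) by blast
    then have "X \<inter> ball x \<rho> \<subseteq> X \<inter> T" by blast
    then show "(singular_cycles 1 (top_of_set (X \<inter> ball x \<rho>)) :: ('a, 'f) schain set)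
      \<subseteq> singular_boundaries 1 (top_of_set X)"
      using singular_cycles_mono T(1) unfolding \<G>_def by blast
  qed
qed

lemma path_segment_argument:
  assumes "u \<in> {0..1}" "v \<in> {0..1}" "s \<in> {0..1}"
  shows "(v - u) * s + u \<in> {0..1::real}"
proof -
  have "(v - u) * s + u = (1 - s) *\<^sub>R u + s *\<^sub>R v" by (simp add: algebra_simps)
  then show ?thesis using convexD[of "{0..1::real}" u v "1 - s" s] assms by simp
qed

lemma path_path_segment:
  assumes "path g" "u \<in> {0..1}" "v \<in> {0..1}"
  shows "path (path_segment u v g)"
proof -
  have "(\<lambda>s. (v - u) * s + u) ` {0..1} \<subseteq> {0..1}" using path_segment_argument[OF assms(2,3)] by blast
  moreover have "continuous_on {0..1} (\<lambda>s. (v - u) * s + u)" by (intro continuous_intros)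
  ultimately show ?thesis
    using continuous_on_compose2[OF assms(1)[unfolded path_def]] unfolding path_def path_segment_def by blast
qed

lemma path_segment_ends [simp]:
  "pathstart (path_segment u v g) = g u" "pathfinish (path_segment u v g) = g v"
  by (simp_all add: pathstart_def pathfinish_def path_segment_def)

text \<open>The path is cut so finely that each piece stays in a ball of radius \<rho> and its chord
  is shorter than \<open>min \<rho> r\<close>. Piece and geodesic chord then differ by a cycle in
  that ball, which bounds in \<open>X\<close>, and the chords are Rips edges. The boundary of
  \<open>c\<close> is recorded so that the approximations of the simplices of a cycle fit
  together.\<close>

lemma (in geodesic_realization) path_approximation:
  fixes g :: "real \<Rightarrow> 'a"
  assumes "compact X" "semi_locally_simply_connected TYPE('f::field) X" "r > 0"
    and g: "path g" "path_image g \<subseteq> X"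
  shows "\<exists>c :: 'a list \<Rightarrow>\<^sub>0 'f. c \<in> oriented_chains 1 (Rips X r) \<and>
    path_chain g - realize R G c \<in> singular_boundaries 1 (top_of_set X) \<and>
    oriented_bd 1 c = single [pathfinish g] 1 - single [pathstart g] 1"
proof -
  let ?B = "singular_boundaries 1 (top_of_set X) :: ('a, 'f) schain set"
  note B = chain_subspaceD[OF subspace_singular_boundaries[of 1 "top_of_set X"]]
  obtain \<rho> where \<rho>: "\<rho> > 0" "\<And>x. x \<in> X \<Longrightarrow> singular_cycles 1 (top_of_set (X \<inter> ball x \<rho>)) \<subseteq> ?B"
    using uniformly_semi_locally_simply_connected[OF assms(1,2)] by metis
  \<comment> \<open>The geodesic from the centre \<open>x\<close> to \<open>y\<close> is no longer
    than \<open>dist x y\<close>, so it does not leave the ball.\<close>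
  have small: "path_chain p - path_chain (G x y) \<in> ?B"
    if p: "path p" "path_image p \<subseteq> X \<inter> ball x \<rho>" "pathstart p = x" "pathfinish p = y" for p x y
  proof -
    have xy: "x \<in> X" "y \<in> X" "dist x y < \<rho>"
      using p pathstart_in_path_image[of p] pathfinish_in_path_image[of p] by auto
    note h = geodesic_choiceD[OF G xy(1,2)]
    have "G x y t \<in> ball x \<rho>" if "t \<in> {0..1}" for t
      using geodesic_choice_small[OF G xy(1,2), of 0 t] that h(3) xy(3) by (simp add: pathstart_def)
    then have h': "path_image (G x y) \<subseteq> X \<inter> ball x \<rho>" using h(2) by (auto simp: path_image_def)
    have "path_chain p - path_chain (G x y) \<in> singular_cycles 1 (top_of_set (X \<inter> ball x \<rho>))"
      unfolding singular_cycles_def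
    proof (intro CollectI conjI)
      show "path_chain p - path_chain (G x y) \<in> singular_chains 1 (top_of_set (X \<inter> ball x \<rho>))"
        using singular_simplex_path_simplex[OF p(1,2)] singular_simplex_path_simplex[OF h(1) h']
        by (intro chain_subspaceD(3)[OF subspace_singular_chains]) auto
      show "singular_bd 1 (path_chain p - path_chain (G x y)) = 0"
        by (simp only: singular_bd_diff singular_bd_path_chain p(3,4) h(3,4)) simp
    qed
    then show ?thesis using \<rho>(2)[OF xy(1)] by blast
  qed
  have "uniformly_continuous_on {0..1} g"
    using g(1) unfolding path_def by (rule compact_uniformly_continuous) simp
  moreover have "min \<rho> r > 0" using \<rho> assms(3) by simp
  ultimately obtain \<delta> where \<delta>: "\<delta> > 0"
    "\<And>s t. s \<in> {0..1} \<Longrightarrow> t \<in> {0..1} \<Longrightarrow> dist s t < \<delta> \<Longrightarrow> dist (g s) (g t) < min \<rho> r"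
    unfolding uniformly_continuous_on_def by (metis dist_commute)
  obtain N :: nat where N: "N > 0" "1 / real N < \<delta>"
    using eventually_happens'[OF _ eventually_mesh_less[OF \<delta>(1)]] by auto
  define t where "t i = real i / real N" for i
  have t01: "t i \<in> {0..1}" if "i \<le> N" for i using that N by (auto simp: t_def)
  have t_step: "t (Suc i) = t i + 1 / real N" for i by (simp add: t_def add_divide_distrib)
  have gX: "g s \<in> X" if "s \<in> {0..1}" for s using g(2) that by (auto simp: path_image_def)
  define c where "c n = (\<Sum>i<n. edge (g (t i)) (g (t (Suc i))) :: 'a list \<Rightarrow>\<^sub>0 'f)" for n
  have seg: "path_segment (t i) (t (Suc i)) g s \<in> X \<inter> ball (g (t i)) \<rho>" if i: "i < N" and s: "s \<in> {0..1}" for i s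
  proof -
    let ?s = "(t (Suc i) - t i) * s + t i"
    have s01: "?s \<in> {0..1}" using i s by (intro path_segment_argument t01) auto
    have "dist (t i) ?s = s / real N" using s by (simp add: dist_real_def t_step)
    also have "\<dots> \<le> 1 / real N" using s by (intro divide_right_mono) auto
    finally have "dist (t i) ?s < \<delta>" using N by linarith
    then have "dist (g (t i)) (g ?s) < \<rho>" using \<delta>(2)[OF t01[of i] s01] i by simp
    then show ?thesis using gX[OF s01] by (simp add: path_segment_def)
  qed
  have step: "path_chain (path_segment (t i) (t (Suc i)) g) - realize R G (edge (g (t i)) (g (t (Suc i)))) \<in> ?B"
    if i: "i < N" for i
  proof -
    let ?p = "path_segment (t i) (t (Suc i)) g" and ?x = "g (t i)" and ?y = "g (t (Suc i))"
    have "path_image ?p \<subseteq> X \<inter> ball ?x \<rho>" using seg[OF i] by (auto simp: path_image_def)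
    moreover have "path ?p" using i by (intro path_path_segment g t01) auto
    ultimately have "path_chain ?p - path_chain (G ?x ?y) \<in> ?B" by (intro small) simp_all
    moreover have "realize R G (edge ?x ?y) - path_chain (G ?x ?y) \<in> ?B"
      using i by (intro realize_edge gX t01) auto
    ultimately have "(path_chain ?p - path_chain (G ?x ?y)) - (realize R G (edge ?x ?y) - path_chain (G ?x ?y)) \<in> ?B"
      by (rule B(3))
    then show ?thesis by simp
  qed
  have "path_chain (path_segment 0 (t n) g) - realize R G (c n) \<in> ?B \<and> c n \<in> oriented_chains 1 (Rips X r) \<and>
      oriented_bd 1 (c n) = single [g (t n)] 1 - single [g 0] 1" if "n \<le> N" for n
    using that
  proof (induction n)
    case 0
    have "path_segment 0 (t 0) g = (\<lambda>_. g 0)" by (simp add: path_segment_def t_def)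
    moreover have "path_chain (\<lambda>_. g 0) \<in> ?B" by (intro const_path_chain_boundary gX) simp
    moreover have "0 \<in> (oriented_chains 1 (Rips X r) :: ('a list \<Rightarrow>\<^sub>0 'f) set)"
      by (intro chain_subspaceD(1) subspace_oriented_chains)
    ultimately show ?case by (simp add: c_def t_def)
  next
    case (Suc n)
    let ?q = "\<lambda>u v. path_chain (path_segment u v g) :: ('a, 'f) schain"
    have IH: "?q 0 (t n) - realize R G (c n) \<in> ?B" "c n \<in> oriented_chains 1 (Rips X r)"
      "oriented_bd 1 (c n) = single [g (t n)] 1 - single [g 0] 1"
      using Suc by auto
    have c: "c (Suc n) = c n + edge (g (t n)) (g (t (Suc n)))" by (simp add: c_def)
    have tri: "?q 0 (t n) + ?q (t n) (t (Suc n)) - ?q 0 (t (Suc n)) \<in> ?B"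
      using t01 Suc.prems by (intro path_segment_triangle g) auto
    have "?q (t n) (t (Suc n)) - realize R G (edge (g (t n)) (g (t (Suc n)))) \<in> ?B"
      using Suc.prems by (intro step) simp
    from B(3)[OF B(2)[OF IH(1) this] tri]
    have 1: "?q 0 (t (Suc n)) - realize R G (c (Suc n)) \<in> ?B"
      by (simp add: c realize_add algebra_simps)
    have "dist (g (t n)) (g (t (Suc n))) < r"
      using \<delta>(2)[of "t n" "t (Suc n)"] t01[of n] t01[of "Suc n"] Suc.prems N t_step[of n]
      by (simp add: dist_real_def)
    then have "{g (t n), g (t (Suc n))} \<in> Rips X r"
      using Suc.prems assms(3) gX t01 by (simp add: edge_in_Rips)
    then have 2: "c (Suc n) \<in> oriented_chains 1 (Rips X r)"
      unfolding c using IH(2) by (intro chain_subspaceD(2)[OF subspace_oriented_chains] edge_in_oriented_chains)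
    have 3: "oriented_bd 1 (c (Suc n)) = single [g (t (Suc n))] 1 - single [g 0] 1"
      unfolding c oriented_bd_add oriented_bd_edge IH(3) by simp
    show ?case using 1 2 3 by blast
  qed
  from this[of N] have "path_chain g - realize R G (c N) \<in> ?B" "c N \<in> oriented_chains 1 (Rips X r)"
      "oriented_bd 1 (c N) = single [pathfinish g] 1 - single [pathstart g] 1"
    using N by (auto simp: t_def pathstart_def pathfinish_def)
  then show ?thesis by blast
qed

text \<open>Each simplex of \<open>z\<close> is approximated separately. The boundary of the
  approximating chain is a linear function of the boundary of the approximated one, so it vanishes
  for a cycle.\<close>

lemma (in geodesic_realization) cycle_approximation:
  fixes z :: "('a, 'f::field) schain"
  assumes X: "compact X" "semi_locally_simply_connected TYPE('f) X" "r > 0"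
    and z: "z \<in> singular_cycles 1 (top_of_set X)"
  shows "\<exists>c\<in>oriented_cycles 1 (Rips X r). z - realize R G c \<in> singular_boundaries 1 (top_of_set X)"
proof -
  let ?B = "singular_boundaries 1 (top_of_set X) :: ('a, 'f) schain set"
  note B = chain_subspaceD[OF subspace_singular_boundaries[of 1 "top_of_set X"]]
  note C = chain_subspaceD[OF subspace_oriented_chains[of 1 "Rips X r"]]
  \<comment> \<open>\<open>Q\<close> reads off the point of a singular 0-simplex and turns it into a
    vertex of the Rips complex.\<close>
  define Q where "Q s = lin_ext chain_scale (\<lambda>f. single [f (vertex 0)] 1) s"
    for s :: "('a, 'f) schain"
  have Q_lin: "Q (s + s') = Q s + Q s'" "Q (s - s') = Q s - Q s'" "Q (chain_scale k s) = chain_scale k (Q s)" "Q 0 = 0" for s s' k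
    by (simp_all add: Q_def chains.lin_ext_add chains.lin_ext_diff chains.lin_ext_scale)
  have "point_simplex x (vertex 0) = x" for x :: 'a
    using basis_in_standard_simplex[of 0 0] by (simp add: point_simplex_def del: basis_in_standard_simplex)
  then have Q_pt: "Q (single (point_simplex x) 1) = single [x] 1" for x
    by (simp add: Q_def)
  define A where "A = {s. \<exists>c\<in>oriented_chains 1 (Rips X r). s - realize R G c \<in> ?B \<and> oriented_bd 1 c = Q (singular_bd 1 s)}"
  have A: "chains.subspace A"
  proof (rule chains.subspaceI)
    show "0 \<in> A" unfolding A_def using C(1) B(1) by (auto intro!: bexI[of _ 0] simp: Q_lin)
    fix x y assume "x \<in> A" "y \<in> A"
    then obtain c d where c: "c \<in> oriented_chains 1 (Rips X r)" "x - realize R G c \<in> ?B" "oriented_bd 1 c = Q (singular_bd 1 x)"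
      and d: "d \<in> oriented_chains 1 (Rips X r)" "y - realize R G d \<in> ?B" "oriented_bd 1 d = Q (singular_bd 1 y)"
      unfolding A_def by blast
    have "(x - realize R G c) + (y - realize R G d) \<in> ?B" using c d by (intro B(2))
    then have "(x + y) - realize R G (c + d) \<in> ?B" by (simp add: realize_add algebra_simps)
    then show "x + y \<in> A"
      unfolding A_def using c d C(2) by (auto intro!: bexI[of _ "c + d"] simp: oriented_bd_add singular_bd_add Q_lin)
  next
    fix k x assume "x \<in> A"
    then obtain c where c: "c \<in> oriented_chains 1 (Rips X r)" "x - realize R G c \<in> ?B" "oriented_bd 1 c = Q (singular_bd 1 x)"
      unfolding A_def by blast
    have "chain_scale k (x - realize R G c) \<in> ?B" using c by (intro B(4))
    then have "chain_scale k x - realize R G (chain_scale k c) \<in> ?B"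
      by (simp add: realize_scale chains.scale_right_diff_distrib)
    then show "chain_scale k x \<in> A"
      unfolding A_def using c C(4) by (auto intro!: bexI[of _ "chain_scale k c"] simp: oriented_bd_scale singular_bd_scale Q_lin)
  qed
  have "single f 1 \<in> A" if f: "singular_simplex 1 (top_of_set X) f" for f
  proof -
    obtain g where g: "path g" "path_image g \<subseteq> X" "f = path_simplex g"
      using singular_1_simplex_is_path[OF f] by metis
    have "Q (singular_bd 1 (path_chain g)) =
        single [pathfinish g] 1 - single [pathstart g] 1"
      unfolding singular_bd_path_chain Q_lin Q_pt ..
    then show ?thesis
      using path_approximation[OF X g(1,2)] unfolding A_def g(3) by (simp add: Bex_def)
  qed
  then have "chain_scale a (single f 1) \<in> A" if "singular_simplex 1 (top_of_set X) f" for f a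
    using chain_subspaceD(4)[OF A] that by blast
  then have single: "single f a \<in> A" if "singular_simplex 1 (top_of_set X) f" for f a
    using that by simp
  have zc: "z \<in> singular_chains 1 (top_of_set X)" and bz: "singular_bd 1 z = 0"
    using z by (auto simp: singular_cycles_def)
  have "(\<Sum>k\<in>keys z. single k (lookup z k)) \<in> A"
    by (intro chains.subspace_sum A single singular_chains_sum_single[OF zc])
  then have "z \<in> A" by (simp only: chain_eq_sum_single[symmetric])
  then show ?thesis unfolding A_def by (auto simp: bz[simplified] Q_lin oriented_cycles_def)
qed


section \<open>The homology of Rips complexes of geodesic spaces\<close>

abbreviation homology_class :: "'a::metric_space set \<Rightarrow> ('a, 'f::field) schain \<Rightarrow> ('a, 'f) schain set" where
  "homology_class X z \<equiv> singular_boundaries 1 (top_of_set X) +>\<^bsub>chain_module\<^esub> z"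

text \<open>The inverse of realization: \<open>\<rho> r z\<close> is the class of any Rips cycle
  whose realization equals \<open>z\<close> modulo \<open>short_cycles X r\<close>. It is compatible
  with the bonding maps because the approximating cycle can be found up to boundaries at the smaller
  scale, and then serves at both.\<close>

lemma presents_Rips_homology_short_cycles:
  fixes X :: "'a::metric_space set"
  assumes X: "compact X" "geodesic_space X" "semi_locally_simply_connected TYPE('f::field) X"
  obtains \<rho> :: "real \<Rightarrow> ('a, 'f::field) schain \<Rightarrow> ('a list \<Rightarrow>\<^sub>0 'f) set"
  where
    "\<And>r. r > 0 \<Longrightarrow> presents (singular_cycles 1 (top_of_set X)) (short_cycles X r)
       (complex_homology 1 (Rips X r)) (\<rho> r)"
    "\<And>r s z. 0 < r \<Longrightarrow> r \<le> s \<Longrightarrow> z \<in> singular_cycles 1 (top_of_set X) \<Longrightarrow>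
       coset_map chain_module (oriented_boundaries 1 (Rips X s)) (\<rho> r z) = \<rho> s z"
proof -
  obtain G where G: "geodesic_choice X G" using geodesic_choice_exists[OF X(2)] by metis
  obtain R :: "('a \<times> 'a) set" where R: "orients R" using orientation_exists ..
  interpret geodesic_realization X R G by unfold_locales (rule R, rule G)
  let ?T = "realize R G :: ('a list \<Rightarrow>\<^sub>0 'f) \<Rightarrow> ('a, 'f) schain"
  let ?Z = "singular_cycles 1 (top_of_set X) :: ('a, 'f) schain set"
  let ?C = "\<lambda>r. oriented_cycles 1 (Rips X r) :: ('a list \<Rightarrow>\<^sub>0 'f) set"
  let ?K = "\<lambda>r. short_cycles X r :: ('a, 'f) schain set"
  let ?q = "\<lambda>r z. oriented_boundaries 1 (Rips X r) +>\<^bsub>chain_module\<^esub> (z :: 'a list \<Rightarrow>\<^sub>0 'f)"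
  have "\<exists>q'. presents ?Z (?K r) (complex_homology 1 (Rips X r)) q' \<and>
      (\<forall>z\<in>?Z. \<forall>c\<in>?C r. z - ?T c \<in> ?K r \<longrightarrow> q' z = ?q r c)" if r: "r > 0" for r
  proof (rule presents_transfer[OF presents_Rips_homology, where T = ?T])
    show "?T x \<in> ?K r \<longleftrightarrow> x \<in> oriented_boundaries 1 (Rips X r)" if "x \<in> ?C r" for x
      using that realize_boundary boundary_if_realize_short[OF r] by (auto simp: oriented_cycles_def)
    show "\<exists>x\<in>?C r. z - ?T x \<in> ?K r" if "z \<in> ?Z" for z
      using cycle_approximation[OF X(1,3) r that] boundaries_subset_short_cycles by blast
  qed (simp_all only: realize_add realize_scale realize_cycle subspace_singular_cycles subspace_short_cycles)
  then obtain \<rho> where \<rho>: "\<And>r. r > 0 \<Longrightarrow> presents ?Z (?K r) (complex_homology 1 (Rips X r)) (\<rho> r)"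
    "\<And>r z c. r > 0 \<Longrightarrow> z \<in> ?Z \<Longrightarrow> c \<in> ?C r \<Longrightarrow> z - ?T c \<in> ?K r \<Longrightarrow> \<rho> r z = ?q r c"
    by metis
  show thesis
  proof (rule that[OF \<rho>(1)])
    fix r s :: real and z assume rs: "0 < r" "r \<le> s" and z: "z \<in> ?Z"
    obtain c where c: "c \<in> ?C r" "z - ?T c \<in> singular_boundaries 1 (top_of_set X)"
      using cycle_approximation[OF X(1,3) rs(1) z] by blast
    then have K: "z - ?T c \<in> ?K r" "z - ?T c \<in> ?K s" using boundaries_subset_short_cycles by blast+
    have cs: "c \<in> ?C s" using c(1) oriented_cycles_mono[OF Rips_mono[OF rs(2)]] by blast
    have "coset_map chain_module (oriented_boundaries 1 (Rips X s)) (?q r c) = ?q s c"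
      by (intro coset_map_chains subspace_oriented_boundaries oriented_boundaries_mono Rips_mono rs(2))
    then show "coset_map chain_module (oriented_boundaries 1 (Rips X s)) (\<rho> r z) = \<rho> s z"
      using \<rho>(2)[OF _ z c(1) K(1)] \<rho>(2)[OF _ z cs K(2)] rs by simp
  qed
qed


section \<open>Persistences presented by a vector space\<close>

text \<open>The levels are the quotients \<open>Z / K r\<close> and the bonding maps are the
  identity on representatives, so all information is in the growing family \<open>K\<close>.\<close>

definition presents_persistence ::
  "('k \<Rightarrow>\<^sub>0 'f::field) set \<Rightarrow> (real \<Rightarrow> ('k \<Rightarrow>\<^sub>0 'f) set) \<Rightarrow> ('f, 'v) persistence \<Rightarrow>
     (real \<Rightarrow> ('k \<Rightarrow>\<^sub>0 'f) \<Rightarrow> 'v) \<Rightarrow> bool" where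
  "presents_persistence Z K P q \<longleftrightarrow>
     (\<forall>r>0. presents Z (K r) (level P r) (q r)) \<and>
     (\<forall>r>0. \<forall>s\<ge>r. \<forall>z\<in>Z. bond P r s (q r z) = q s z)"

lemma presents_persistenceD:
  assumes "presents_persistence Z K P q" "0 < r"
  shows "presents Z (K r) (level P r) (q r)" "r \<le> s \<Longrightarrow> z \<in> Z \<Longrightarrow> bond P r s (q r z) = q s z"
  using assms unfolding presents_persistence_def by blast+

lemma presents_persistence_kernel_cong:
  assumes "presents_persistence Z K P q" "\<And>r. r > 0 \<Longrightarrow> K r = K' r"
  shows "presents_persistence Z K' P q"
  using assms unfolding presents_persistence_def by metis

lemma isomorphic_persistences_presented:
  assumes P: "presents_persistence Z K P q" and Q: "presents_persistence Z K Q q'"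
  shows "isomorphic_persistences P Q"
proof -
  have "\<exists>h. linear_iso (level P r) (level Q r) h \<and> (\<forall>z\<in>Z. h (q r z) = q' r z)" if "r > 0" for r
    using linear_iso_presented presents_persistenceD(1)[OF P that] presents_persistenceD(1)[OF Q that] by blast
  then obtain h where h: "\<And>r. r > 0 \<Longrightarrow> linear_iso (level P r) (level Q r) (h r)"
    "\<And>r z. r > 0 \<Longrightarrow> z \<in> Z \<Longrightarrow> h r (q r z) = q' r z"
    by metis
  show ?thesis
    unfolding isomorphic_persistences_def
  proof (intro exI[of _ h] conjI allI impI ballI h(1))
    fix r s :: real and x assume rs: "0 < r" "r \<le> s" and "x \<in> carrier (level P r)"
    then obtain z where z: "z \<in> Z" "x = q r z" using presentsD(3)[OF presents_persistenceD(1)[OF P rs(1)]] by blast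
    have "0 < s" using rs by simp
    then show "h s (bond P r s x) = bond Q r s (h r x)"
      using z h(2) rs presents_persistenceD(2)[OF P rs] presents_persistenceD(2)[OF Q rs] by simp
  qed
qed

lemma bond_iso_presented:
  assumes P: "presents_persistence Z K P q" and rs: "0 < r" "r \<le> s" and K: "K r \<subseteq> K s" "K s \<subseteq> Z"
  shows "bond_iso P r s \<longleftrightarrow> K r = K s"
proof -
  have "0 < s" using rs by simp
  then show ?thesis
    unfolding bond_iso_def
    using linear_iso_between_presented[OF presents_persistenceD(1)[OF P rs(1)] presents_persistenceD(1)[OF P]]
      presents_persistenceD(2)[OF P rs] K by simp
qed


section \<open>Coordinates on a finite-dimensional first homology\<close>

lemma subspace_supported: "chains.subspace {e :: 'k \<Rightarrow>\<^sub>0 'f::field. keys e \<subseteq> I}"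
proof (rule chains.subspaceI)
  fix x y :: "'k \<Rightarrow>\<^sub>0 'f"
  assume "x \<in> {e. keys e \<subseteq> I}" "y \<in> {e. keys e \<subseteq> I}"
  then show "x + y \<in> {e. keys e \<subseteq> I}" using keys_add[of x y] by blast
qed (auto simp: in_keys_iff)

lemma supported_eq_span:
  "{e :: 'k \<Rightarrow>\<^sub>0 'f::field. keys e \<subseteq> I} = chains.span ((\<lambda>i. single i 1) ` I)"
proof
  show "chains.span ((\<lambda>i. single i 1) ` I) \<subseteq> {e :: 'k \<Rightarrow>\<^sub>0 'f. keys e \<subseteq> I}"
    by (intro chains.span_minimal subspace_supported) auto
  have "e \<in> chains.span ((\<lambda>i. single i 1) ` I)" if "keys e \<subseteq> I" for e :: "'k \<Rightarrow>\<^sub>0 'f"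
  proof -
    have "(\<Sum>k\<in>keys e. chain_scale (lookup e k) (single k 1))
        \<in> chains.span ((\<lambda>i. single i 1) ` I)"
      using that by (intro chains.span_sum chains.span_scale chains.span_base) auto
    then show ?thesis by (simp flip: chain_eq_sum_single)
  qed
  then show "{e :: 'k \<Rightarrow>\<^sub>0 'f. keys e \<subseteq> I} \<subseteq> chains.span ((\<lambda>i. single i 1) ` I)"
    by blast
qed

lemma inj_single_1: "inj (\<lambda>i. single i (1 :: 'f::field))"
proof (rule injI)
  fix i j :: 'a assume "single i (1 :: 'f) = single j 1"
  then have "keys (single i (1 :: 'f)) = keys (single j (1 :: 'f))"
    by simp
  then show "i = j" by simp
qed

lemma independent_single:
  "chains.independent ((\<lambda>i. single i 1 :: 'k \<Rightarrow>\<^sub>0 'f::field) ` I)"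
proof
  have inj: "inj (\<lambda>i. single i 1 :: 'k \<Rightarrow>\<^sub>0 'f)" by (rule inj_single_1)
  assume "chains.dependent ((\<lambda>i. single i 1 :: 'k \<Rightarrow>\<^sub>0 'f::field) ` I)"
  then obtain i where i: "i \<in> I"
    "single i 1 \<in> chains.span ((\<lambda>i. single i 1 :: 'k \<Rightarrow>\<^sub>0 'f) ` I - {single i 1})"
    unfolding chains.dependent_def by blast
  have "(\<lambda>i. single i 1 :: 'k \<Rightarrow>\<^sub>0 'f) ` I - {single i 1} =
      (\<lambda>i. single i 1) ` (I - {i})"
    using inj_on_image_set_diff[OF inj, of I "{i}"] i(1) by simp
  with i(2) have "keys (single i (1 :: 'f)) \<subseteq> I - {i}"
    by (simp flip: supported_eq_span)
  then show False by simp
qed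

lemma card_le_if_spanning:
  assumes "finite T" "{e :: 'k \<Rightarrow>\<^sub>0 'f::field. keys e \<subseteq> I} \<subseteq> chains.span T"
  shows "card I \<le> card T"
proof -
  have "(\<lambda>i. single i 1 :: 'k \<Rightarrow>\<^sub>0 'f) ` I \<subseteq> chains.span T" using assms(2) by auto
  then have "card ((\<lambda>i. single i 1 :: 'k \<Rightarrow>\<^sub>0 'f) ` I) \<le> card T"
    using chains.independent_span_bound[OF assms(1) independent_single] by blast
  then show ?thesis by (simp add: card_image inj_on_subset[OF inj_single_1])
qed

text \<open>Otherwise fewer than \<open>card I\<close> vectors would span a space of dimension
  \<open>card I\<close>.\<close>

lemma not_in_span_others:
  fixes v :: "'k \<Rightarrow> ('k \<Rightarrow>\<^sub>0 'f::field)"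
  assumes I: "finite I" and v: "chains.span (v ` I) = {e. keys e \<subseteq> I}" and i: "i \<in> I"
  shows "v i \<notin> chains.span (v ` (I - {i}))"
proof
  assume "v i \<in> chains.span (v ` (I - {i}))"
  then have "v ` I \<subseteq> chains.span (v ` (I - {i}))"
    using chains.span_base[of _ "v ` (I - {i})"] by blast
  then have "chains.span (v ` I) \<subseteq> chains.span (v ` (I - {i}))"
    by (intro chains.span_minimal) auto
  then have "card I \<le> card (v ` (I - {i}))" using v I by (intro card_le_if_spanning) auto
  also have "\<dots> \<le> card (I - {i})" using I by (intro card_image_le) auto
  also have "\<dots> < card I" using I i by (intro psubset_card_mono) auto
  finally show False by simp
qed

lemma lin_ext_image_supported:
  fixes v :: "'k \<Rightarrow> ('m \<Rightarrow>\<^sub>0 'f::field)"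
  shows "lin_ext chain_scale v ` {e. keys e \<subseteq> I} = chains.span (v ` I)"
proof
  show "lin_ext chain_scale v ` {e. keys e \<subseteq> I} \<subseteq> chains.span (v ` I)"
  proof clarify
    fix e :: "'k \<Rightarrow>\<^sub>0 'f" assume "keys e \<subseteq> I"
    then show "lin_ext chain_scale v e \<in> chains.span (v ` I)"
      unfolding lin_ext_def by (intro chains.span_sum chains.span_scale chains.span_base) auto
  qed
  show "chains.span (v ` I) \<subseteq> lin_ext chain_scale v ` {e. keys e \<subseteq> I}"
  proof (rule chains.span_minimal)
    have "chains.subspace {e :: 'k \<Rightarrow>\<^sub>0 'f. keys e \<subseteq> I}" by (rule subspace_supported)
    note S = chain_subspaceD[OF this]
    show "v ` I \<subseteq> lin_ext chain_scale v ` {e. keys e \<subseteq> I}"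
      by (auto intro!: image_eqI[of _ _ "single _ 1"])
    show "chains.subspace (lin_ext chain_scale v ` {e. keys e \<subseteq> I})"
    proof (rule chains.subspaceI)
      show "0 \<in> lin_ext chain_scale v ` {e. keys e \<subseteq> I}"
        by (rule image_eqI[of _ _ 0]) auto
      fix x y assume "x \<in> lin_ext chain_scale v ` {e. keys e \<subseteq> I}"
        "y \<in> lin_ext chain_scale v ` {e. keys e \<subseteq> I}"
      then show "x + y \<in> lin_ext chain_scale v ` {e. keys e \<subseteq> I}"
        using S(2) by (auto simp flip: chains.lin_ext_add)
    next
      fix c x assume "x \<in> lin_ext chain_scale v ` {e. keys e \<subseteq> I}"
      then show "chain_scale c x \<in> lin_ext chain_scale v ` {e. keys e \<subseteq> I}"
        using S(4) by (auto simp flip: chains.lin_ext_scale)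
    qed
  qed
qed

lemma lin_ext_inj_on_supported:
  fixes v :: "'k \<Rightarrow> ('k \<Rightarrow>\<^sub>0 'f::field)"
  assumes I: "finite I" and v: "chains.span (v ` I) = {e. keys e \<subseteq> I}"
  shows "inj_on (lin_ext chain_scale v) {e. keys e \<subseteq> I}"
proof (rule inj_onI)
  let ?L = "lin_ext chain_scale v"
  note S = chain_subspaceD[OF subspace_supported[of I]]
  fix x y :: "'k \<Rightarrow>\<^sub>0 'f"
  assume xy: "x \<in> {e. keys e \<subseteq> I}" "y \<in> {e. keys e \<subseteq> I}" "?L x = ?L y"
  show "x = y"
  proof (rule ccontr)
    assume "x \<noteq> y"
    define e where "e = x - y"
    have e: "keys e \<subseteq> I" "?L e = 0"
      using S(3)[OF xy(1,2)] xy(3) by (auto simp: e_def chains.lin_ext_diff)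
    from \<open>x \<noteq> y\<close> obtain i where i: "lookup e i \<noteq> 0"
      unfolding e_def by (metis poly_mapping_eqI lookup_zero right_minus_eq)
    then have iI: "i \<in> I" using e(1) by (auto simp: in_keys_iff)
    \<comment> \<open>\<open>e\<close> is scaled to have coordinate 1 at \<open>i\<close>;
      subtracting it removes \<open>i\<close> from the support without changing the image
      \<open>v i\<close>.\<close>
    define d where "d = single i 1 - chain_scale (1 / lookup e i) e"
    have "keys d \<subseteq> I - {i}"
      using e(1) iI i by (auto simp: d_def in_keys_iff lookup_minus lookup_single when_def split: if_splits)
    then have "?L d \<in> chains.span (v ` (I - {i}))" using lin_ext_image_supported by blast
    moreover have "?L d = v i" by (simp add: d_def chains.lin_ext_diff chains.lin_ext_scale e(2))
    ultimately show False using not_in_span_others[OF I v iI] by simp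
  qed
qed

text \<open>An isomorphism from first homology to \<open>n\<close>-space, written on cycles. Vectors
  are finitely supported functions with keys in \<open>{1..n}\<close>, so that the linear algebra of
  chains applies to them as well.\<close>

definition homology_coordinates ::
  "'a::metric_space set \<Rightarrow> nat \<Rightarrow> (('a, 'f::field) schain \<Rightarrow> (nat \<Rightarrow>\<^sub>0 'f)) \<Rightarrow> bool" where
  "homology_coordinates X n \<theta> \<longleftrightarrow>
     (\<forall>x\<in>singular_cycles 1 (top_of_set X). \<forall>y\<in>singular_cycles 1 (top_of_set X). \<theta> (x + y) = \<theta> x + \<theta> y) \<and>
     (\<forall>k. \<forall>x\<in>singular_cycles 1 (top_of_set X). \<theta> (chain_scale k x) = chain_scale k (\<theta> x)) \<and>
     \<theta> ` singular_cycles 1 (top_of_set X) = {e. keys e \<subseteq> {1..n}} \<and>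
     (\<forall>z\<in>singular_cycles 1 (top_of_set X). \<theta> z = 0 \<longleftrightarrow> z \<in> singular_boundaries 1 (top_of_set X))"

lemma homology_coordinates_exist:
  fixes X :: "'a::metric_space set"
  assumes "isomorphic_modules
           (singular_homology 1 (top_of_set X) :: ('f::field, ('a, 'f) schain set) module)
           (direct_sum_module {1..n} (\<lambda>i. field_module :: ('f, 'f) module))"
  obtains \<theta> :: "('a, 'f::field) schain \<Rightarrow> (nat \<Rightarrow>\<^sub>0 'f)" where "homology_coordinates X n \<theta>"
proof -
  let ?H = "singular_homology 1 (top_of_set X) :: ('f, ('a, 'f) schain set) module"
  let ?D = "direct_sum_module {1..n} (\<lambda>i. field_module :: ('f, 'f) module)"
  let ?Z = "singular_cycles 1 (top_of_set X) :: ('a, 'f) schain set"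
  obtain h where h: "linear_iso ?H ?D h" using assms unfolding isomorphic_modules_def by blast
  have PH: "presents ?Z (singular_boundaries 1 (top_of_set X)) ?H (homology_class X)"
    by (rule presents_singular_homology)
  note D = presentsD[OF PH] and Z = chain_subspaceD[OF presentsD(1)[OF PH]]
  have carrier_D: "carrier ?D = ({1..n} \<rightarrow>\<^sub>E UNIV)"
    by (auto simp: direct_sum_module_def field_module_def)
  have im: "h ` homology_class X ` ?Z = ({1..n} \<rightarrow>\<^sub>E UNIV)"
    using h D(3) unfolding linear_iso_def bij_betw_def carrier_D by metis
  have h_add: "h (homology_class X (x + y)) = (\<lambda>i\<in>{1..n}. h (homology_class X x) i + h (homology_class X y) i)"
    if "x \<in> ?Z" "y \<in> ?Z" for x y
    using h that D(5,8) unfolding linear_iso_def by (simp add: direct_sum_module_def field_module_def)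
  have h_scale: "h (homology_class X (chain_scale k x)) = (\<lambda>i\<in>{1..n}. k * h (homology_class X x) i)"
    if "x \<in> ?Z" for k x
    using h that D(6,8) unfolding linear_iso_def by (simp add: direct_sum_module_def field_module_def)
  have h_eq: "h (homology_class X x) = h (homology_class X y) \<longleftrightarrow> x - y \<in> singular_boundaries 1 (top_of_set X)"
    if "x \<in> ?Z" "y \<in> ?Z" for x y
    using h that D(7,8) unfolding linear_iso_def bij_betw_def inj_on_def by metis
  define \<theta> where "\<theta> z = (\<Sum>i\<in>{1..n}. single i (h (homology_class X z) i))" for z
  have \<theta>: "lookup (\<theta> z) i = (if i \<in> {1..n} then h (homology_class X z) i else 0)" for z i
    by (simp add: \<theta>_def lookup_sum lookup_single when_def)
  have "homology_coordinates X n \<theta>"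
    unfolding homology_coordinates_def
  proof (intro conjI ballI allI)
    show "\<theta> (x + y) = \<theta> x + \<theta> y" if "x \<in> ?Z" "y \<in> ?Z" for x y
      by (rule poly_mapping_eqI) (simp only: \<theta> lookup_add h_add[OF that], simp)
    show "\<theta> (chain_scale k x) = chain_scale k (\<theta> x)" if "x \<in> ?Z" for k x
      by (rule poly_mapping_eqI) (simp only: \<theta> lookup_chain_scale h_scale[OF that], simp)
    show "\<theta> z = 0 \<longleftrightarrow> z \<in> singular_boundaries 1 (top_of_set X)" if z: "z \<in> ?Z" for z
    proof -
      have ext: "h (homology_class X x) \<in> ({1..n} \<rightarrow>\<^sub>E UNIV)" if "x \<in> ?Z" for x using im that by blast
      have "h (homology_class X 0) = (\<lambda>i\<in>{1..n}. 0)"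
        using h_scale[OF Z(1), of 0] by simp
      then have "\<theta> z = 0 \<longleftrightarrow> h (homology_class X z) = h (homology_class X 0)"
        using ext[OF z] by (auto simp: poly_mapping_eq_iff fun_eq_iff \<theta> PiE_def extensional_def restrict_def)
      then show ?thesis using h_eq[OF z Z(1)] by simp
    qed
    show "\<theta> ` ?Z = {e. keys e \<subseteq> {1..n}}"
    proof
      show "\<theta> ` ?Z \<subseteq> {e. keys e \<subseteq> {1..n}}"
        by (auto simp: in_keys_iff \<theta> split: if_splits)
      show "{e. keys e \<subseteq> {1..n}} \<subseteq> \<theta> ` ?Z"
      proof clarify
        fix e :: "nat \<Rightarrow>\<^sub>0 'f" assume e: "keys e \<subseteq> {1..n}"
        have "restrict (lookup e) {1..n} \<in> ({1..n} \<rightarrow>\<^sub>E UNIV)" by simp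
        then obtain z where z: "z \<in> ?Z" "h (homology_class X z) = restrict (lookup e) {1..n}"
          unfolding im[symmetric] by force
        have "e = \<theta> z"
        proof (rule poly_mapping_eqI)
          fix i show "lookup e i = lookup (\<theta> z) i"
            unfolding \<theta> z(2) using e by (auto simp: in_keys_iff)
        qed
        then show "e \<in> \<theta> ` ?Z" using z by blast
      qed
    qed
  qed
  then show thesis by (rule that)
qed

section \<open>Loops sorted by length and the index \<open>num_below\<close>\<close>

lemma path_length_third_less:
  assumes "r > 0"
  shows "l / 3 < ennreal r \<longleftrightarrow> l < ennreal (3 * r)"
proof (cases l)
  case (real x)
  then have "l / 3 = ennreal (x / 3)" using divide_ennreal[of x 3] by simp
  then show ?thesis using real by (simp add: ennreal_less_iff field_simps)
next
  case top then show ?thesis by (simp add: ennreal_top_divide)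
qed

definition sorted_loops :: "'a::metric_space set \<Rightarrow> nat \<Rightarrow> (nat \<Rightarrow> real \<Rightarrow> 'a) \<Rightarrow> bool" where
  "sorted_loops X n a \<longleftrightarrow> (\<forall>i\<in>{1..n}. loop_in X (a i)) \<and>
     (\<forall>i\<in>{1..n}. \<forall>j\<in>{1..n}. i < j \<longrightarrow> path_length (a i) \<le> path_length (a j))"

lemma sorted_loopsD:
  assumes "sorted_loops X n a"
  shows "1 \<le> i \<Longrightarrow> i \<le> n \<Longrightarrow> loop_in X (a i)"
    "1 \<le> i \<Longrightarrow> i \<le> j \<Longrightarrow> j \<le> n \<Longrightarrow> path_length (a i) \<le> path_length (a j)"
proof -
  show "1 \<le> i \<Longrightarrow> i \<le> n \<Longrightarrow> loop_in X (a i)" using assms by (simp add: sorted_loops_def)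
  show "1 \<le> i \<Longrightarrow> i \<le> j \<Longrightarrow> j \<le> n \<Longrightarrow> path_length (a i) \<le> path_length (a j)"
    using assms unfolding sorted_loops_def by (cases "i = j") auto
qed

lemma num_below_le: "num_below n a r \<le> n"
proof -
  define I where "I = {i \<in> {1..n}. path_length (a i) / 3 < ennreal r}"
  have nb: "num_below n a r = (if I = {} then 0 else Max I)" by (simp only: num_below_def I_def Let_def)
  have I: "I \<subseteq> {1..n}" by (auto simp: I_def)
  then have "Max I \<in> {1..n}" if "I \<noteq> {}" using that Max_in[of I] finite_subset by blast
  then show ?thesis by (simp add: nb)
qed

text \<open>Sorted lengths make the indices with \<open>path_length (a i) / 3 < ennreal r\<close> an
  initial segment, of which \<open>num_below\<close> is the last index. Indices start at 1, so the
  default 0 denotes the empty segment.\<close>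

lemma le_num_below_iff:
  assumes "sorted_loops X n a" "1 \<le> i" "i \<le> n"
  shows "i \<le> num_below n a r \<longleftrightarrow> path_length (a i) / 3 < ennreal r"
proof -
  define I where "I = {i \<in> {1..n}. path_length (a i) / 3 < ennreal r}"
  have nb: "num_below n a r = (if I = {} then 0 else Max I)" by (simp only: num_below_def I_def Let_def)
  have fin: "finite I" by (simp add: I_def)
  show ?thesis
  proof
    assume "path_length (a i) / 3 < ennreal r"
    then have "i \<in> I" using assms by (simp add: I_def)
    then show "i \<le> num_below n a r" using fin by (auto simp: nb)
  next
    assume i: "i \<le> num_below n a r"
    then have "I \<noteq> {}" using assms(2) by (auto simp: nb)
    then have M: "Max I \<in> I" "i \<le> Max I" using i fin by (auto simp: nb)
    then have "path_length (a i) / 3 \<le> path_length (a (Max I)) / 3"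
      using sorted_loopsD(2)[OF assms(1,2)] by (intro divide_right_mono_ennreal) (auto simp: I_def)
    then show "path_length (a i) / 3 < ennreal r" using M(1) by (auto simp: I_def intro: le_less_trans)
  qed
qed

lemma num_below_mono:
  assumes "sorted_loops X n a" "r \<le> s"
  shows "num_below n a r \<le> num_below n a s"
proof (cases "num_below n a r = 0")
  case False
  let ?k = "num_below n a r"
  have "path_length (a ?k) / 3 < ennreal r"
    using le_num_below_iff[OF assms(1), of ?k r] False num_below_le[of n a r] by simp
  also have "\<dots> \<le> ennreal s" using assms(2) by (rule ennreal_leI)
  finally show ?thesis using le_num_below_iff[OF assms(1), of ?k s] False num_below_le[of n a r] by simp
qed simp

text \<open>Used with two kinds of coordinates: arbitrary ones from the assumed isomorphism, and
  ones adapted to a base, in which the classes of its loops are the unit vectors.\<close>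

locale coordinates =
  fixes X :: "'a::metric_space set" and n :: nat and \<theta> :: "('a, 'f::field) schain \<Rightarrow> (nat \<Rightarrow>\<^sub>0 'f)"
  assumes coords: "homology_coordinates X n \<theta>"
begin

abbreviation "Z \<equiv> singular_cycles 1 (top_of_set X) :: ('a, 'f) schain set"
abbreviation "B \<equiv> singular_boundaries 1 (top_of_set X) :: ('a, 'f) schain set"
abbreviation "H \<equiv> singular_homology 1 (top_of_set X) :: ('f, ('a, 'f) schain set) module"
abbreviation "E \<equiv> {e :: nat \<Rightarrow>\<^sub>0 'f. keys e \<subseteq> {1..n}}"

text \<open>Subspaces of \<open>n\<close>-space correspond in this way to the subspaces of
  \<open>Z\<close> that contain the boundaries; the kernels of all three persistences are of this
  form.\<close>

definition preimage :: "(nat \<Rightarrow>\<^sub>0 'f) set \<Rightarrow> ('a, 'f) schain set" where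
  "preimage \<Lambda> = {z \<in> Z. \<theta> z \<in> \<Lambda>}"

abbreviation loop_vec :: "(real \<Rightarrow> 'a) \<Rightarrow> (nat \<Rightarrow>\<^sub>0 'f)" where
  "loop_vec g \<equiv> \<theta> (path_chain g)"

definition short_space :: "real \<Rightarrow> (nat \<Rightarrow>\<^sub>0 'f) set" where
  "short_space r = chains.span (loop_vec ` {g. loop_in X g \<and> path_length g < ennreal (3 * r)})"

lemma presents_H: "presents Z B H (homology_class X)"
  by (rule presents_singular_homology)

lemmas Z_sub = chain_subspaceD[OF presentsD(1)[OF presents_H]]

lemma B_subset_Z: "B \<subseteq> Z"
  by (rule singular_boundaries_1_subset_cycles)

lemma path_chain_in_Z: "loop_in X g \<Longrightarrow> path_chain g \<in> Z"
  by (rule loop_in_cycle)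

lemma \<theta>_add: "x \<in> Z \<Longrightarrow> y \<in> Z \<Longrightarrow> \<theta> (x + y) = \<theta> x + \<theta> y"
  and \<theta>_scale: "x \<in> Z \<Longrightarrow> \<theta> (chain_scale k x) = chain_scale k (\<theta> x)"
  and \<theta>_image: "\<theta> ` Z = E"
  and \<theta>_eq_0: "z \<in> Z \<Longrightarrow> \<theta> z = 0 \<longleftrightarrow> z \<in> B"
  using coords unfolding homology_coordinates_def by blast+

lemma \<theta>_diff: "x \<in> Z \<Longrightarrow> y \<in> Z \<Longrightarrow> \<theta> (x - y) = \<theta> x - \<theta> y"
  using \<theta>_add[of "x - y" y] Z_sub(3)[of x y] by simp

lemma \<theta>_0: "\<theta> 0 = 0"
  using \<theta>_diff[of 0 0] Z_sub(1) by simp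

lemma \<theta>_eq: "x \<in> Z \<Longrightarrow> y \<in> Z \<Longrightarrow> \<theta> x = \<theta> y \<longleftrightarrow> x - y \<in> B"
  using \<theta>_eq_0[of "x - y"] \<theta>_diff Z_sub(3) by simp

lemma \<theta>_in_E: "z \<in> Z \<Longrightarrow> \<theta> z \<in> E"
  using \<theta>_image by blast

lemma subspace_preimage: "chains.subspace \<Lambda> \<Longrightarrow> chains.subspace (preimage \<Lambda>)"
  unfolding preimage_def using chain_subspaceD[of \<Lambda>] Z_sub
  by (intro chains.subspaceI) (simp_all add: \<theta>_0 \<theta>_add \<theta>_scale)

lemma preimage_subset: "preimage \<Lambda> \<subseteq> Z"
  by (auto simp: preimage_def)

lemma B_subset_preimage: "chains.subspace \<Lambda> \<Longrightarrow> B \<subseteq> preimage \<Lambda>"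
proof
  fix b assume \<Lambda>: "chains.subspace \<Lambda>" and b: "b \<in> B"
  then have "b \<in> Z" using B_subset_Z by blast
  moreover from this have "\<theta> b = 0" using \<theta>_eq_0 b by blast
  ultimately show "b \<in> preimage \<Lambda>" using chain_subspaceD(1)[OF \<Lambda>] by (simp add: preimage_def)
qed

lemma preimage_eq_iff:
  assumes "\<Lambda> \<subseteq> E" "\<Lambda>' \<subseteq> E"
  shows "preimage \<Lambda> = preimage \<Lambda>' \<longleftrightarrow> \<Lambda> = \<Lambda>'"
proof
  have "\<theta> ` preimage \<Lambda> = \<Lambda>" if "\<Lambda> \<subseteq> E" for \<Lambda>
    using that unfolding preimage_def \<theta>_image[symmetric] by blast
  then show "preimage \<Lambda> = preimage \<Lambda>' \<Longrightarrow> \<Lambda> = \<Lambda>'" using assms by metis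
qed simp

lemma preimage_mono: "\<Lambda> \<subseteq> \<Lambda>' \<Longrightarrow> preimage \<Lambda> \<subseteq> preimage \<Lambda>'"
  by (auto simp: preimage_def)

lemma \<theta>_span:
  assumes "S \<subseteq> Z"
  shows "\<theta> ` chains.span S = chains.span (\<theta> ` S)" "chains.span S \<subseteq> Z"
proof -
  show SZ: "chains.span S \<subseteq> Z" using assms by (intro chains.span_minimal subspace_singular_cycles)
  show "\<theta> ` chains.span S = chains.span (\<theta> ` S)"
  proof
    have "chains.span S \<subseteq> preimage (chains.span (\<theta> ` S))"
      using assms by (intro chains.span_minimal subspace_preimage) (auto simp: preimage_def intro: chains.span_base)
    then show "\<theta> ` chains.span S \<subseteq> chains.span (\<theta> ` S)" by (auto simp: preimage_def)
    show "chains.span (\<theta> ` S) \<subseteq> \<theta> ` chains.span S"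
    proof (rule chains.span_minimal)
      show "\<theta> ` S \<subseteq> \<theta> ` chains.span S" using chains.span_superset by blast
      show "chains.subspace (\<theta> ` chains.span S)"
      proof (rule chains.subspaceI)
        show "0 \<in> \<theta> ` chains.span S" using \<theta>_0 chains.span_zero by (metis imageI)
        fix x y assume "x \<in> \<theta> ` chains.span S" "y \<in> \<theta> ` chains.span S"
        then obtain u v where "u \<in> chains.span S" "v \<in> chains.span S" "x = \<theta> u" "y = \<theta> v" by blast
        moreover from this have "\<theta> (u + v) = x + y" using \<theta>_add SZ by blast
        ultimately show "x + y \<in> \<theta> ` chains.span S" using chains.span_add by (metis imageI)
      next
        fix c x assume "x \<in> \<theta> ` chains.span S"
        then obtain u where "u \<in> chains.span S" "x = \<theta> u" by blast
        moreover from this have "\<theta> (chain_scale c u) = chain_scale c x" using \<theta>_scale SZ by blast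
        ultimately show "chain_scale c x \<in> \<theta> ` chains.span S" using chains.span_scale by (metis imageI)
      qed
    qed
  qed
qed

text \<open>A cycle whose coordinates agree with those of an element of the span differs from that
  element by a boundary.\<close>

lemma preimage_span:
  assumes S: "S \<subseteq> Z"
  shows "preimage (chains.span (\<theta> ` S)) = {b + z |b z. b \<in> B \<and> z \<in> chains.span S}"
proof safe
  fix x assume "x \<in> preimage (chains.span (\<theta> ` S))"
  then obtain z where z: "x \<in> Z" "z \<in> chains.span S" "\<theta> x = \<theta> z"
    unfolding preimage_def \<theta>_span(1)[OF S, symmetric] by auto
  then have "x - z \<in> B" using \<theta>_eq \<theta>_span(2)[OF S] by blast
  then show "\<exists>b z. x = b + z \<and> b \<in> B \<and> z \<in> chains.span S"
    using z(2) by (intro exI[of _ "x - z"] exI[of _ z]) auto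
next
  fix b z assume zb: "b \<in> B" "z \<in> chains.span S"
  note P = subspace_preimage[OF chains.subspace_span[of "\<theta> ` S"]]
  have "z \<in> preimage (chains.span (\<theta> ` S))"
    using zb \<theta>_span[OF S] by (auto simp: preimage_def)
  moreover have "b \<in> preimage (chains.span (\<theta> ` S))" using B_subset_preimage[OF chains.subspace_span] zb by blast
  ultimately show "b + z \<in> preimage (chains.span (\<theta> ` S))" by (intro chain_subspaceD(2)[OF P])
qed

lemma module_span_homology:
  assumes S: "S \<subseteq> Z"
  shows "module_span H (homology_class X ` S) = homology_class X ` preimage (chains.span (\<theta> ` S))"
proof -
  note D = presentsD[OF presents_H]
  have B0: "0 \<in> B" by (rule chain_subspaceD(1)[OF subspace_singular_boundaries])
  have "homology_class X (b + z) = homology_class X z" if "b \<in> B" "z \<in> chains.span S" for z b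
    using D(7)[of "b + z" z] that \<theta>_span(2)[OF S] B_subset_Z Z_sub(2)
    by auto
  then have "homology_class X ` {b + z |b z. b \<in> B \<and> z \<in> chains.span S} = homology_class X ` chains.span S"
    using B0 by (force simp: image_iff)
  then show ?thesis
    unfolding preimage_span[OF S] module_span_presented[OF presents_H S] by simp
qed

lemma short_cycles_eq_preimage: "short_cycles X r = preimage (short_space r)"
proof -
  let ?P = "path_chain ` {g. loop_in X g \<and> path_length g < ennreal (3 * r)} :: ('a, 'f) schain set"
  have P: "?P \<subseteq> Z" using path_chain_in_Z by blast
  have eq: "preimage (short_space r) = {b + z |b z. b \<in> B \<and> z \<in> chains.span ?P}"
    unfolding short_space_def using preimage_span[OF P] by (simp add: image_image)
  have span_B: "chains.span B = B" using presentsD(2)[OF presents_H] by (simp only: chains.span_eq_iff)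
  have "short_cycles X r = {b + z |b z. b \<in> B \<and> z \<in> chains.span ?P}"
    unfolding short_cycles_def chains.span_Un span_B ..
  then show ?thesis using eq by simp
qed

lemma short_space_subset: "short_space r \<subseteq> E"
  unfolding short_space_def
proof (intro chains.span_minimal subspace_supported image_subsetI)
  fix g assume "g \<in> {g. loop_in X g \<and> path_length g < ennreal (3 * r)}"
  then show "loop_vec g \<in> E" using \<theta>_in_E[OF path_chain_in_Z] by simp
qed

lemma homology_base_iff:
  "homology_base TYPE('f) X n a \<longleftrightarrow>
     sorted_loops X n a \<and> chains.span ((\<lambda>i. loop_vec (a i)) ` {1..n}) = E"
proof (cases "sorted_loops X n a")
  case True
  let ?S = "(\<lambda>i. path_chain (a i)) ` {1..n} :: ('a, 'f) schain set"
  note D = presentsD[OF presents_H]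
  have S: "?S \<subseteq> Z" using sorted_loopsD(1)[OF True] path_chain_in_Z by auto
  have spanE: "chains.span (\<theta> ` ?S) \<subseteq> E" unfolding \<theta>_span(1)[OF S, symmetric] using \<theta>_span(2)[OF S] \<theta>_in_E by blast
  have "homology_class X ` preimage (chains.span (\<theta> ` ?S)) = carrier H \<longleftrightarrow> chains.span (\<theta> ` ?S) = E"
  proof
    assume *: "homology_class X ` preimage (chains.span (\<theta> ` ?S)) = carrier H"
    have "Z \<subseteq> preimage (chains.span (\<theta> ` ?S))"
    proof
      fix z assume z: "z \<in> Z"
      then have "homology_class X z \<in> homology_class X ` preimage (chains.span (\<theta> ` ?S))"
        unfolding * by (rule D(8))
      then obtain z' where z': "z' \<in> preimage (chains.span (\<theta> ` ?S))" "homology_class X z = homology_class X z'"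
        by (rule imageE) (rule that)
      then have "z' \<in> Z" using preimage_subset by blast
      then have "z - z' \<in> B" "z' \<in> Z" using D(7)[OF z] z'(2) by simp_all
      then have "\<theta> z = \<theta> z'" using \<theta>_eq z by simp
      then show "z \<in> preimage (chains.span (\<theta> ` ?S))" using z z'(1) by (simp add: preimage_def)
    qed
    then have "E \<subseteq> chains.span (\<theta> ` ?S)" unfolding \<theta>_image[symmetric] by (auto simp: preimage_def)
    then show "chains.span (\<theta> ` ?S) = E" using spanE by blast
  next
    assume "chains.span (\<theta> ` ?S) = E"
    then have "preimage (chains.span (\<theta> ` ?S)) = Z" using \<theta>_in_E by (auto simp: preimage_def)
    then show "homology_class X ` preimage (chains.span (\<theta> ` ?S)) = carrier H" using D(3) by simp
  qed
  moreover have "(\<lambda>i. loop_class X (a i)) ` {1..n} = homology_class X ` ?S"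
    by (simp add: loop_class_def image_image)
  ultimately show ?thesis
    using True module_span_homology[OF S]
    by (simp add: homology_base_def sorted_loops_def image_image)
next
  case False
  then show ?thesis by (auto simp: homology_base_def sorted_loops_def)
qed

lemma presents_quotient_preimage:
  assumes "chains.subspace \<Lambda>"
  shows "presents Z (preimage \<Lambda>) (quotient_module H (homology_class X ` preimage \<Lambda>))
    (\<lambda>z. homology_class X ` preimage \<Lambda> +>\<^bsub>H\<^esub> homology_class X z)"
  by (rule presents_quotient[OF presents_H subspace_preimage[OF assms]
      B_subset_preimage[OF assms] preimage_subset])

abbreviation base_space :: "(nat \<Rightarrow> real \<Rightarrow> 'a) \<Rightarrow> real \<Rightarrow> (nat \<Rightarrow>\<^sub>0 'f) set" where
  "base_space a r \<equiv> chains.span ((\<lambda>i. loop_vec (a i)) ` {1..num_below n a r})"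

lemma loop_span_eq:
  assumes "sorted_loops X n a"
  shows "loop_span X n a r = homology_class X ` preimage (base_space a r)"
proof -
  let ?S = "(\<lambda>i. path_chain (a i)) ` {1..num_below n a r} :: ('a, 'f) schain set"
  have S: "?S \<subseteq> Z" using sorted_loopsD(1)[OF assms] num_below_le[of n a r] path_chain_in_Z by auto
  show ?thesis
    using module_span_homology[OF S] by (simp add: loop_span_def loop_class_def image_image)
qed

lemma presents_quotient_persistence:
  assumes a: "sorted_loops X n a"
  shows "presents_persistence Z (\<lambda>r. preimage (base_space a r)) (quotient_persistence X n a)
    (\<lambda>r z. homology_class X ` preimage (base_space a r) +>\<^bsub>H\<^esub> homology_class X z)"
  unfolding presents_persistence_def
proof (intro conjI allI impI ballI)
  fix r :: real
  show "presents Z (preimage (base_space a r)) (level (quotient_persistence X n a) r)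
      (\<lambda>z. homology_class X ` preimage (base_space a r) +>\<^bsub>H\<^esub> homology_class X z)"
    using presents_quotient_preimage[OF chains.subspace_span]
    by (simp add: quotient_persistence_def loop_span_eq[OF a])
  fix s z assume s: "r \<le> s" and z: "z \<in> Z"
  have "base_space a r \<subseteq> base_space a s"
    using num_below_mono[OF a s] by (intro chains.span_mono) auto
  then show "bond (quotient_persistence X n a) r s
        (homology_class X ` preimage (base_space a r) +>\<^bsub>H\<^esub> homology_class X z) =
      homology_class X ` preimage (base_space a s) +>\<^bsub>H\<^esub> homology_class X z"
    using coset_map_presented[OF presents_H preimage_mono preimage_subset
        chain_subspaceD(1)[OF subspace_preimage[OF chains.subspace_span]]
        subspace_preimage[OF chains.subspace_span] z]
    by (simp add: quotient_persistence_def loop_span_eq[OF a])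
qed

section \<open>Independence and exchange in a base\<close>

lemma homology_base_independent:
  assumes "homology_base TYPE('f) X n a" "i \<in> {1..n}"
  shows "loop_vec (a i) \<notin> chains.span ((\<lambda>i. loop_vec (a i)) ` ({1..n} - {i}))"
  using not_in_span_others[of "{1..n}" "\<lambda>i. loop_vec (a i)" i] assms by (simp add: homology_base_iff)

text \<open>Should the index grow, the last loop gained would lie in the span of earlier ones,
  against independence.\<close>

lemma base_space_eq_iff:
  assumes a: "homology_base TYPE('f) X n a" and "r \<le> s"
  shows "base_space a r = base_space a s \<longleftrightarrow> num_below n a r = num_below n a s"
proof
  assume eq: "base_space a r = base_space a s"
  show "num_below n a r = num_below n a s"
  proof (rule ccontr)
    assume "num_below n a r \<noteq> num_below n a s"
    then have lt: "num_below n a r < num_below n a s"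
      using num_below_mono[of X n a r s] a assms(2) by (simp add: homology_base_iff)
    let ?k = "num_below n a s"
    have "loop_vec (a ?k) \<in> base_space a s" using lt by (intro chains.span_base) auto
    then have "loop_vec (a ?k) \<in> base_space a r" using eq by simp
    moreover have "base_space a r \<subseteq> chains.span ((\<lambda>i. loop_vec (a i)) ` ({1..n} - {?k}))"
      using lt num_below_le[of n a r] by (intro chains.span_mono) auto
    ultimately show False
      using homology_base_independent[OF a, of ?k] lt num_below_le[of n a s] by auto
  qed
qed simp

text \<open>
  Inserting the loop \<open>c\<close> at the first position \<open>p\<close> where it is shorter than \<open>a p\<close>, and dropping
  \<open>a m\<close>, makes the length vector lexicographically smaller.
\<close>

lemma homology_base_exchange:
  assumes a: "homology_base TYPE('f) X n a" and c: "loop_in X c" and m: "m \<in> {1..n}"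
    and less: "path_length c < path_length (a m)"
    and span: "loop_vec (a m) \<in> chains.span (insert (loop_vec c) ((\<lambda>i. loop_vec (a i)) ` ({1..n} - {m})))"
  obtains b where "homology_base TYPE('f) X n b"
    "ord_class.lexordp (length_vector n b) (length_vector n a)"
proof -
  have sa: "sorted_loops X n a" and Ea: "chains.span ((\<lambda>i. loop_vec (a i)) ` {1..n}) = E"
    using a by (auto simp: homology_base_iff)
  \<comment> \<open>\<open>p\<close> is the first position held by a loop strictly longer than
    \<open>c\<close>, so loops of the same length as \<open>c\<close> stay before it and the order
    is kept.\<close>
  define p where "p = (LEAST p. 1 \<le> p \<and> path_length c < path_length (a p))"
  have p: "1 \<le> p" "path_length c < path_length (a p)"
    using LeastI[of "\<lambda>p. 1 \<le> p \<and> path_length c < path_length (a p)" m] m less by (auto simp: p_def)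
  have pm: "p \<le> m" unfolding p_def using m less by (intro Least_le) auto
  have before: "path_length (a i) \<le> path_length c" if "1 \<le> i" "i < p" for i
    using not_less_Least[of i "\<lambda>p. 1 \<le> p \<and> path_length c < path_length (a p)"] that
    by (auto simp: p_def not_less)
  have mn: "m \<le> n" using m by simp
  define b where "b i = (if i < p then a i else if i = p then c else if i \<le> m then a (i - 1) else a i)" for i
  have sb: "sorted_loops X n b"
    unfolding sorted_loops_def
  proof (intro conjI ballI impI)
    show "loop_in X (b i)" if "i \<in> {1..n}" for i
      using sorted_loopsD(1)[OF sa] that c p(1) mn by (auto simp: b_def)
    fix i j assume ij: "i \<in> {1..n}" "j \<in> {1..n}" "i < j"
    have after: "path_length c \<le> path_length (a k)" if "p \<le> k" "k \<le> n" for k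
      using less_imp_le[OF p(2)] sorted_loopsD(2)[OF sa p(1) that] by (rule order.trans)
    have mono: "path_length (a k) \<le> path_length (a l)" if "1 \<le> k" "k \<le> l" "l \<le> n" for k l
      using sorted_loopsD(2)[OF sa that] .
    consider "j < p" | "i < p" "j = p" | "i < p" "p < j" | "i = p" | "p < i" using ij by linarith
    then show "path_length (b i) \<le> path_length (b j)"
    proof cases
      case 1 then show ?thesis using ij mono[of i j] by (simp add: b_def)
    next
      case 2 then show ?thesis using ij before[of i] by (simp add: b_def)
    next
      case 3 then show ?thesis using ij mono[of i "j - 1"] mono[of i j] by (auto simp: b_def)
    next
      case 4 then show ?thesis using ij after[of "j - 1"] after[of j] by (auto simp: b_def)
    next
      case 5
      then show ?thesis
        using ij p(1) mono[of "i - 1" "j - 1"] mono[of "i - 1" j] mono[of i j] by (auto simp: b_def)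
    qed
  qed
  let ?W = "chains.span ((\<lambda>i. loop_vec (b i)) ` {1..n})"
  have W: "loop_vec (b i) \<in> ?W" if "1 \<le> i" "i \<le> n" for i using that by (intro chains.span_base) auto
  have c_W: "loop_vec c \<in> ?W" using W[of p] p(1) pm mn by (simp add: b_def)
  have a_W: "loop_vec (a i) \<in> ?W" if i: "i \<in> {1..n} - {m}" for i
  proof -
    have "i \<noteq> m" using i by simp
    then consider "i < p" | "p \<le> i" "i < m" | "m < i" by linarith
    then show ?thesis
    proof cases
      case 1 then show ?thesis using W[of i] i by (simp add: b_def)
    next
      case 2 then show ?thesis using W[of "Suc i"] mn by (simp add: b_def)
    next
      case 3 then show ?thesis using W[of i] i pm by (simp add: b_def)
    qed
  qed
  have "chains.span (insert (loop_vec c) ((\<lambda>i. loop_vec (a i)) ` ({1..n} - {m}))) \<subseteq> ?W"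
    using c_W a_W by (intro chains.span_minimal) blast+
  then have "loop_vec (a m) \<in> ?W" using span by blast
  then have "(\<lambda>i. loop_vec (a i)) ` {1..n} \<subseteq> ?W" using a_W by blast
  then have "E \<subseteq> ?W" unfolding Ea[symmetric] by (intro chains.span_minimal) auto
  moreover have "?W \<subseteq> E"
    using sorted_loopsD(1)[OF sb] path_chain_in_Z \<theta>_in_E
    by (intro chains.span_minimal subspace_supported) force
  ultimately have "?W = E" by blast
  then have "homology_base TYPE('f) X n b" using sb by (simp add: homology_base_iff)
  moreover have "ord_class.lexordp (length_vector n b) (length_vector n a)"
  proof -
    have split: "[1..<Suc n] = [1..<p] @ p # [Suc p..<Suc n]"
      using p(1) pm mn upt_add_eq_append[of 1 p "Suc n - p"] upt_conv_Cons[of p "Suc n"] by simp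
    have "map (\<lambda>i. path_length (b i)) [1..<p] = map (\<lambda>i. path_length (a i)) [1..<p]" "b p = c"
      by (simp_all add: b_def)
    then show ?thesis
      unfolding length_vector_def split map_append list.map
      by (simp only:) (rule lexordp_append_left_rightI[OF p(2)])
  qed
  ultimately show thesis by (rule that)
qed

text \<open>Suppose that the class of a loop \<open>c\<close> shorter than \<open>3 * r\<close> is
  not in the span of the loops \<open>a i\<close> that are shorter than this. The last loop
  \<open>a m\<close> in its expansion is then longer than \<open>c\<close> and can be exchanged for
  \<open>c\<close>, against minimality. Choosing \<open>m\<close> least such that the first
  \<open>m\<close> loops suffice makes \<open>a m\<close> occur.\<close>

lemma lex_minimal_short_space:
  assumes a: "lex_minimal_base TYPE('f) X n a" and r: "r > 0"
  shows "short_space r = base_space a r"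
proof
  have base: "homology_base TYPE('f) X n a" using a by (simp add: lex_minimal_base_def)
  then have sa: "sorted_loops X n a" and Ea: "chains.span ((\<lambda>i. loop_vec (a i)) ` {1..n}) = E"
    by (auto simp: homology_base_iff)
  let ?k = "num_below n a r"
  have short_iff: "path_length (a i) < ennreal (3 * r) \<longleftrightarrow> i \<le> ?k" if "1 \<le> i" "i \<le> n" for i
    using le_num_below_iff[OF sa that, of r] path_length_third_less[OF r] by simp
  show "base_space a r \<subseteq> short_space r"
    unfolding short_space_def
  proof (rule chains.span_mono, clarify)
    fix i assume "i \<in> {1..?k}"
    then show "loop_vec (a i) \<in> loop_vec ` {g. loop_in X g \<and> path_length g < ennreal (3 * r)}"
      using sorted_loopsD(1)[OF sa, of i] short_iff[of i] num_below_le[of n a r] by auto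
  qed
  show "short_space r \<subseteq> base_space a r"
    unfolding short_space_def
  proof (rule chains.span_minimal, clarify)
    fix c assume c: "loop_in X c" "path_length c < ennreal (3 * r)"
    let ?V = "\<lambda>m. chains.span ((\<lambda>i. loop_vec (a i)) ` {1..m})"
    have "loop_vec c \<in> ?V n" using \<theta>_in_E[OF path_chain_in_Z[OF c(1)]] Ea by blast
    define m where "m = (LEAST m. loop_vec c \<in> ?V m)"
    have m: "loop_vec c \<in> ?V m" unfolding m_def by (rule LeastI) fact
    have mn: "m \<le> n" unfolding m_def by (rule Least_le) fact
    show "loop_vec c \<in> base_space a r"
    proof (cases "m \<le> ?k")
      case True
      then have "?V m \<subseteq> ?V ?k" by (intro chains.span_mono image_mono) auto
      then show ?thesis using m by blast
    next
      case False
      then have "m - 1 < m" by simp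
      then have notin: "loop_vec c \<notin> ?V (m - 1)" using not_less_Least unfolding m_def by blast
      have "{1..m} = insert m {1..m - 1}" using False by auto
      then have "loop_vec c \<in> chains.span (insert (loop_vec (a m)) ((\<lambda>i. loop_vec (a i)) ` {1..m - 1}))" using m by simp
      then have "loop_vec (a m) \<in> chains.span (insert (loop_vec c) ((\<lambda>i. loop_vec (a i)) ` {1..m - 1}))"
        by (rule chains.in_span_insert) (rule notin)
      moreover have "chains.span (insert (loop_vec c) ((\<lambda>i. loop_vec (a i)) ` {1..m - 1})) \<subseteq>
          chains.span (insert (loop_vec c) ((\<lambda>i. loop_vec (a i)) ` ({1..n} - {m})))"
        using mn False by (intro chains.span_mono insert_mono image_mono) auto
      ultimately have "loop_vec (a m) \<in> chains.span (insert (loop_vec c) ((\<lambda>i. loop_vec (a i)) ` ({1..n} - {m})))" by blast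
      moreover have "path_length c < path_length (a m)"
        using short_iff[of m] False mn c(2) by (auto intro: less_le_trans)
      ultimately obtain b where "homology_base TYPE('f) X n b"
          "ord_class.lexordp (length_vector n b) (length_vector n a)"
        using homology_base_exchange[OF base c(1), of m] False mn by auto
      then show ?thesis using a by (auto simp: lex_minimal_base_def)
    qed
  qed auto
qed

end


section \<open>Direct sums of interval modules\<close>

abbreviation interval_sum :: "nat \<Rightarrow> (nat \<Rightarrow> ennreal) \<Rightarrow> ('f::field, nat \<Rightarrow> 'f) persistence" where
  "interval_sum n b \<equiv> direct_sum_persistence {1..n} (\<lambda>i. interval_persistence (b i))"

lemma level_interval_sum:
  assumes "0 < r"
  shows "carrier (level (interval_sum n b :: ('f::field, nat \<Rightarrow> 'f) persistence) r) =
      (\<Pi>\<^sub>E i\<in>{1..n}. if ennreal r \<le> b i then UNIV else {0})"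
    "\<zero>\<^bsub>level (interval_sum n b :: ('f::field, nat \<Rightarrow> 'f) persistence) r\<^esub> = (\<lambda>i\<in>{1..n}. 0)"
    "x \<oplus>\<^bsub>level (interval_sum n b :: ('f::field, nat \<Rightarrow> 'f) persistence) r\<^esub> y = (\<lambda>i\<in>{1..n}. x i + y i)"
    "k \<odot>\<^bsub>level (interval_sum n b :: ('f::field, nat \<Rightarrow> 'f) persistence) r\<^esub> x = (\<lambda>i\<in>{1..n}. k * x i)"
proof -
  let ?M = "\<lambda>i. level (interval_persistence (b i) :: ('f, 'f) persistence) r"
  have M: "carrier (?M i) = (if ennreal r \<le> b i then UNIV else {0})" "\<zero>\<^bsub>?M i\<^esub> = 0"
    "u \<oplus>\<^bsub>?M i\<^esub> v = u + v" "k \<odot>\<^bsub>?M i\<^esub> u = k * u" for i u v k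
    using assms by (simp_all add: interval_persistence_def field_module_def)
  have L: "level (interval_sum n b) r = direct_sum_module {1..n} ?M"
    by (simp add: direct_sum_persistence_def)
  show "carrier (level (interval_sum n b :: ('f::field, nat \<Rightarrow> 'f) persistence) r) =
      (\<Pi>\<^sub>E i\<in>{1..n}. if ennreal r \<le> b i then UNIV else {0})"
    unfolding L by (simp only: direct_sum_module_def partial_object.simps M) auto
  show "\<zero>\<^bsub>level (interval_sum n b :: ('f::field, nat \<Rightarrow> 'f) persistence) r\<^esub> = (\<lambda>i\<in>{1..n}. 0)"
    "x \<oplus>\<^bsub>level (interval_sum n b :: ('f::field, nat \<Rightarrow> 'f) persistence) r\<^esub> y = (\<lambda>i\<in>{1..n}. x i + y i)"
    "k \<odot>\<^bsub>level (interval_sum n b :: ('f::field, nat \<Rightarrow> 'f) persistence) r\<^esub> x = (\<lambda>i\<in>{1..n}. k * x i)"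
    unfolding L by (simp_all add: direct_sum_module_def M)
qed

context coordinates
begin

text \<open>The map \<open>?L\<close> taking unit vectors to the coordinate vectors of the base is
  bijective, since \<open>n\<close> vectors spanning \<open>n\<close>-space are independent. The
  adapted coordinates are \<theta> followed by its inverse.\<close>

lemma adapted_coordinates_exist:
  assumes a: "homology_base TYPE('f) X n a"
  obtains \<theta>' :: "('a, 'f) schain \<Rightarrow> (nat \<Rightarrow>\<^sub>0 'f)"
  where "homology_coordinates X n \<theta>'" "\<And>i. i \<in> {1..n} \<Longrightarrow> \<theta>' (path_chain (a i)) = single i 1"
proof -
  let ?v = "\<lambda>i. loop_vec (a i)"
  let ?L = "lin_ext chain_scale ?v"
  have sa: "sorted_loops X n a" and span: "chains.span (?v ` {1..n}) = E"
    using a by (auto simp: homology_base_iff)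
  have im: "?L ` E = E" using lin_ext_image_supported[of ?v "{1..n}"] span by simp
  have inj: "inj_on ?L E" by (rule lin_ext_inj_on_supported[OF _ span]) simp
  have E: "chains.subspace E" by (rule subspace_supported)
  note E_sub = chain_subspaceD[OF E]
  define \<theta>' where "\<theta>' z = the_inv_into E ?L (\<theta> z)" for z
  have \<theta>'_E: "\<theta>' z \<in> E" and L\<theta>': "?L (\<theta>' z) = \<theta> z" if "z \<in> Z" for z
  proof -
    have "\<theta> z \<in> ?L ` E" using \<theta>_in_E[OF that] unfolding im .
    then show "\<theta>' z \<in> E" "?L (\<theta>' z) = \<theta> z"
      unfolding \<theta>'_def using the_inv_into_into[OF inj _ order_refl] f_the_inv_into_f[OF inj] by blast+
  qed
  have \<theta>'_eqI: "\<theta>' z = e" if "z \<in> Z" "e \<in> E" "?L e = \<theta> z" for z e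
    using inj_onD[OF inj, of "\<theta>' z" e] L\<theta>'[OF that(1)] \<theta>'_E[OF that(1)] that by metis
  have "homology_coordinates X n \<theta>'"
    unfolding homology_coordinates_def
  proof (intro conjI ballI allI)
    show "\<theta>' (x + y) = \<theta>' x + \<theta>' y" if xy: "x \<in> Z" "y \<in> Z" for x y
      by (intro \<theta>'_eqI Z_sub(2) E_sub(2) \<theta>'_E xy) (simp only: chains.lin_ext_add L\<theta>' \<theta>_add xy)
    show "\<theta>' (chain_scale k x) = chain_scale k (\<theta>' x)" if x: "x \<in> Z" for k x
      by (intro \<theta>'_eqI Z_sub(4) E_sub(4) \<theta>'_E x) (simp only: chains.lin_ext_scale L\<theta>' \<theta>_scale x)
    show "\<theta>' z = 0 \<longleftrightarrow> z \<in> B" if z: "z \<in> Z" for z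
      using \<theta>'_eqI[OF z E_sub(1)] L\<theta>'[OF z] \<theta>_eq_0[OF z] by auto
    show "\<theta>' ` Z = E"
    proof
      show "\<theta>' ` Z \<subseteq> E" using \<theta>'_E by blast
      show "E \<subseteq> \<theta>' ` Z"
      proof
        fix e assume e: "e \<in> E"
        then have "?L e \<in> \<theta> ` Z" using im \<theta>_image by blast
        then obtain z where "z \<in> Z" "?L e = \<theta> z" by blast
        then show "e \<in> \<theta>' ` Z" using \<theta>'_eqI[of z e] e by blast
      qed
    qed
  qed
  moreover have "\<theta>' (path_chain (a i)) = single i 1" if "i \<in> {1..n}" for i
    using that sorted_loopsD(1)[OF sa, of i] by (intro \<theta>'_eqI path_chain_in_Z) auto
  ultimately show thesis by (rule that)
qed

text \<open>In adapted coordinates the span of the first \<open>num_below n a r\<close> loops is a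
  coordinate subspace, and the interval of index \<open>i\<close> is alive at \<open>r\<close>
  exactly when \<open>i\<close> exceeds \<open>num_below n a r\<close>. The projection onto the
  living coordinates therefore has the required kernel.\<close>

lemma presents_interval_sum:
  assumes a: "sorted_loops X n a" and v: "\<And>i. i \<in> {1..n} \<Longrightarrow> loop_vec (a i) = single i 1"
  shows "presents_persistence Z (\<lambda>r. preimage (base_space a r))
    (interval_sum n (\<lambda>i. path_length (a i) / 3) :: ('f, nat \<Rightarrow> 'f) persistence)
    (\<lambda>r z. \<lambda>i\<in>{1..n}. if ennreal r \<le> path_length (a i) / 3 then lookup (\<theta> z) i else 0)"
    (is "presents_persistence Z ?K ?P ?q")
  unfolding presents_persistence_def
proof (intro conjI allI impI ballI)
  let ?b = "\<lambda>i. path_length (a i) / 3"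
  fix r :: real assume r: "0 < r"
  note level = level_interval_sum[OF r, of n ?b, where 'f = 'f]
  let ?k = "num_below n a r"
  have k: "ennreal r \<le> ?b i \<longleftrightarrow> \<not> i \<le> ?k" if "1 \<le> i" "i \<le> n" for i
    using le_num_below_iff[OF a that, of r] by (simp add: not_less)
  have "(\<lambda>i. loop_vec (a i)) ` {1..?k} = (\<lambda>i. single i 1) ` {1..?k}"
    using num_below_le[of n a r] by (intro image_cong refl v) auto
  then have base: "base_space a r = {e. keys e \<subseteq> {1..?k}}"
    by (simp only: supported_eq_span)
  show "presents Z (?K r) (level ?P r) (?q r)"
    unfolding presents_def
  proof (intro conjI ballI allI)
    show "chains.subspace Z" by (rule presentsD(1)[OF presents_H])
    show "chains.subspace (?K r)" by (rule subspace_preimage[OF chains.subspace_span])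
    show "?q r ` Z = carrier (level ?P r)"
    proof
      show "?q r ` Z \<subseteq> carrier (level ?P r)" unfolding level(1) by auto
      show "carrier (level ?P r) \<subseteq> ?q r ` Z"
      proof
        fix x assume x: "x \<in> carrier (level ?P r)"
        define e where "e = (\<Sum>i\<in>{1..n}. single i (x i))"
        have e: "lookup e i = (if i \<in> {1..n} then x i else 0)" for i
          by (simp add: e_def lookup_sum lookup_single when_def)
        then have "e \<in> E" by (auto simp: in_keys_iff split: if_splits)
        then obtain z where z: "z \<in> Z" "e = \<theta> z" unfolding \<theta>_image[symmetric] by blast
        have "x = ?q r z"
          using x unfolding level(1) z(2)[symmetric]
          by (intro extensionalityI[where A = "{1..n}"]) (auto simp: e PiE_def Pi_def split: if_splits)
        then show "x \<in> ?q r ` Z" using z(1) by blast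
      qed
    qed
    show "?q r 0 = \<zero>\<^bsub>level ?P r\<^esub>" unfolding level(2) by (auto simp: \<theta>_0)
    fix x y assume xy: "x \<in> Z" "y \<in> Z"
    show "?q r (x + y) = ?q r x \<oplus>\<^bsub>level ?P r\<^esub> ?q r y"
      unfolding level(3) by (rule restrict_ext) (simp add: \<theta>_add[OF xy] lookup_add)
    have "x - y \<in> ?K r \<longleftrightarrow> (\<forall>i. lookup (\<theta> x - \<theta> y) i \<noteq> 0 \<longrightarrow> i \<in> {1..?k})"
      unfolding base preimage_def using Z_sub(3)[OF xy] by (auto simp: \<theta>_diff[OF xy] in_keys_iff)
    also have "\<dots> \<longleftrightarrow> (\<forall>i\<in>{1..n}. ennreal r \<le> ?b i \<longrightarrow> lookup (\<theta> x) i = lookup (\<theta> y) i)"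
    proof -
      have "\<theta> x - \<theta> y \<in> E" using \<theta>_in_E[OF Z_sub(3)[OF xy]] by (simp add: \<theta>_diff[OF xy])
      then have out: "lookup (\<theta> x - \<theta> y) i = 0" if "i \<notin> {1..n}" for i
        using that by (auto simp: in_keys_iff)
      show ?thesis
      proof safe
        fix i assume *: "\<forall>i. lookup (\<theta> x - \<theta> y) i \<noteq> 0 \<longrightarrow> i \<in> {1..?k}"
          and i: "i \<in> {1..n}" "ennreal r \<le> ?b i"
        then have "\<not> i \<le> ?k" using k[of i] by simp
        then have "lookup (\<theta> x - \<theta> y) i = 0" using * by fastforce
        then show "lookup (\<theta> x) i = lookup (\<theta> y) i" by (simp add: lookup_minus)
      next
        fix i assume *: "\<forall>i\<in>{1..n}. ennreal r \<le> ?b i \<longrightarrow> lookup (\<theta> x) i = lookup (\<theta> y) i"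
          and i: "lookup (\<theta> x - \<theta> y) i \<noteq> 0"
        have "i \<in> {1..n}" using out i by blast
        moreover from this have "\<not> ennreal r \<le> ?b i" using * i by (auto simp: lookup_minus)
        ultimately show "i \<in> {1..?k}" using k[of i] by simp
      qed
    qed
    also have "\<dots> \<longleftrightarrow> ?q r x = ?q r y"
      by (auto simp: fun_eq_iff restrict_def)
    finally show "?q r x = ?q r y \<longleftrightarrow> x - y \<in> ?K r" ..
  next
    fix k x assume x: "x \<in> Z"
    show "?q r (chain_scale k x) = k \<odot>\<^bsub>level ?P r\<^esub> ?q r x"
      unfolding level(4) by (rule restrict_ext) (simp add: \<theta>_scale[OF x])
  qed
  fix s z assume rs: "r \<le> s" and z: "z \<in> Z"
  have "ennreal r \<le> ?b i" if "ennreal s \<le> ?b i" for i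
    using ennreal_leI[OF rs] that by (rule order.trans)
  then show "bond ?P r s (?q r z) = ?q s z"
    using r rs by (auto simp: direct_sum_persistence_def interval_persistence_def intro!: restrict_ext)
qed

end


section \<open>Large scales\<close>

text \<open>Coning from a point \<open>p\<close>: the points \<open>p\<close>, \<open>x\<close>,
  \<open>y\<close> span a simplex, so modulo boundaries the edge from \<open>x\<close> to
  \<open>y\<close> is the edge from \<open>p\<close> to \<open>y\<close> minus the edge from
  \<open>p\<close> to \<open>x\<close>. By linearity every chain agrees with the cone
  \<open>S\<close> over its boundary, which is 0 for a cycle.\<close>

lemma Rips_cycles_bound_at_large_scale:
  assumes X: "\<And>x y. x \<in> X \<Longrightarrow> y \<in> X \<Longrightarrow> dist x y < r"
  shows "oriented_cycles 1 (Rips X r) \<subseteq> (oriented_boundaries 1 (Rips X r) :: ('a::metric_space list \<Rightarrow>\<^sub>0 'f::field) set)"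
proof
  let ?B = "oriented_boundaries 1 (Rips X r) :: ('a list \<Rightarrow>\<^sub>0 'f) set"
  have "chains.subspace ?B" by (rule subspace_oriented_boundaries)
  note B = chain_subspaceD[OF this]
  fix c :: "'a list \<Rightarrow>\<^sub>0 'f" assume "c \<in> oriented_cycles 1 (Rips X r)"
  then have c: "c \<in> oriented_chains 1 (Rips X r)" "oriented_bd 1 c = 0" by (auto simp: oriented_cycles_def)
  show "c \<in> ?B"
  proof (cases "X = {}")
    case True
    then have "Rips X r = {}" by (auto simp: Rips_def)
    then have "oriented_chains 1 (Rips X r) = ({0} :: ('a list \<Rightarrow>\<^sub>0 'f) set)"
      unfolding oriented_chains_1_eq_span by simp
    then show ?thesis using c(1) B(1) by simp
  next
    case False
    then obtain p where p: "p \<in> X" by blast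
    then have r: "0 < r" using X[of p p] by simp
    define S where "S d = lin_ext chain_scale (\<lambda>xs. edge p (hd xs)) d" for d :: "'a list \<Rightarrow>\<^sub>0 'f"
    have "c - S (oriented_bd 1 c) \<in> ?B"
      using c(1)
    proof (induction c rule: oriented_chains_1_induct)
      case (edge x y)
      then have "x \<in> X" "y \<in> X" by (auto simp: edge_in_Rips)
      then have "edge x y + edge y p + edge p x \<in> ?B"
        using X p r by (intro triangle_in_oriented_boundaries) (auto simp: triangle_in_Rips)
      moreover have "S (oriented_bd 1 (edge x y)) = edge p y - edge p x"
        unfolding oriented_bd_edge by (simp add: S_def chains.lin_ext_diff)
      then have "edge x y - S (oriented_bd 1 (edge x y)) = edge x y + edge y p + edge p x"
        unfolding edge_swap[of y p] by (simp only:) (simp add: algebra_simps)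
      ultimately show ?case by (simp only:)
    next
      case (add c d)
      have "(c - S (oriented_bd 1 c)) + (d - S (oriented_bd 1 d)) \<in> ?B" by (rule B(2)[OF add])
      then show ?case by (simp add: oriented_bd_add S_def chains.lin_ext_add algebra_simps)
    next
      case (scale k c)
      have "chain_scale k (c - S (oriented_bd 1 c)) \<in> ?B" by (rule B(4)[OF scale])
      then show ?case by (simp add: oriented_bd_scale S_def chains.lin_ext_scale chains.scale_right_diff_distrib)
    next
      case zero
      then show ?case using B(1) by (simp add: S_def)
    qed
    then show ?thesis by (simp add: c(2)[simplified] S_def)
  qed
qed

lemma linear_iso_trans:
  assumes h: "linear_iso M N h" and g: "linear_iso N P g"
  shows "linear_iso M P (g \<circ> h)"
proof -
  have "h x \<in> carrier N" if "x \<in> carrier M" for x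
    using h that unfolding linear_iso_def bij_betw_def by blast
  then show ?thesis
    using h g bij_betw_trans[of h "carrier M" "carrier N" g "carrier P"] by (simp add: linear_iso_def)
qed

lemma bij_betw_subsingleton:
  assumes "bij_betw f A B" "\<And>x y. x \<in> A \<Longrightarrow> y \<in> A \<Longrightarrow> x = y" "u \<in> B" "v \<in> B"
  shows "u = v"
  using assms unfolding bij_betw_def by (metis imageE)

lemma Rips_homology_trivial_at_large_scale:
  assumes "\<And>x y. x \<in> X \<Longrightarrow> y \<in> X \<Longrightarrow> dist x y < r"
    and "u \<in> carrier (complex_homology 1 (Rips X r))" "v \<in> carrier (complex_homology 1 (Rips X r))"
  shows "u = v"
proof -
  note D = presentsD[OF presents_Rips_homology[of X r]]
  obtain c d where "c \<in> oriented_cycles 1 (Rips X r)" "d \<in> oriented_cycles 1 (Rips X r)"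
    "u = oriented_boundaries 1 (Rips X r) +>\<^bsub>chain_module\<^esub> c" "v = oriented_boundaries 1 (Rips X r) +>\<^bsub>chain_module\<^esub> d"
    using assms(2,3) unfolding D(3)[symmetric] by blast
  moreover from this have "c - d \<in> oriented_boundaries 1 (Rips X r)"
    using Rips_cycles_bound_at_large_scale[OF assms(1)] chain_subspaceD(3)[OF D(1)] by blast
  ultimately show ?thesis using D(7) by blast
qed


section \<open>Isomorphic persistences determine the minimal length vector\<close>

context coordinates
begin

text \<open>The scale exceeds all distances, so Rips homology and with it the other two levels
  vanish. A vanishing interval sum means that every third of a length is below \<open>r\<close>;
  hence all loops are divided out in the quotient, and its vanishing says that they
  generate.\<close>

lemma homology_base_if_isomorphic:
  assumes a: "sorted_loops X n a" and r: "0 < r" "\<And>x y. x \<in> X \<Longrightarrow> y \<in> X \<Longrightarrow> dist x y < r"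
    and RQ: "linear_iso (complex_homology 1 (Rips X r) :: ('f, _) module) (level (quotient_persistence X n a) r) h"
    and QD: "linear_iso (level (quotient_persistence X n a) r)
      (level (interval_sum n (\<lambda>i. path_length (a i) / 3) :: ('f, _) persistence) r) g"
  shows "homology_base TYPE('f) X n a" "i \<in> {1..n} \<Longrightarrow> path_length (a i) / 3 < ennreal r"
proof -
  let ?Q = "level (quotient_persistence X n a) r :: ('f, ('a, 'f) schain set set) module"
  let ?D = "level (interval_sum n (\<lambda>i. path_length (a i) / 3) :: ('f, _) persistence) r"
  have bij: "bij_betw h (carrier (complex_homology 1 (Rips X r))) (carrier ?Q)" "bij_betw g (carrier ?Q) (carrier ?D)"
    using RQ QD unfolding linear_iso_def by blast+
  have Q: "u = v" if "u \<in> carrier ?Q" "v \<in> carrier ?Q" for u v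
    by (rule bij_betw_subsingleton[OF bij(1) Rips_homology_trivial_at_large_scale[OF r(2)] that])
  have D: "u = v" if "u \<in> carrier ?D" "v \<in> carrier ?D" for u v
    by (rule bij_betw_subsingleton[OF bij(2) Q that])
  show third: "path_length (a i) / 3 < ennreal r" if i: "i \<in> {1..n}" for i
  proof (rule ccontr)
    assume "\<not> path_length (a i) / 3 < ennreal r"
    then have "(\<lambda>j\<in>{1..n}. if j = i then 1 else 0) \<in> carrier ?D" "(\<lambda>j\<in>{1..n}. 0) \<in> carrier ?D"
      unfolding level_interval_sum[OF r(1)] by (auto simp: not_less)
    from fun_cong[OF D[OF this], of i] show False using i by simp
  qed
  have "num_below n a r = n"
    using le_num_below_iff[OF a, of n r] third[of n] num_below_le[of n a r] by (cases "n = 0") auto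
  then have P: "presents Z (preimage (chains.span ((\<lambda>i. loop_vec (a i)) ` {1..n}))) ?Q
      (\<lambda>z. homology_class X ` preimage (base_space a r) +>\<^bsub>H\<^esub> homology_class X z)"
    using presents_persistenceD(1)[OF presents_quotient_persistence[OF a] r(1)] by simp
  have "Z \<subseteq> preimage (chains.span ((\<lambda>i. loop_vec (a i)) ` {1..n}))"
  proof
    fix z assume z: "z \<in> Z"
    show "z \<in> preimage (chains.span ((\<lambda>i. loop_vec (a i)) ` {1..n}))"
      using presentsD(7)[OF P z Z_sub(1)] Q[OF presentsD(8)[OF P z] presentsD(8)[OF P Z_sub(1)]] by simp
  qed
  then have "E \<subseteq> chains.span ((\<lambda>i. loop_vec (a i)) ` {1..n})"
    unfolding \<theta>_image[symmetric] by (auto simp: preimage_def)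
  moreover have "chains.span ((\<lambda>i. loop_vec (a i)) ` {1..n}) \<subseteq> E"
  proof (intro chains.span_minimal subspace_supported image_subsetI)
    fix i assume "i \<in> {1..n}"
    then show "loop_vec (a i) \<in> E" using \<theta>_in_E[OF path_chain_in_Z] sorted_loopsD(1)[OF a, of i] by simp
  qed
  ultimately show "homology_base TYPE('f) X n a" using a by (simp add: homology_base_iff)
qed

lemma length_vector_nth: "k < n \<Longrightarrow> length_vector n b ! k = path_length (b (Suc k))"
  by (simp add: length_vector_def del: upt_Suc)

lemma length_length_vector: "length (length_vector n b) = n"
  by (simp add: length_vector_def)

text \<open>
  If \<open>b\<close> is smaller than \<open>a\<close> at the first difference \<open>j\<close>, then at scale \<open>length (a j) / 3\<close> the classes
  of \<open>b 1, \<dots>, b j\<close> have died but \<open>n - j + 1\<close> intervals of the direct sum are still alive.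
\<close>

lemma not_lexordp_if_isomorphic:
  assumes a: "sorted_loops X n a" and fin: "\<And>i. i \<in> {1..n} \<Longrightarrow> path_length (a i) < \<infinity>"
    and M: "\<And>r. 0 < r \<Longrightarrow> presents Z (short_cycles X r) (M r) (q r)"
    and iso: "\<And>r. 0 < r \<Longrightarrow> linear_iso (M r)
      (level (interval_sum n (\<lambda>i. path_length (a i) / 3) :: ('f, _) persistence) r) (h r)"
    and b: "homology_base TYPE('f) X n b"
  shows "\<not> ord_class.lexordp (length_vector n b) (length_vector n a)"
proof
  assume lex: "ord_class.lexordp (length_vector n b) (length_vector n a)"
  have "\<not> (\<exists>x vs. length_vector n a = length_vector n b @ x # vs)"
  proof clarify
    fix x vs assume "length_vector n a = length_vector n b @ x # vs"
    from arg_cong[OF this, of length] show False by (simp add: length_length_vector)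
  qed
  with lex obtain us u v vs ws where us: "u < v" "length_vector n b = us @ u # vs" "length_vector n a = us @ v # ws"
    unfolding lexordp_iff by blast
  define j where "j = Suc (length us)"
  have jn: "j \<le> n" using arg_cong[OF us(2), of length] by (simp add: length_length_vector j_def)
  then have lt: "path_length (b j) < path_length (a j)"
    using us length_vector_nth[of "length us" b] length_vector_nth[of "length us" a] by (simp add: j_def)
  have j1: "1 \<le> j" by (simp add: j_def)
  obtain l where l: "path_length (a j) = ennreal l" "0 \<le> l"
    using fin[of j] jn j1 by (cases "path_length (a j)") auto
  have sb: "sorted_loops X n b" and span_b: "chains.span ((\<lambda>i. loop_vec (b i)) ` {1..n}) = E"
    using b by (auto simp: homology_base_iff)
  \<comment> \<open>The intervals are closed on the right, so the one of \<open>a j\<close> is still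
    alive at this scale, while \<open>b j\<close>, being strictly shorter, is already a short
    cycle.\<close>
  define r where "r = l / 3"
  have "l > 0" using lt l by (cases "l = 0") auto
  then have r: "0 < r" by (simp add: r_def)
  have b_short: "path_chain (b i) \<in> short_cycles X r" if "1 \<le> i" "i \<le> j" for i
  proof (rule short_loop_in_short_cycles)
    show "loop_in X (b i)" using sorted_loopsD(1)[OF sb] that jn by simp
    have "path_length (b i) \<le> path_length (b j)" using sorted_loopsD(2)[OF sb that jn] .
    then show "path_length (b i) < ennreal (3 * r)" using lt l by (simp add: r_def)
  qed
  have alive: "ennreal r \<le> path_length (a i) / 3" if "j \<le> i" "i \<le> n" for i
  proof -
    have "ennreal r = path_length (a j) / 3" using l divide_ennreal[of l 3] by (simp add: r_def)
    also have "\<dots> \<le> path_length (a i) / 3"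
      using sorted_loopsD(2)[OF a j1 that] by (rule divide_right_mono_ennreal)
    finally show ?thesis .
  qed
  note level = level_interval_sum[OF r, of n "\<lambda>i. path_length (a i) / 3", where 'f = 'f]
  note P = presentsD[OF M[OF r]]
  let ?D = "level (interval_sum n (\<lambda>i. path_length (a i) / 3) :: ('f, _) persistence) r"
  define F where "F z = h r (q r z)" for z
  have F_add: "F (x + y) = (\<lambda>i\<in>{1..n}. F x i + F y i)" if "x \<in> Z" "y \<in> Z" for x y
    using iso[OF r] P(5)[OF that] P(8) that unfolding linear_iso_def F_def level(3) by simp
  have F_scale: "F (chain_scale k x) = (\<lambda>i\<in>{1..n}. k * F x i)" if "x \<in> Z" for k x
    using iso[OF r] P(6)[OF that] P(8) that unfolding linear_iso_def F_def level(4) by simp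
  have F_im: "F ` Z = carrier ?D"
    using iso[OF r] P(3) unfolding linear_iso_def bij_betw_def F_def by (metis image_image)
  \<comment> \<open>Only the coordinates \<open>j..n\<close> are kept: their intervals are alive at
    \<open>r\<close>, so \<open>f\<close> maps \<open>Z\<close> onto all vectors supported there,
    and it kills the short cycles.\<close>
  define f where "f z = (\<Sum>i\<in>{j..n}. single i (F z i))" for z
  have f: "lookup (f z) i = (if i \<in> {j..n} then F z i else 0)" for z i
    by (simp add: f_def lookup_sum lookup_single when_def)
  have f_add: "f (x + y) = f x + f y" if "x \<in> Z" "y \<in> Z" for x y
    by (rule poly_mapping_eqI) (use j1 in \<open>simp add: f lookup_add F_add[OF that]\<close>)
  have f_scale: "f (chain_scale k x) = chain_scale k (f x)" if "x \<in> Z" for k x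
    by (rule poly_mapping_eqI) (use j1 in \<open>simp add: f F_scale[OF that]\<close>)
  have f_short: "f x = 0" if "x \<in> short_cycles X r" for x
  proof -
    have xZ: "x \<in> Z" using that short_cycles_subset_cycles by blast
    have "q r x = q r 0" using P(7)[OF xZ Z_sub(1)] that by simp
    then have "F x = F (chain_scale 0 x)" by (simp add: F_def)
    then have "f x = f (chain_scale 0 x)" by (simp add: f_def)
    then show ?thesis using f_scale[OF xZ, of 0] by simp
  qed
  \<comment> \<open>Among the images of \<open>b 1, ..., b n\<close> only the last
    \<open>n - j\<close> can be nonzero, too few to span \<open>n - j + 1\<close>
    coordinates.\<close>
  let ?T = "(\<lambda>i. f (path_chain (b i))) ` {Suc j..n}"
  let ?W = "{z \<in> Z. f z \<in> chains.span ?T}"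
  have W: "chains.subspace ?W"
  proof (rule chains.subspaceI)
    have "f 0 = 0" using f_short chain_subspaceD(1)[OF subspace_short_cycles] by blast
    then show "0 \<in> ?W" using Z_sub(1) by (simp add: chains.span_zero)
    show "x + y \<in> ?W" if "x \<in> ?W" "y \<in> ?W" for x y
      using that Z_sub(2) by (simp add: f_add chains.span_add)
    show "chain_scale c x \<in> ?W" if "x \<in> ?W" for c x
      using that Z_sub(4) by (simp add: f_scale chains.span_scale)
  qed
  let ?S = "(\<lambda>i. path_chain (b i)) ` {1..n} :: ('a, 'f) schain set"
  have S: "?S \<subseteq> Z" using sorted_loopsD(1)[OF sb] path_chain_in_Z by auto
  have "?S \<subseteq> ?W"
  proof (rule image_subsetI)
    fix i assume i: "i \<in> {1..n}"
    have "f (path_chain (b i)) \<in> chains.span ?T"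
    proof (cases "i \<le> j")
      case True
      then show ?thesis using f_short[OF b_short] i by (simp add: chains.span_zero)
    next
      case False
      then show ?thesis using i by (intro chains.span_base) auto
    qed
    then show "path_chain (b i) \<in> ?W" using i S by auto
  qed
  then have span_W: "chains.span ?S \<subseteq> ?W" by (intro chains.span_minimal W)
  have B_W: "B \<subseteq> ?W"
    using B_subset_Z boundaries_subset_short_cycles f_short chains.span_zero by fastforce
  have "Z \<subseteq> preimage (chains.span (\<theta> ` ?S))"
    using \<theta>_in_E span_b by (auto simp: preimage_def image_image)
  also have "\<dots> \<subseteq> ?W"
    unfolding preimage_span[OF S] using span_W B_W chain_subspaceD(2)[OF W] by blast
  finally have ZW: "Z \<subseteq> ?W" .
  have "{e :: nat \<Rightarrow>\<^sub>0 'f. keys e \<subseteq> {j..n}} \<subseteq> chains.span ?T"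
  proof clarify
    fix e :: "nat \<Rightarrow>\<^sub>0 'f" assume e: "keys e \<subseteq> {j..n}"
    have e0: "lookup e i = 0" if "i \<notin> {j..n}" for i using e that by (auto simp: in_keys_iff)
    have "restrict (lookup e) {1..n} \<in> carrier ?D"
      unfolding level(1)
    proof (rule restrict_PiE_iff[THEN iffD2], rule ballI)
      fix i assume "i \<in> {1..n}"
      then show "lookup e i \<in> (if ennreal r \<le> path_length (a i) / 3 then UNIV else {0})"
        using alive[of i] e0[of i] by auto
    qed
    then obtain z where z: "z \<in> Z" "F z = restrict (lookup e) {1..n}"
      unfolding F_im[symmetric] by force
    have "f z = e"
    proof (rule poly_mapping_eqI)
      fix i show "lookup (f z) i = lookup e i"
        unfolding f z(2) using j1 e0[of i] by simp
    qed
    then show "e \<in> chains.span ?T" using ZW z(1) by blast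
  qed
  then have "card {j..n} \<le> card ?T" by (intro card_le_if_spanning) auto
  also have "\<dots> \<le> card {Suc j..n}" by (intro card_image_le) auto
  finally show False using jn by simp
qed

end


section \<open>Critical values\<close>

context coordinates
begin

text \<open>A loop of length 0 is constant and bounds, so its class cannot belong to a base.
  Critical values are positive by definition, so the lengths have to be positive as well.\<close>

lemma path_length_positive:
  assumes a: "homology_base TYPE('f) X n a" and i: "i \<in> {1..n}"
  shows "path_length (a i) \<noteq> 0"
proof
  assume 0: "path_length (a i) = 0"
  have loop: "loop_in X (a i)" using a i sorted_loopsD(1)[of X n a i] by (simp add: homology_base_iff)
  have "a i s = a i 0" if "s \<in> {0..1}" for s
    using dist_le_path_length[OF that, of 0 "a i"] 0 by simp
  then have "path_simplex (a i) = path_simplex (\<lambda>_. a i 0)" by (rule path_simplex_cong)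
  moreover have "a i 0 \<in> X" using loop by (auto simp: loop_in_def path_image_def)
  then have "path_chain (\<lambda>_. a i 0) \<in> B" by (rule const_path_chain_boundary)
  ultimately have "path_chain (a i) \<in> B" by simp
  then have "loop_vec (a i) = 0" using \<theta>_eq_0[OF path_chain_in_Z[OF loop]] by blast
  then show False
    using homology_base_independent[OF a i] chains.span_zero by metis
qed

text \<open>The bonding map from \<open>r\<close> to \<open>s\<close> is an isomorphism iff no third
  of a length lies in \<open>[r, s)\<close>. As the intervals are closed on the right, the kernel
  changes immediately after each third of a length, which the second alternative in
  \<open>critical_value\<close> detects.\<close>

lemma critical_values:
  fixes P :: "('f, 'v) persistence"
  assumes P: "presents_persistence Z (\<lambda>r. short_cycles X r) P \<rho>" and lex: "lex_minimal_base TYPE('f) X n a"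
    and fin: "\<And>i. i \<in> {1..n} \<Longrightarrow> path_length (a i) < \<infinity>"
  shows "{ennreal p |p. critical_value P p} = (\<lambda>i. path_length (a i) / 3) ` {1..n}"
proof -
  have base: "homology_base TYPE('f) X n a" using lex by (simp add: lex_minimal_base_def)
  then have sa: "sorted_loops X n a" by (simp add: homology_base_iff)
  have "\<exists>x>0. path_length (a i) / 3 = ennreal x" if i: "i \<in> {1..n}" for i
  proof (cases "path_length (a i)")
    case (real x)
    moreover have "x \<noteq> 0" using path_length_positive[OF base i] real by auto
    ultimately show ?thesis using divide_ennreal[of x 3] by (intro exI[of _ "x / 3"]) auto
  next
    case top then show ?thesis using fin[OF i] by simp
  qed
  then obtain \<beta> where \<beta>: "\<And>i. i \<in> {1..n} \<Longrightarrow> \<beta> i > 0" "\<And>i. i \<in> {1..n} \<Longrightarrow> path_length (a i) / 3 = ennreal (\<beta> i)"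
    by metis
  have nb: "i \<le> num_below n a r \<longleftrightarrow> \<beta> i < r" if "i \<in> {1..n}" "0 < r" for i r
    using le_num_below_iff[OF sa, of i r] that \<beta>[OF that(1)] by (simp add: ennreal_less_iff)
  have bond: "bond_iso P r s \<longleftrightarrow> (\<forall>i\<in>{1..n}. \<beta> i < s \<longrightarrow> \<beta> i < r)" if rs: "0 < r" "r \<le> s" for r s
  proof -
    have s: "0 < s" using rs by simp
    have "bond_iso P r s \<longleftrightarrow> (short_cycles X r :: ('a, 'f) schain set) = short_cycles X s"
      by (rule bond_iso_presented[OF P rs short_cycles_mono[OF rs(2)] short_cycles_subset_cycles])
    also have "\<dots> \<longleftrightarrow> short_space r = short_space s"
      unfolding short_cycles_eq_preimage by (rule preimage_eq_iff[OF short_space_subset short_space_subset])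
    also have "\<dots> \<longleftrightarrow> num_below n a r = num_below n a s"
      unfolding lex_minimal_short_space[OF lex rs(1)] lex_minimal_short_space[OF lex s]
      by (rule base_space_eq_iff[OF base rs(2)])
    also have "\<dots> \<longleftrightarrow> (\<forall>i\<in>{1..n}. \<beta> i < s \<longrightarrow> \<beta> i < r)"
    proof
      assume "num_below n a r = num_below n a s"
      then show "\<forall>i\<in>{1..n}. \<beta> i < s \<longrightarrow> \<beta> i < r" using nb rs s by metis
    next
      assume *: "\<forall>i\<in>{1..n}. \<beta> i < s \<longrightarrow> \<beta> i < r"
      have "num_below n a s \<le> num_below n a r"
      proof (cases "num_below n a s = 0")
        case False
        then have i: "num_below n a s \<in> {1..n}" using num_below_le[of n a s] by simp
        then show ?thesis using * nb[OF i rs(1)] nb[OF i s] by simp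
      qed simp
      then show "num_below n a r = num_below n a s" using num_below_mono[OF sa rs(2)] by simp
    qed
    finally show ?thesis .
  qed
  have "critical_value P p \<longleftrightarrow> p \<in> \<beta> ` {1..n}" for p
  proof
    assume "p \<in> \<beta> ` {1..n}"
    then obtain i where i: "i \<in> {1..n}" "p = \<beta> i" by blast
    have "\<not> bond_iso P p (p + \<epsilon>)" if \<epsilon>: "\<epsilon> > 0" for \<epsilon>
    proof -
      have "bond_iso P p (p + \<epsilon>) \<longleftrightarrow> (\<forall>i\<in>{1..n}. \<beta> i < p + \<epsilon> \<longrightarrow> \<beta> i < p)"
        by (rule bond) (use \<epsilon> \<beta>(1)[OF i(1)] i(2) in auto)
      moreover have "\<beta> i < p + \<epsilon>" "\<not> \<beta> i < p" using \<epsilon> i(2) by simp_all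
      ultimately show ?thesis using i(1) by blast
    qed
    then show "critical_value P p" using \<beta>(1)[OF i(1)] i(2) by (simp add: critical_value_def)
  next
    assume crit: "critical_value P p"
    show "p \<in> \<beta> ` {1..n}"
    proof (rule ccontr)
      assume p: "p \<notin> \<beta> ` {1..n}"
      have p0: "p > 0" using crit by (simp add: critical_value_def)
      obtain d where d: "d > 0" "\<And>x. x \<in> \<beta> ` {1..n} \<Longrightarrow> x \<noteq> p \<Longrightarrow> d \<le> dist p x"
        using finite_set_avoid[of "\<beta> ` {1..n}" p] by auto
      have gap: "d \<le> \<bar>p - \<beta> i\<bar>" if "i \<in> {1..n}" for i
      proof -
        have "\<beta> i \<in> \<beta> ` {1..n}" using that by blast
        moreover from this have "\<beta> i \<noteq> p" using p by blast
        ultimately show ?thesis using d(2)[of "\<beta> i"] by (simp add: dist_real_def)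
      qed
      \<comment> \<open>Smaller than the distance from \<open>p\<close> to the nearest third of a
        length, and smaller than \<open>p\<close> so that \<open>p - \<epsilon>\<close> stays
        positive.\<close>
      define e where "e = min (d / 2) (p / 2)"
      have e: "0 < e" "e < d" "e < p" using d(1) p0 by (auto simp: e_def)
      have "bond_iso P p (p + e)"
        unfolding bond[OF p0 less_imp_le[OF less_add_same_cancel1[THEN iffD2, OF e(1)]]]
      proof clarify
        fix i assume i: "i \<in> {1..n}" "\<beta> i < p + e"
        show "\<beta> i < p" using gap[OF i(1)] i(2) e by linarith
      qed
      then have "\<forall>\<^sub>F \<epsilon> in at_right 0. \<not> bond_iso P (p - \<epsilon>) p"
        using crit e(1) by (auto simp: critical_value_def)
      then obtain t where t: "t > 0" "\<And>\<epsilon>. 0 < \<epsilon> \<Longrightarrow> \<epsilon> < t \<Longrightarrow> \<not> bond_iso P (p - \<epsilon>) p"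
        by (auto simp: eventually_at_right_field)
      define \<epsilon> where "\<epsilon> = min (t / 2) e"
      have \<epsilon>: "0 < \<epsilon>" "\<epsilon> < t" "\<epsilon> \<le> e" using t(1) e(1) by (auto simp: \<epsilon>_def)
      have "bond_iso P (p - \<epsilon>) p \<longleftrightarrow> (\<forall>i\<in>{1..n}. \<beta> i < p \<longrightarrow> \<beta> i < p - \<epsilon>)"
        by (rule bond) (use \<epsilon> e in linarith)+
      moreover have "\<beta> i < p - \<epsilon>" if i: "i \<in> {1..n}" "\<beta> i < p" for i
        using gap[OF i(1)] i(2) e \<epsilon> by linarith
      ultimately show False using t(2)[OF \<epsilon>(1,2)] by blast
    qed
  qed
  then have "{ennreal p |p. critical_value P p} = (\<lambda>i. ennreal (\<beta> i)) ` {1..n}" by auto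
  also have "\<dots> = (\<lambda>i. path_length (a i) / 3) ` {1..n}" by (rule image_cong) (simp_all add: \<beta>(2))
  finally show ?thesis .
qed

end

theorem theorem8p10:
  fixes X :: "'a::metric_space set" and n :: nat and a :: "nat \<Rightarrow> real \<Rightarrow> 'a"
  assumes "compact X" and "geodesic_space X"
    and "semi_locally_simply_connected TYPE('f::field) X"
    and "isomorphic_modules
           (singular_homology 1 (top_of_set X) :: ('f, ('a, 'f) schain set) module)
           (direct_sum_module {1..n} (\<lambda>i. field_module :: ('f, 'f) module))"
    and "\<And>i. i \<in> {1..n} \<Longrightarrow> loop_in X (a i)"
    and "\<And>i j. \<lbrakk>i \<in> {1..n}; j \<in> {1..n}; i < j\<rbrakk> \<Longrightarrow> path_length (a i) \<le> path_length (a j)"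
  shows "(lex_minimal_base TYPE('f) X n a \<longleftrightarrow>
            isomorphic_persistences
              (Rips_persistence X :: ('f, ('a list \<Rightarrow>\<^sub>0 'f) set) persistence)
              (quotient_persistence X n a :: ('f, ('a, 'f) schain set set) persistence) \<and>
            isomorphic_persistences
              (quotient_persistence X n a :: ('f, ('a, 'f) schain set set) persistence)
              (direct_sum_persistence {1..n}
                 (\<lambda>i. interval_persistence (path_length (a i) / 3) :: ('f, 'f) persistence))) \<and>
         (lex_minimal_base TYPE('f) X n a \<longrightarrow>
            {ennreal p |p. critical_value
                             (Rips_persistence X :: ('f, ('a list \<Rightarrow>\<^sub>0 'f) set) persistence) p} =
            (\<lambda>i. path_length (a i) / 3) ` {1..n})"
proof -
  let ?R = "Rips_persistence X :: ('f, ('a list \<Rightarrow>\<^sub>0 'f) set) persistence"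
  let ?Q = "quotient_persistence X n a :: ('f, ('a, 'f) schain set set) persistence"
  let ?D = "interval_sum n (\<lambda>i. path_length (a i) / 3) :: ('f, nat \<Rightarrow> 'f) persistence"
  obtain \<theta> :: "('a, 'f) schain \<Rightarrow> (nat \<Rightarrow>\<^sub>0 'f)" where "homology_coordinates X n \<theta>"
    by (rule homology_coordinates_exist[OF assms(4)])
  then interpret coordinates X n \<theta> by unfold_locales
  obtain \<rho> where \<rho>: "\<And>r. r > 0 \<Longrightarrow> presents Z (short_cycles X r) (complex_homology 1 (Rips X r)) (\<rho> r)"
    "\<And>r s z. 0 < r \<Longrightarrow> r \<le> s \<Longrightarrow> z \<in> Z \<Longrightarrow>
       coset_map chain_module (oriented_boundaries 1 (Rips X s)) (\<rho> r z) = \<rho> s z"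
    by (rule presents_Rips_homology_short_cycles[OF assms(1-3)]) (rule that)
  have PR: "presents_persistence Z (\<lambda>r. short_cycles X r) ?R \<rho>"
    using \<rho> by (simp add: presents_persistence_def Rips_persistence_def)
  have level_R: "level ?R r = complex_homology 1 (Rips X r)" for r
    by (simp add: Rips_persistence_def)
  have sa: "sorted_loops X n a" using assms(5,6) by (simp add: sorted_loops_def)
  \<comment> \<open>A scale that exceeds all distances in \<open>X\<close>, where Rips homology
    vanishes; adding 1 makes the bound strict and the scale positive.\<close>
  define d where "d = diameter X + 1"
  have bounded: "bounded X" using assms(1) by (rule compact_imp_bounded)
  have d: "0 < d" using diameter_ge_0[OF bounded] by (simp add: d_def)
  have dist_d: "dist x y < d" if "x \<in> X" "y \<in> X" for x y
    using diameter_bounded_bound[OF bounded that] by (simp add: d_def)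
  have iso: "isomorphic_persistences ?R ?Q" "isomorphic_persistences ?Q ?D"
    if lex: "lex_minimal_base TYPE('f) X n a"
  proof -
    have "presents_persistence Z (\<lambda>r. short_cycles X r) ?Q
        (\<lambda>r z. homology_class X ` preimage (base_space a r) +>\<^bsub>H\<^esub> homology_class X z)"
      by (rule presents_persistence_kernel_cong[OF presents_quotient_persistence[OF sa]])
        (simp only: short_cycles_eq_preimage lex_minimal_short_space[OF lex])
    then show "isomorphic_persistences ?R ?Q" by (rule isomorphic_persistences_presented[OF PR])
    obtain \<theta>' :: "('a, 'f) schain \<Rightarrow> (nat \<Rightarrow>\<^sub>0 'f)" where "homology_coordinates X n \<theta>'"
      and v: "\<And>i. i \<in> {1..n} \<Longrightarrow> \<theta>' (path_chain (a i)) = single i 1"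
      using adapted_coordinates_exist[of a] lex unfolding lex_minimal_base_def by metis
    \<comment> \<open>The kernels in the presentation of the quotients are written through
      coordinates, so this presentation is taken anew in the adapted ones; it presents the same
      persistence.\<close>
    then interpret adapted: coordinates X n \<theta>' by unfold_locales
    show "isomorphic_persistences ?Q ?D"
      by (rule isomorphic_persistences_presented[OF adapted.presents_quotient_persistence[OF sa]
            adapted.presents_interval_sum[OF sa v]])
  qed
  have base: "homology_base TYPE('f) X n a" "\<And>i. i \<in> {1..n} \<Longrightarrow> path_length (a i) < \<infinity>"
    if RQ: "isomorphic_persistences ?R ?Q" and QD: "isomorphic_persistences ?Q ?D"
  proof -
    obtain h where h: "\<And>r. r > 0 \<Longrightarrow> linear_iso (level ?R r) (level ?Q r) (h r)"
      using RQ unfolding isomorphic_persistences_def by blast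
    obtain g where g: "\<And>r. r > 0 \<Longrightarrow> linear_iso (level ?Q r) (level ?D r) (g r)"
      using QD unfolding isomorphic_persistences_def by blast
    note * = homology_base_if_isomorphic[OF sa d _ h[OF d, unfolded level_R] g[OF d]]
    show "homology_base TYPE('f) X n a" by (rule *(1)) (rule dist_d)
    show "path_length (a i) < \<infinity>" if "i \<in> {1..n}" for i
    proof -
      have "path_length (a i) / 3 < ennreal d" by (rule *(2)[OF dist_d that])
      then have "path_length (a i) < ennreal (3 * d)" using path_length_third_less[OF d] by blast
      also have "\<dots> < \<infinity>" by simp
      finally show ?thesis .
    qed
  qed
  \<comment> \<open>Minimality is tested on the composite with the interval sum: Rips homology can
    be compared with any other base \<open>b\<close>, whereas the quotients refer to
    \<open>a\<close> itself.\<close>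
  have "lex_minimal_base TYPE('f) X n a"
    if RQ: "isomorphic_persistences ?R ?Q" and QD: "isomorphic_persistences ?Q ?D"
  proof -
    obtain h where h: "\<And>r. r > 0 \<Longrightarrow> linear_iso (level ?R r) (level ?Q r) (h r)"
      using RQ unfolding isomorphic_persistences_def by blast
    obtain g where g: "\<And>r. r > 0 \<Longrightarrow> linear_iso (level ?Q r) (level ?D r) (g r)"
      using QD unfolding isomorphic_persistences_def by blast
    have "\<not> ord_class.lexordp (length_vector n b) (length_vector n a)" if "homology_base TYPE('f) X n b" for b
      by (rule not_lexordp_if_isomorphic[OF sa base(2)[OF RQ QD] presents_persistenceD(1)[OF PR]
            linear_iso_trans[OF h g] that])
    then show ?thesis using base(1)[OF RQ QD] by (simp add: lex_minimal_base_def)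
  qed
  moreover have "{ennreal p |p. critical_value ?R p} = (\<lambda>i. path_length (a i) / 3) ` {1..n}"
    if "lex_minimal_base TYPE('f) X n a"
    using critical_values[OF PR that base(2)[OF iso[OF that]]] .
  ultimately show ?thesis using iso by blast
qed

end
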